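(* Let $k$ be an algebraically closed field of characteristic $p>0$, let $\mathfrak g$ be a finite dimensional restricted $p$-Lie algebra over $k$, and let $\Gamma$ be the finite group scheme over $k$ with $\mathcal{O}(\Gamma)=u(\mathfrak g)^*$. Then: (1) $H^0(\Gamma,\mathbb{G}_m)=k^\times$ and $H^1(\Gamma,\mathbb{G}_m)=\mathrm{Hom}(\Gamma,\mathbb{G}_m)$. (2) For every $n\ge2$, the assignment $E: Z^n(\Gamma,\mathbb{G}_a)\to Z^n(\Gamma,\mathbb{G}_m)$, $\phi\mapsto E(\phi)$, is a group isomorphism, whose inverse is given by $L:Z^n(\Gamma,\mathbb{G}_m)\to Z^n(\Gamma,\mathbb{G}_a)$, $\Phi\mapsto L(\Phi)$. (3) For every $n\ge3$, the assignment $\mathbf{E}:H^n(\Gamma,\mathbb{G}_a)\to H^n(\Gamma,\mathbb{G}_m)$, $[\phi]\mapsto[E(\phi)]$, is a well defined group isomorphism, whose inverse is given by $\mathbf{L}:H^n(\Gamma,\mathbb{G}_m)\to H^n(\Gamma,\mathbb{G}_a)$, $[\Phi]\mapsto[L(\Phi)]$.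
   Context: $u(\mathfrak g)$ is the restricted enveloping algebra, so $u(\mathfrak g)=k\Gamma$. $\mathcal{O}(\Gamma)$ is a finite dimensional local commutative algebra whose augmentation ideal $I$ satisfies $x^p=0$ for all $x\in I$. $H^n(\Gamma,\mathbb{G}_a)$ is the Hochschild cohomology of $\Gamma$ with trivial coefficients $k$, and $H^n(\Gamma,\mathbb{G}_m)=H^n_{\mathrm{Sw}}(u(\mathfrak g))$ is the Sweedler cohomology of the cocommutative Hopf algebra $u(\mathfrak g)$ with coefficients in the trivial module algebra $k$: $n$-cochains are respectively all elements and the invertible elements of $\mathcal{O}(\Gamma)^{\otimes n}$, with the standard bar differentials built from $\Delta$ (additive, resp. multiplicative). $Z^n$ denotes $n$-cocycles. In positive degrees only normalized cochains are used (applying the counit to any tensor factor gives $0$, resp. $1$), so that $Z^n(\Gamma,\mathbb{G}_a)\subset I^{\otimes n}$ and $Z^n(\Gamma,\mathbb{G}_m)\subset 1+I^{\otimes n}$. For $n\ge2$, $E:(I^{\otimes n},+)\to(1+I^{\otimes n},\times)$ is the unique homomorphism of unipotent algebraic groups with $E(T)=\sum_{j=0}^{p-1}T^j/j!$ for every decomposable $T=a_1\otimes\cdots\otimes a_n$, $a_i\in I$; it is an isomorphism, and $L:=E^{-1}$. *)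

theory Defs
  imports
    "HOL-Computational_Algebra.Computational_Algebra"
    "HOL-Library.Poly_Mapping"
    "HOL-Library.Function_Algebras"
    "HOL-Algebra.Algebra"
begin

section \<open>Restricted Lie algebras\<close>

text \<open>\<open>jacobson_coeff br x y m j\<close> is the coefficient of \<open>t ^ j\<close> in \<open>ad (t x + y) ^ m (x)\<close>.\<close>

primrec jacobson_coeff :: "('g \<Rightarrow> 'g \<Rightarrow> 'g::ab_group_add) \<Rightarrow> 'g \<Rightarrow> 'g \<Rightarrow> nat \<Rightarrow> nat \<Rightarrow> 'g" where
  "jacobson_coeff br x y 0 j = (if j = 0 then x else 0)"
| "jacobson_coeff br x y (Suc m) j =
     (if j = 0 then 0 else br x (jacobson_coeff br x y m (j - 1)))
     + br y (jacobson_coeff br x y m j)"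

text \<open>The sum in \<open>pmap_add\<close> is that of Jacobson's \<open>s\<^sub>i(x, y)\<close>, where \<open>i s\<^sub>i(x, y)\<close> is the
  coefficient of \<open>t ^ (i - 1)\<close> in \<open>ad (t x + y) ^ (p - 1) (x)\<close>.\<close>

locale restricted_lie_algebra = vector_space scale
  for scale :: "'k::field \<Rightarrow> 'g::ab_group_add \<Rightarrow> 'g" +
  fixes br :: "'g \<Rightarrow> 'g \<Rightarrow> 'g" and pmap :: "'g \<Rightarrow> 'g"
  assumes br_add_left: "br (x + y) z = br x z + br y z"
    and br_add_right: "br x (y + z) = br x y + br x z"
    and br_scale_left: "br (scale c x) y = scale c (br x y)"
    and br_scale_right: "br x (scale c y) = scale c (br x y)"
    and br_self: "br x x = 0"
    and jacobi: "br x (br y z) + br y (br z x) + br z (br x y) = 0"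
    and br_pmap: "br (pmap x) y = (br x ^^ CHAR('k)) y"
    and pmap_scale: "pmap (scale c x) = scale (c ^ CHAR('k)) (pmap x)"
    and pmap_add: "pmap (x + y) = pmap x + pmap y
          + (\<Sum>i = 1..<CHAR('k). scale (inverse (of_nat i))
               (jacobson_coeff br x y (CHAR('k) - 1) (i - 1)))"

definition fin_dim :: "('k::field \<Rightarrow> 'g::ab_group_add \<Rightarrow> 'g) \<Rightarrow> bool" where
  "fin_dim scale \<longleftrightarrow> (\<exists>B. finite B \<and> module.span scale B = UNIV)"

section \<open>The restricted enveloping algebra\<close>

text \<open>The free associative algebra on the set \<open>'g\<close> is the monoid algebra \<open>'g fmon \<Rightarrow>\<^sub>0 'k\<close> of the
  free monoid, written additively as \<^typ>\<open>('a, 'b) poly_mapping\<close> requires.\<close>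

datatype 'g fmon = Word (letters: "'g list")

instantiation fmon :: (type) monoid_add
begin

definition zero_fmon :: "'a fmon" where "0 = Word []"

definition plus_fmon :: "'a fmon \<Rightarrow> 'a fmon \<Rightarrow> 'a fmon" where
  "u + v = Word (letters u @ letters v)"

instance
  by standard (auto simp: zero_fmon_def plus_fmon_def)

end

type_synonym ('g, 'k) free_alg = "'g fmon \<Rightarrow>\<^sub>0 'k"

definition word_elem :: "'g list \<Rightarrow> ('g, 'k::field) free_alg" where
  "word_elem w = Poly_Mapping.single (Word w) 1"

definition scalar :: "'k::field \<Rightarrow> ('g, 'k) free_alg" where
  "scalar c = Poly_Mapping.single 0 c"

abbreviation gen :: "'g \<Rightarrow> ('g, 'k::field) free_alg" where
  "gen x \<equiv> word_elem [x]"

inductive_set two_sided_ideal :: "'a::ring_1 set \<Rightarrow> 'a set" for S where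
  zero: "0 \<in> two_sided_ideal S"
| gens: "s \<in> S \<Longrightarrow> a * s * b \<in> two_sided_ideal S"
| add: "a \<in> two_sided_ideal S \<Longrightarrow> b \<in> two_sided_ideal S \<Longrightarrow> a + b \<in> two_sided_ideal S"

definition u_relations ::
  "('k::field \<Rightarrow> 'g::ab_group_add \<Rightarrow> 'g) \<Rightarrow> ('g \<Rightarrow> 'g \<Rightarrow> 'g) \<Rightarrow> ('g \<Rightarrow> 'g) \<Rightarrow> ('g, 'k) free_alg set" where
  "u_relations scale br pmap =
     {gen (x + y) - gen x - gen y | x y. True}
     \<union> {gen (scale c x) - scalar c * gen x | c x. True}
     \<union> {gen x * gen y - gen y * gen x - gen (br x y) | x y. True}
     \<union> {gen x ^ CHAR('k) - gen (pmap x) | x. True}"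

text \<open>The elements of \<open>u(\<gg>)\<close> are the cosets \<open>u_class scale br pmap a\<close>.\<close>

definition u_class ::
  "('k::field \<Rightarrow> 'g::ab_group_add \<Rightarrow> 'g) \<Rightarrow> ('g \<Rightarrow> 'g \<Rightarrow> 'g) \<Rightarrow> ('g \<Rightarrow> 'g)
    \<Rightarrow> ('g, 'k) free_alg \<Rightarrow> ('g, 'k) free_alg set" where
  "u_class scale br pmap a = {b. b - a \<in> two_sided_ideal (u_relations scale br pmap)}"

definition u_dual ::
  "('k::field \<Rightarrow> 'g::ab_group_add \<Rightarrow> 'g) \<Rightarrow> ('g \<Rightarrow> 'g \<Rightarrow> 'g) \<Rightarrow> ('g \<Rightarrow> 'g)
    \<Rightarrow> (('g, 'k) free_alg set \<Rightarrow> 'k) set" where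
  "u_dual scale br pmap =
     {f. (\<forall>a b. f (u_class scale br pmap (a + b))
                = f (u_class scale br pmap a) + f (u_class scale br pmap b))
       \<and> (\<forall>c a. f (u_class scale br pmap (scalar c * a)) = c * f (u_class scale br pmap a))}"

text \<open>A functional \<open>f\<close> on \<open>u(\<gg>)\<close> is recorded by its values \<open>f(x\<^sub>1 \<cdots> x\<^sub>m)\<close> on the monomials in
  elements of \<open>\<gg>\<close>, which span \<open>u(\<gg>)\<close>. This embeds \<open>\<O>(\<Gamma>) = u(\<gg>)\<^sup>*\<close> into \<open>'g list \<Rightarrow> 'k\<close>.\<close>

definition coord_ring ::
  "('k::field \<Rightarrow> 'g::ab_group_add \<Rightarrow> 'g) \<Rightarrow> ('g \<Rightarrow> 'g \<Rightarrow> 'g) \<Rightarrow> ('g \<Rightarrow> 'g) \<Rightarrow> ('g list \<Rightarrow> 'k) set" where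
  "coord_ring scale br pmap = (\<lambda>f w. f (u_class scale br pmap (word_elem w))) ` u_dual scale br pmap"

text \<open>The counit of \<open>\<O>(\<Gamma>)\<close> is evaluation at \<open>1 \<in> u(\<gg>)\<close>, the empty monomial.\<close>

definition aug_ideal :: "('g list \<Rightarrow> 'k::field) set \<Rightarrow> ('g list \<Rightarrow> 'k) set" where
  "aug_ideal A = {a \<in> A. a [] = 0}"

section \<open>Tensor powers\<close>

text \<open>For a space \<open>V\<close> of functions on words, \<open>V\<^sup>\<otimes>\<^sup>n\<close> is realised inside the functions on \<open>n\<close>-tuples
  of words, extended by \<open>0\<close> to lists of other lengths: \<open>a\<^sub>1 \<otimes> \<dots> \<otimes> a\<^sub>n\<close> is the function
  \<open>(w\<^sub>1, \<dots>, w\<^sub>n) \<mapsto> a\<^sub>1(w\<^sub>1) \<cdots> a\<^sub>n(w\<^sub>n)\<close>.\<close>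

type_synonym ('g, 'k) cochain = "'g list list \<Rightarrow> 'k"

definition pure_tensor :: "('g list \<Rightarrow> 'k::field) list \<Rightarrow> ('g, 'k) cochain" where
  "pure_tensor as ws =
     (if length ws = length as then \<Prod>i<length as. (as ! i) (ws ! i) else 0)"

definition tensor_power :: "('g list \<Rightarrow> 'k::field) set \<Rightarrow> nat \<Rightarrow> ('g, 'k) cochain set" where
  "tensor_power V n = module.span (\<lambda>c \<phi> ws. c * \<phi> ws)
     {pure_tensor as | as. length as = n \<and> set as \<subseteq> V}"

text \<open>In \<open>u(\<gg>)\<close> one has \<open>\<Delta>(x\<^sub>1 \<cdots> x\<^sub>m) = (x\<^sub>1 \<otimes> 1 + 1 \<otimes> x\<^sub>1) \<cdots> (x\<^sub>m \<otimes> 1 + 1 \<otimes> x\<^sub>m)\<close>; \<open>splits w\<close> lists the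
  pairs of monomials in the expansion, and \<open>splits_list\<close> does the same in each tensor factor. The
  product of \<open>\<O>(\<Gamma>)\<^sup>\<otimes>\<^sup>n\<close> is dual to this comultiplication.\<close>

fun splits :: "'g list \<Rightarrow> ('g list \<times> 'g list) list" where
  "splits [] = [([], [])]"
| "splits (x # w) = map (\<lambda>(u, v). (x # u, v)) (splits w) @ map (\<lambda>(u, v). (u, x # v)) (splits w)"

fun splits_list :: "'g list list \<Rightarrow> ('g list list \<times> 'g list list) list" where
  "splits_list [] = [([], [])]"
| "splits_list (w # ws) =
     concat (map (\<lambda>(u, v). map (\<lambda>(us, vs). (u # us, v # vs)) (splits_list ws)) (splits w))"

definition conv :: "('g, 'k::field) cochain \<Rightarrow> ('g, 'k) cochain \<Rightarrow> ('g, 'k) cochain" where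
  "conv \<Phi> \<Psi> ws = (\<Sum>(us, vs)\<leftarrow>splits_list ws. \<Phi> us * \<Psi> vs)"

definition unit_cochain :: "nat \<Rightarrow> ('g, 'k::field) cochain" where
  "unit_cochain n ws = (if ws = replicate n [] then 1 else 0)"

definition cochain_ring :: "('g list \<Rightarrow> 'k::field) set \<Rightarrow> nat \<Rightarrow> ('g, 'k) cochain ring" where
  "cochain_ring A n = \<lparr>carrier = tensor_power A n, mult = conv, one = unit_cochain n,
     ring.zero = (\<lambda>_. 0), ring.add = (\<lambda>\<phi> \<psi> ws. \<phi> ws + \<psi> ws)\<rparr>"

section \<open>Cochains, cocycles and cohomology\<close>

text \<open>The comultiplication of \<open>\<O>(\<Gamma>)\<close> is \<open>(\<Delta> a)(u \<otimes> v) = a(u v)\<close>, so \<open>face i n\<close> is \<open>\<phi> \<mapsto> 1 \<otimes> \<phi>\<close> for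
  \<open>i = 0\<close>, \<open>\<phi> \<mapsto> \<phi> \<otimes> 1\<close> for \<open>i = n + 1\<close>, and otherwise \<open>\<Delta>\<close> applied to the \<open>i\<close>-th tensor factor
  (counting from \<open>1\<close>).\<close>

definition face :: "nat \<Rightarrow> nat \<Rightarrow> ('g, 'k::field) cochain \<Rightarrow> ('g, 'k) cochain" where
  "face i n \<phi> ws =
     (if length ws \<noteq> Suc n then 0
      else if i = 0 then (if hd ws = [] then \<phi> (tl ws) else 0)
      else if i = Suc n then (if last ws = [] then \<phi> (butlast ws) else 0)
      else \<phi> (take (i - 1) ws @ [ws ! (i - 1) @ ws ! i] @ drop (i + 1) ws))"

text \<open>The counit applied to the tensor factor number \<open>i\<close> (counting from \<open>0\<close>).\<close>

definition counit_at :: "nat \<Rightarrow> ('g, 'k::field) cochain \<Rightarrow> ('g, 'k) cochain" where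
  "counit_at i \<phi> ws = \<phi> (take i ws @ [[]] @ drop i ws)"

text \<open>In degree \<open>0\<close> the normalisation conditions below are vacuous.\<close>

definition C_add :: "('g list \<Rightarrow> 'k::field) set \<Rightarrow> nat \<Rightarrow> ('g, 'k) cochain set" where
  "C_add A n = {\<phi> \<in> tensor_power A n. \<forall>i<n. counit_at i \<phi> = (\<lambda>_. 0)}"

definition C_mult :: "('g list \<Rightarrow> 'k::field) set \<Rightarrow> nat \<Rightarrow> ('g, 'k) cochain set" where
  "C_mult A n = {\<Phi> \<in> Units (cochain_ring A n). \<forall>i<n. counit_at i \<Phi> = unit_cochain (n - 1)}"

definition d_add :: "nat \<Rightarrow> ('g, 'k::field) cochain \<Rightarrow> ('g, 'k) cochain" where
  "d_add n \<phi> ws = (\<Sum>i\<le>Suc n. (- 1) ^ i * face i n \<phi> ws)"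

definition d_mult ::
  "('g list \<Rightarrow> 'k::field) set \<Rightarrow> nat \<Rightarrow> ('g, 'k) cochain \<Rightarrow> ('g, 'k) cochain" where
  "d_mult A n \<Phi> = finprod (cochain_ring A (Suc n))
     (\<lambda>i. face i n \<Phi> [^]\<^bsub>cochain_ring A (Suc n)\<^esub> ((- 1) ^ i :: int)) {..Suc n}"

definition Z_add :: "('g list \<Rightarrow> 'k::field) set \<Rightarrow> nat \<Rightarrow> ('g, 'k) cochain monoid" where
  "Z_add A n = (add_monoid (cochain_ring A n))
     \<lparr>carrier := {\<phi> \<in> C_add A n. d_add n \<phi> = (\<lambda>_. 0)}\<rparr>"

definition Z_mult :: "('g list \<Rightarrow> 'k::field) set \<Rightarrow> nat \<Rightarrow> ('g, 'k) cochain monoid" where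
  "Z_mult A n = (units_of (cochain_ring A n))
     \<lparr>carrier := {\<Phi> \<in> C_mult A n. d_mult A n \<Phi> = unit_cochain (Suc n)}\<rparr>"

definition B_add :: "('g list \<Rightarrow> 'k::field) set \<Rightarrow> nat \<Rightarrow> ('g, 'k) cochain set" where
  "B_add A n = (case n of 0 \<Rightarrow> {\<lambda>_. 0} | Suc m \<Rightarrow> d_add m ` C_add A m)"

definition B_mult :: "('g list \<Rightarrow> 'k::field) set \<Rightarrow> nat \<Rightarrow> ('g, 'k) cochain set" where
  "B_mult A n = (case n of 0 \<Rightarrow> {unit_cochain 0} | Suc m \<Rightarrow> d_mult A m ` C_mult A m)"

definition H_add :: "('g list \<Rightarrow> 'k::field) set \<Rightarrow> nat \<Rightarrow> ('g, 'k) cochain set monoid" where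
  "H_add A n = Z_add A n Mod B_add A n"

definition H_mult :: "('g list \<Rightarrow> 'k::field) set \<Rightarrow> nat \<Rightarrow> ('g, 'k) cochain set monoid" where
  "H_mult A n = Z_mult A n Mod B_mult A n"

definition cls_add ::
  "('g list \<Rightarrow> 'k::field) set \<Rightarrow> nat \<Rightarrow> ('g, 'k) cochain \<Rightarrow> ('g, 'k) cochain set" where
  "cls_add A n \<phi> = B_add A n #>\<^bsub>Z_add A n\<^esub> \<phi>"

definition cls_mult ::
  "('g list \<Rightarrow> 'k::field) set \<Rightarrow> nat \<Rightarrow> ('g, 'k) cochain \<Rightarrow> ('g, 'k) cochain set" where
  "cls_mult A n \<Phi> = B_mult A n #>\<^bsub>Z_mult A n\<^esub> \<Phi>"

section \<open>The maps \<open>E\<close> and \<open>L\<close>\<close>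

definition one_plus :: "('g list \<Rightarrow> 'k::field) set \<Rightarrow> nat \<Rightarrow> ('g, 'k) cochain set" where
  "one_plus A n = {\<lambda>ws. unit_cochain n ws + \<phi> ws | \<phi>. \<phi> \<in> tensor_power (aug_ideal A) n}"

text \<open>Polynomial functions on a space of functions \<open>'x \<Rightarrow> 'k\<close>. On a finite dimensional subspace the
  evaluations at points span the linear functionals, so that the restrictions of these functions
  are its regular functions.\<close>

inductive_set poly_fun :: "(('x \<Rightarrow> 'k::field) \<Rightarrow> 'k) set" where
  "(\<lambda>_. c) \<in> poly_fun"
| "(\<lambda>T. T x) \<in> poly_fun"
| "f \<in> poly_fun \<Longrightarrow> g \<in> poly_fun \<Longrightarrow> (\<lambda>T. f T + g T) \<in> poly_fun"
| "f \<in> poly_fun \<Longrightarrow> g \<in> poly_fun \<Longrightarrow> (\<lambda>T. f T * g T) \<in> poly_fun"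

definition alg_group_hom_E ::
  "('g list \<Rightarrow> 'k::field) set \<Rightarrow> nat \<Rightarrow> (('g, 'k) cochain \<Rightarrow> ('g, 'k) cochain) \<Rightarrow> bool" where
  "alg_group_hom_E A n e \<longleftrightarrow>
     e \<in> hom ((add_monoid (cochain_ring A n))\<lparr>carrier := tensor_power (aug_ideal A) n\<rparr>)
             ((units_of (cochain_ring A n))\<lparr>carrier := one_plus A n\<rparr>)
     \<and> (\<forall>ws. \<exists>q \<in> poly_fun. \<forall>T \<in> tensor_power (aug_ideal A) n. e T ws = q T)
     \<and> (\<forall>as. length as = n \<and> set as \<subseteq> aug_ideal A \<longrightarrow>
          e (pure_tensor as) = (\<lambda>ws. \<Sum>j<CHAR('k).
            (pure_tensor as [^]\<^bsub>cochain_ring A n\<^esub> j) ws / of_nat (fact j)))"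

definition E_map ::
  "('g list \<Rightarrow> 'k::field) set \<Rightarrow> nat \<Rightarrow> ('g, 'k) cochain \<Rightarrow> ('g, 'k) cochain" where
  "E_map A n = (THE e. e \<in> extensional (tensor_power (aug_ideal A) n) \<and> alg_group_hom_E A n e)"

definition L_map ::
  "('g list \<Rightarrow> 'k::field) set \<Rightarrow> nat \<Rightarrow> ('g, 'k) cochain \<Rightarrow> ('g, 'k) cochain" where
  "L_map A n = inv_into (tensor_power (aug_ideal A) n) (E_map A n)"

section \<open>Characters\<close>

text \<open>\<open>\<O>(\<G>\<^sub>m) = k[t, t\<^sup>-\<^sup>1]\<close> is the group algebra \<open>int \<Rightarrow>\<^sub>0 'k\<close>, with \<open>\<Delta>(t\<^sup>m) = t\<^sup>m \<otimes> t\<^sup>m\<close> and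
  \<open>\<epsilon>(t\<^sup>m) = 1\<close>. A homomorphism of group schemes \<open>\<Gamma> \<rightarrow> \<G>\<^sub>m\<close> is a homomorphism of Hopf algebras
  \<open>\<O>(\<G>\<^sub>m) \<rightarrow> \<O>(\<Gamma>)\<close>; compatibility with \<open>\<Delta>\<close> and \<open>\<epsilon>\<close> is stated on the basis \<open>t\<^sup>m\<close>. The product of
  two characters is their convolution, \<open>t\<^sup>m \<mapsto> h(t\<^sup>m) h'(t\<^sup>m)\<close>. Elements of \<open>\<O>(\<Gamma>)\<close> are taken in the
  form of elements of \<open>\<O>(\<Gamma>)\<^sup>\<otimes>\<^sup>1\<close>.\<close>

definition lpow :: "int \<Rightarrow> (int \<Rightarrow>\<^sub>0 'k::field)" where
  "lpow m = Poly_Mapping.single m 1"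

definition hopf_hom_Gm ::
  "('g list \<Rightarrow> 'k::field) set \<Rightarrow> ((int \<Rightarrow>\<^sub>0 'k) \<Rightarrow> ('g, 'k) cochain) \<Rightarrow> bool" where
  "hopf_hom_Gm A h \<longleftrightarrow>
     (\<forall>P. h P \<in> carrier (cochain_ring A 1))
     \<and> h 1 = unit_cochain 1
     \<and> (\<forall>P Q. h (P * Q) = conv (h P) (h Q))
     \<and> (\<forall>P Q ws. h (P + Q) ws = h P ws + h Q ws)
     \<and> (\<forall>c P ws. h (Poly_Mapping.single 0 c * P) ws = c * h P ws)
     \<and> (\<forall>m u v. h (lpow m) [u @ v] = h (lpow m) [u] * h (lpow m) [v])
     \<and> (\<forall>m. h (lpow m) [[]] = 1)"

definition Hom_Gm ::
  "('g list \<Rightarrow> 'k::field) set \<Rightarrow> ((int \<Rightarrow>\<^sub>0 'k) \<Rightarrow> ('g, 'k) cochain) monoid" where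
  "Hom_Gm A = \<lparr>carrier = {h. hopf_hom_Gm A h},
     mult = (\<lambda>h h' P ws. \<Sum>m\<in>Poly_Mapping.keys P.
               Poly_Mapping.lookup P m * conv (h (lpow m)) (h' (lpow m)) ws),
     one = (\<lambda>P ws. \<Sum>m\<in>Poly_Mapping.keys P. Poly_Mapping.lookup P m * unit_cochain 1 ws)\<rparr>"

definition mult_group_of_field :: "'k::field monoid" where
  "mult_group_of_field = \<lparr>carrier = UNIV - {0}, mult = (*), one = 1\<rparr>"

definition group_iso ::
  "('a \<Rightarrow> 'b) \<Rightarrow> ('a, 'c) monoid_scheme \<Rightarrow> ('b, 'd) monoid_scheme \<Rightarrow> bool" where
  "group_iso f G H \<longleftrightarrow> group G \<and> group H \<and> f \<in> iso G H"

end

theory Submission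
  imports Defs
begin

text \<open>All functions on \<open>n\<close>-tuples of words form a commutative algebra under \<^const>\<open>conv\<close> (a shuffle
  algebra), which has divided powers in every characteristic. Its exponential \<open>EE\<close> is the solution
  of \<open>\<partial> (EE T) = EE T \<cdot> \<partial> T\<close>, where \<open>\<partial>\<close> is the derivation that strips a first letter. Uniqueness for
  this equation shows that \<open>EE\<close> turns sums into products and commutes with all face maps. As
  \<open>\<partial> (T\<^sup>p) = p T\<^sup>p\<^sup>-\<^sup>1 \<partial> T = 0\<close>, the \<open>p\<close>-th power of an element without constant term vanishes, and hence
  on decomposable tensors with at least two factors \<open>EE\<close> is the truncated exponential, i.e. it is
  the map \<open>E\<close>. So \<open>E\<close> intertwines the additive with the multiplicative differential. That \<open>E\<close> maps
  \<open>I\<^sup>\<otimes>\<^sup>n\<close> onto \<open>1 + I\<^sup>\<otimes>\<^sup>n\<close> follows by successive approximation along the filtration of the first tensor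
  factor by word length, which is finite because \<open>u(\<gg>)\<close> is spanned by words of bounded length.\<close>


text \<open>Since \<open>EE\<close> is defined on every function on tuples of words, no choice of a
  decomposition of a tensor into decomposable ones is ever made; facts about I^{\<otimes>n} serve
  only to show that the exponential stays inside the coordinate ring. The bound n \<ge> 2 has the
  following source. For X = a \<otimes> T the truncated exponential fails the differential equation
  by the single term X^(p-1) \<partial>X / (p-1)!, and X^(p-1) \<partial>X = (a^(p-1) \<partial>a)
  \<otimes> T^p. This is zero as soon as T has no constant term. With one factor only, a^(p-1)
  \<partial>a need not vanish, the higher divided powers of a survive in the exponential, and the
  result may fail to descend to the restricted enveloping algebra. This is also why degrees 0 and 1
  are computed by hand, from the explicit cocycle condition. Characteristic p is used in three ways:
  p-th powers of functions without constant term vanish, the p-th power of a primitive element is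
  primitive (so functionals on the restricted enveloping algebra are closed under the product), and
  a p-fold letter can be replaced by a single one (so words of bounded length suffice).\<close>

lemma words_induct [case_names Nil Empty Letter]:
  assumes "P []" "\<And>ws. P ws \<Longrightarrow> P ([] # ws)"
    "\<And>x w ws. P (w # ws) \<Longrightarrow> P ((x # w) # ws)"
  shows "P ws"
proof (induction ws)
  case Nil
  show ?case by (rule assms(1))
next
  case (Cons w ws)
  show ?case by (induction w) (use Cons assms in auto)
qed

lemma sum_list_concat_map:
  "(\<Sum>x\<leftarrow>concat (map f xs). g x) = (\<Sum>y\<leftarrow>xs. \<Sum>x\<leftarrow>f y. g x)"
  by (induction xs) auto

text \<open>The comultiplication of the free algebra is an algebra homomorphism: on monomials,
  \<Delta>(uv) = \<Delta>(u) \<Delta>(v).\<close>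

lemma splits_append:
  "splits (u @ v)
     = concat (map (\<lambda>(a, b). map (\<lambda>(c, d). (a @ c, b @ d)) (splits v)) (splits u))"
  by (induction u) (auto simp: map_concat comp_def case_prod_unfold)

lemma splits_length: "(u, v) \<in> set (splits w) \<Longrightarrow> length u + length v = length w"
  by (induction w arbitrary: u v) force+

definition vol :: "'g list list \<Rightarrow> nat" where
  "vol ws = sum_list (map length ws)"

lemma splits_list_length:
  "(us, vs) \<in> set (splits_list ws) \<Longrightarrow>
     length us = length ws \<and> length vs = length ws \<and> vol us + vol vs = vol ws"
proof (induction ws arbitrary: us vs)
  case (Cons w ws)
  from Cons.prems obtain u v us' vs' where *: "(u, v) \<in> set (splits w)"
      "(us', vs') \<in> set (splits_list ws)" "us = u # us'" "vs = v # vs'"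
    by auto
  show ?case
    using splits_length[OF *(1)] Cons.IH[OF *(2)] *(3,4) by (simp add: vol_def)
qed (auto simp: vol_def)

section \<open>The algebra of all functions on tuples of words\<close>

definition fix_empty :: "('g, 'k::field) cochain \<Rightarrow> ('g, 'k) cochain" where
  "fix_empty F ws = F ([] # ws)"

text \<open>The value 0 on the empty tuple is the one compatible with the Leibniz rule there, and it
  also lets the last face map commute with \<open>lder x\<close>. Together, \<open>lder\<close> and
  \<open>fix_empty\<close> reduce an identity of functions to shorter tuples, in the pattern of
  \<open>words_induct\<close>.\<close>

definition lder :: "'g \<Rightarrow> ('g, 'k::field) cochain \<Rightarrow> ('g, 'k) cochain" where
  "lder x F ws = (case ws of [] \<Rightarrow> 0 | w # ws \<Rightarrow> F ((x # w) # ws))"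

definition smul :: "'k::field \<Rightarrow> ('x \<Rightarrow> 'k) \<Rightarrow> 'x \<Rightarrow> 'k" where
  "smul c F = (\<lambda>ws. c * F ws)"

definition sconv :: "('g list \<Rightarrow> 'k::field) \<Rightarrow> ('g list \<Rightarrow> 'k) \<Rightarrow> 'g list \<Rightarrow> 'k" where
  "sconv a b w = (\<Sum>(u, v)\<leftarrow>splits w. a u * b v)"

definition tcons :: "('g list \<Rightarrow> 'k::field) \<Rightarrow> ('g, 'k) cochain \<Rightarrow> ('g, 'k) cochain" where
  "tcons a T ws = (case ws of [] \<Rightarrow> 0 | w # ws \<Rightarrow> a w * T ws)"

lemma lder_simps [simp]: "lder x F [] = 0" "lder x F (w # ws) = F ((x # w) # ws)"
  by (simp_all add: lder_def)

lemma conv_slices: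
  "conv F G (w # ws) = (\<Sum>(u, v)\<leftarrow>splits w. conv (\<lambda>us. F (u # us)) (\<lambda>vs. G (v # vs)) ws)"
  by (simp add: conv_def sum_list_concat_map comp_def case_prod_unfold)

lemma conv_Nil [simp]: "conv F G [] = F [] * G []"
  by (simp add: conv_def)

lemma conv_Empty [simp]: "conv F G ([] # ws) = conv (fix_empty F) (fix_empty G) ws"
  by (simp add: conv_slices fix_empty_def[abs_def])

text \<open>A letter is primitive, so the first letter goes entirely to one of the two arguments.
  This is the Leibniz rule for stripping it.\<close>

lemma conv_Letter [simp]:
  "conv F G ((x # w) # ws) = conv (lder x F) G (w # ws) + conv F (lder x G) (w # ws)"
  by (simp add: conv_slices comp_def case_prod_unfold)

lemma fix_empty_conv: "fix_empty (conv F G) = conv (fix_empty F) (fix_empty G)"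
  by (rule ext) (simp add: fix_empty_def[of "conv F G"])

lemma conv_add_left: "conv (F + G) H = conv F H + conv G H"
  by (rule ext) (simp add: conv_def case_prod_unfold ring_distribs sum_list_addf)

lemma conv_add_right: "conv H (F + G) = conv H F + conv H G"
  by (rule ext) (simp add: conv_def case_prod_unfold ring_distribs sum_list_addf)

lemma conv_smul_left: "conv (smul c F) G = smul c (conv F G)"
  by (rule ext) (simp add: conv_def smul_def case_prod_unfold sum_list_const_mult mult.assoc)

lemma conv_smul_right: "conv F (smul c G) = smul c (conv F G)"
  by (rule ext) (simp add: conv_def smul_def case_prod_unfold sum_list_const_mult mult.left_commute)

lemma conv_zero_left [simp]: "conv 0 F = 0"
  by (rule ext) (simp add: conv_def case_prod_unfold)

lemma conv_zero_right [simp]: "conv F 0 = 0"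
  by (rule ext) (simp add: conv_def case_prod_unfold)

lemma lder_conv: "lder x (conv F G) = conv (lder x F) G + conv F (lder x G)"
proof
  fix ws show "lder x (conv F G) ws = (conv (lder x F) G + conv F (lder x G)) ws"
    by (cases ws) simp_all
qed

lemma fix_empty_linear [simp]:
  "fix_empty 0 = 0" "fix_empty (F + G) = fix_empty F + fix_empty G"
  "fix_empty (smul c F) = smul c (fix_empty F)"
  by (rule ext, simp add: fix_empty_def smul_def)+

lemma lder_linear [simp]:
  "lder x 0 = 0" "lder x (F + G) = lder x F + lder x G"
  "lder x (smul c F) = smul c (lder x F)"
  by (rule ext, simp add: lder_def smul_def split: list.split)+

lemma conv_commute: "conv F G = conv G F"
proof
  fix ws show "conv F G ws = conv G F ws"
    by (induction ws arbitrary: F G rule: words_induct) (simp_all add: add.commute mult.commute)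
qed

lemma conv_assoc: "conv (conv F G) H = conv F (conv G H)"
proof
  fix ws show "conv (conv F G) H ws = conv F (conv G H) ws"
    by (induction ws arbitrary: F G H rule: words_induct)
      (simp_all add: mult.assoc fix_empty_conv lder_conv conv_add_left conv_add_right)
qed

lemma conv_left_commute: "conv F (conv G H) = conv G (conv F H)"
  by (metis conv_assoc conv_commute)

lemmas conv_ac = conv_assoc conv_commute conv_left_commute

text \<open>Splitting a tuple keeps its length and never increases the number of letters. This bound
  is what makes convolution usable inside inductions on the size of a tuple.\<close>

lemma conv_cong:
  assumes "\<And>us. length us = length ws \<Longrightarrow> vol us \<le> vol ws \<Longrightarrow> F us = F' us"
    and "\<And>us. length us = length ws \<Longrightarrow> vol us \<le> vol ws \<Longrightarrow> G us = G' us"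
  shows "conv F G ws = conv F' G' ws"
  unfolding conv_def
proof (intro arg_cong[where f = sum_list] map_cong refl, clarify)
  fix us vs assume "(us, vs) \<in> set (splits_list ws)"
  then show "F us * G vs = F' us * G' vs"
    using splits_list_length[of us vs ws] assms[of us] assms[of vs] by simp
qed

text \<open>This is the unit for functions on tuples of all lengths at once;
  \<open>unit_cochain n\<close> is its part in length \<open>n\<close>.\<close>

definition all_one :: "('g, 'k::field) cochain" where
  "all_one ws = (if set ws \<subseteq> {[]} then 1 else 0)"

lemma all_one_simps [simp]: "all_one [] = 1" "all_one ([] # ws) = all_one ws"
    "all_one ((x # w) # ws) = 0" "fix_empty all_one = all_one" "lder x all_one = 0"
  by (auto simp: all_one_def fix_empty_def fun_eq_iff lder_def split: list.split)

lemma conv_all_one: "conv all_one F = F"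
proof
  fix ws show "conv all_one F ws = F ws"
    by (induction ws arbitrary: F rule: words_induct) (simp_all add: fix_empty_def)
qed

definition supported :: "nat \<Rightarrow> ('g, 'k::field) cochain \<Rightarrow> bool" where
  "supported n F \<longleftrightarrow> (\<forall>ws. length ws \<noteq> n \<longrightarrow> F ws = 0)"

lemma unit_cochain_eq: "unit_cochain n ws = (if length ws = n then all_one ws else 0)"
  by (auto simp: unit_cochain_def all_one_def replicate_eqI subset_iff)

lemma supported_unit [simp]: "supported n (unit_cochain n)"
  by (simp add: supported_def unit_cochain_eq)

lemma conv_length_cong:
  assumes "\<And>us. length us = length ws \<Longrightarrow> F us = F' us"
    and "\<And>us. length us = length ws \<Longrightarrow> G us = G' us"
  shows "conv F G ws = conv F' G' ws"
  by (rule conv_cong) (use assms in auto)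

lemma supported_conv: "supported n F \<Longrightarrow> supported n (conv F G)"
  unfolding supported_def
  by (metis (no_types, lifting) conv_length_cong conv_zero_left zero_fun_apply)

lemma conv_unit: "supported n F \<Longrightarrow> conv (unit_cochain n) F = F"
proof
  fix ws assume F: "supported n F"
  show "conv (unit_cochain n) F ws = F ws"
  proof (cases "length ws = n")
    case True
    have "conv (unit_cochain n) F ws = conv all_one F ws"
      by (rule conv_length_cong) (auto simp: True unit_cochain_eq)
    then show ?thesis by (simp add: conv_all_one)
  next
    case False
    then show ?thesis
      using F supported_conv[OF supported_unit[of n], of F] by (simp add: supported_def)
  qed
qed

lemma conv_unit_right: "supported n F \<Longrightarrow> conv F (unit_cochain n) = F"
  by (simp add: conv_unit conv_commute[of F])

section \<open>Powers\<close>

primrec cpow :: "nat \<Rightarrow> ('g, 'k::field) cochain \<Rightarrow> nat \<Rightarrow> ('g, 'k) cochain" where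
  "cpow n T 0 = unit_cochain n"
| "cpow n T (Suc j) = conv (cpow n T j) T"

lemma nat_pow_cochain_ring: "T [^]\<^bsub>cochain_ring A n\<^esub> (j::nat) = cpow n T j"
  by (induction j) (simp_all add: cochain_ring_def nat_pow_def)

lemma supported_cpow [simp]: "supported n (cpow n T j)"
  by (induction j) (simp_all add: supported_conv)

lemma fix_empty_unit [simp]: "fix_empty (unit_cochain (Suc n)) = unit_cochain n"
  by (rule ext) (simp add: fix_empty_def unit_cochain_eq)

lemma lder_unit [simp]: "lder x (unit_cochain n) = 0"
  by (rule ext) (simp add: lder_def unit_cochain_eq split: list.split)

lemma fix_empty_cpow: "fix_empty (cpow (Suc n) T j) = cpow n (fix_empty T) j"
  by (induction j) (simp_all add: fix_empty_conv)

lemma supported_lder: "supported n F \<Longrightarrow> supported n (lder x F)"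
  by (simp add: supported_def lder_def split: list.split)

lemma supported_fix_empty: "supported (Suc n) F \<Longrightarrow> supported n (fix_empty F)"
  by (simp add: supported_def fix_empty_def)

lemma lder_cpow:
  assumes "supported n T"
  shows "lder x (cpow n T (Suc j)) = smul (of_nat (Suc j)) (conv (cpow n T j) (lder x T))"
proof (induction j)
  case 0
  show ?case
    by (simp add: lder_conv conv_unit supported_lder assms) (simp add: smul_def)
next
  case (Suc j)
  have "lder x (cpow n T (Suc (Suc j)))
      = smul (of_nat (Suc j)) (conv (conv (cpow n T j) (lder x T)) T)
        + conv (cpow n T (Suc j)) (lder x T)"
    by (simp only: cpow.simps(2)[of n T "Suc j"] lder_conv Suc conv_smul_left)
  also have "conv (conv (cpow n T j) (lder x T)) T = conv (cpow n T (Suc j)) (lder x T)"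
    by (simp add: conv_ac)
  finally show ?case
    by (simp add: smul_def fun_eq_iff ring_distribs)
qed

text \<open>Vanishing derivatives only reduce the claim to a tuple of empty words, where the power
  is the \<open>p\<close>-th power of the constant term; hence the third hypothesis. Tuples of a
  length other than \<open>n\<close> are settled by the support of \<open>cpow\<close>.\<close>

lemma cpow_char:
  fixes T :: "('g, 'k::field) cochain"
  assumes "CHAR('k) > 0" "supported n T" "T (replicate n []) = 0"
  shows "cpow n T CHAR('k) = 0"
proof
  fix ws :: "'g list list"
  obtain q where q: "CHAR('k) = Suc q" using assms(1) gr0_conv_Suc by blast
  show "cpow n T CHAR('k) ws = 0 ws"
    using assms(2,3)
  proof (induction ws arbitrary: n T rule: words_induct)
    case Nil
    show ?case
    proof (cases n)
      case 0
      then show ?thesis using Nil by (simp add: q)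
    next
      case (Suc m)
      then show ?thesis
        using supported_cpow[of "Suc m" T "CHAR('k)"] by (simp add: supported_def)
    qed
  next
    case (Empty ws)
    show ?case
    proof (cases n)
      case 0
      then show ?thesis using supported_cpow[of 0 T "CHAR('k)"] by (simp add: supported_def)
    next
      case (Suc m)
      have "cpow n T CHAR('k) ([] # ws) = fix_empty (cpow n T CHAR('k)) ws"
        by (simp add: fix_empty_def)
      also have "\<dots> = 0"
        using Empty.IH[of m "fix_empty T"] Empty.prems Suc
        by (simp add: fix_empty_cpow supported_fix_empty) (simp add: fix_empty_def)
      finally show ?thesis by simp
    qed
  next
    case (Letter x w ws)
    have "cpow n T CHAR('k) ((x # w) # ws) = lder x (cpow n T CHAR('k)) (w # ws)"
      by simp
    also have "\<dots> = of_nat CHAR('k) * conv (cpow n T q) (lder x T) (w # ws)"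
      unfolding q using lder_cpow[OF Letter.prems(1), of x q] by (simp add: smul_def del: of_nat_Suc)
    finally show ?case by simp
  qed
qed

section \<open>The exponential\<close>

text \<open>The third equation is \<partial>(EE T) = EE T \<cdot> \<partial>T with
  \<open>conv\<close> written out, so that the termination proof sees the recursive calls: after the
  first letter is stripped, both parts of a splitting have fewer letters than the original tuple.
  The constant term of \<open>T\<close> is ignored, and the value at a tuple of empty words is
  1.\<close>

function EE :: "('g, 'k::field) cochain \<Rightarrow> ('g, 'k) cochain" where
  "EE T [] = 1"
| "EE T ([] # ws) = EE (fix_empty T) ws"
| "EE T ((x # w) # ws) = (\<Sum>(us, vs)\<leftarrow>splits_list (w # ws). EE T us * lder x T vs)"
  by pat_completeness auto
termination
proof (relation "measure (\<lambda>(T, ws). length ws + vol ws)", goal_cases)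
  case (3 T x w ws z us vs)
  then show ?case using splits_list_length[of us vs "w # ws"] by (auto simp: vol_def)
qed (auto simp: vol_def)

declare EE.simps(3) [simp del]

lemma EE_Letter [simp]: "EE T ((x # w) # ws) = conv (EE T) (lder x T) (w # ws)"
  by (simp add: EE.simps(3) conv_def)

lemma fix_empty_EE: "fix_empty (EE T) = EE (fix_empty T)"
  by (rule ext) (simp add: fix_empty_def[of "EE T"])

lemma lder_EE: "lder x (EE T) = conv (EE T) (lder x T)"
proof
  fix ws show "lder x (EE T) ws = conv (EE T) (lder x T) ws"
    by (cases ws) simp_all
qed

text \<open>Convolution evaluates its arguments at all parts of a splitting, so the letter case
  needs the hypothesis for every tuple of the same length with no more letters, not just for the
  remaining one. The parameter \<open>y\<close> carries the functions, which change under
  \<open>fix_empty\<close>.\<close>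

lemma words_size_induct [case_names Nil Empty Letter]:
  assumes "\<And>y. P y []" "\<And>y ws. (\<And>y. P y ws) \<Longrightarrow> P y ([] # ws)"
    "\<And>y x w ws. (\<And>y us. length us = Suc (length ws) \<Longrightarrow> vol us \<le> vol (w # ws) \<Longrightarrow> P y us)
       \<Longrightarrow> P y ((x # w) # ws)"
  shows "P y ws"
proof (induction "length ws + vol ws" arbitrary: y ws rule: less_induct)
  case less
  show ?case
  proof (cases ws)
    case Nil
    then show ?thesis using assms(1) by simp
  next
    case (Cons w' ws')
    show ?thesis
    proof (cases w')
      case Nil
      then show ?thesis using Cons assms(2) less by (simp add: vol_def)
    next
      case (Cons x w)
      then show ?thesis
        using \<open>ws = w' # ws'\<close> less by (auto simp: vol_def intro!: assms(3))
    qed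
  qed
qed

lemma EE_add: "EE (S + T) = conv (EE S) (EE T)"
proof
  fix ws :: "'a list list"
  show "EE (S + T) ws = conv (EE S) (EE T) ws"
  proof (induction "(S, T)" ws arbitrary: S T rule: words_size_induct)
    case (Letter x w ws)
    have "EE (S + T) ((x # w) # ws) = conv (EE (S + T)) (lder x S + lder x T) (w # ws)"
      by simp
    \<comment> \<open>Uniqueness for the differential equation takes this form: both candidates
      satisfy it, and the right side only involves values already known to agree.\<close>
    also have "\<dots> = conv (conv (EE S) (EE T)) (lder x S + lder x T) (w # ws)"
      by (rule conv_cong) (simp_all add: Letter.hyps)
    also have "\<dots> = lder x (conv (EE S) (EE T)) (w # ws)"
      by (simp add: lder_conv lder_EE conv_add_right conv_ac)
    finally show ?case by simp
  qed (simp_all add: fix_empty_EE)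
qed

lemma EE_zero: "EE 0 = all_one"
proof
  fix ws :: "'a list list"
  show "EE 0 ws = (all_one :: ('a, 'b) cochain) ws"
    by (induction ws rule: words_induct)
      (simp_all add: fix_empty_linear(1)[unfolded zero_fun_def]
        lder_linear(1)[unfolded zero_fun_def] conv_zero_right[unfolded zero_fun_def])
qed

text \<open>The recursion never changes the length in an essential way: it drops an empty first word
  from function and tuple simultaneously. So a function may be replaced by one agreeing with it in a
  single length, such as a cochain extended by zero.\<close>

lemma EE_length_cong:
  assumes "\<And>us. length us = length ws \<Longrightarrow> S us = T us"
  shows "EE S ws = EE T ws"
  using assms
proof (induction "(S, T)" ws arbitrary: S T rule: words_size_induct)
  case (Empty ws)
  have "EE (fix_empty S) ws = EE (fix_empty T) ws"
    by (rule Empty.hyps) (simp add: fix_empty_def Empty.prems)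
  then show ?case by simp
next
  case (Letter x w ws)
  show ?case
    unfolding EE_Letter
  proof (rule conv_cong)
    fix us :: "'a list list" assume "length us = length (w # ws)" "vol us \<le> vol (w # ws)"
    then show "EE S us = EE T us"
      by (intro Letter.hyps Letter.prems) simp_all
    show "lder x S us = lder x T us"
      using \<open>length us = length (w # ws)\<close> by (cases us) (simp_all add: Letter.prems)
  qed
qed simp

text \<open>If EE T = 1 then \<partial>T = EE T \<cdot> \<partial>T = \<partial>(EE T) = 0. What
  remains is the constant term, which \<open>EE\<close> does not see and which is therefore assumed
  to be zero.\<close>

lemma EE_eq_one_imp_zero:
  assumes "\<And>us. length us = length ws \<Longrightarrow> EE T us = all_one us"
    and "T (replicate (length ws) []) = 0"
  shows "T ws = 0"
  using assms
proof (induction ws arbitrary: T rule: words_induct)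
  case (Empty ws)
  have "fix_empty T ws = 0"
  proof (rule Empty.IH)
    fix us :: "'a list list" assume "length us = length ws"
    then show "EE (fix_empty T) us = all_one us"
      using Empty.prems(1)[of "[] # us"] by simp
  qed (use Empty.prems(2) in \<open>simp add: fix_empty_def\<close>)
  then show ?case by (simp add: fix_empty_def)
next
  case (Letter x w ws)
  have "0 = EE T ((x # w) # ws)" using Letter.prems(1)[of "(x # w) # ws"] by simp
  also have "\<dots> = conv all_one (lder x T) (w # ws)"
    unfolding EE_Letter by (rule conv_length_cong) (use Letter.prems(1) in auto)
  finally show ?case by (simp add: conv_all_one)
qed simp

lemma sum_fun_at: "sum f S x = (\<Sum>i\<in>S. f i x)"
  by (induction S rule: infinite_finite_induct) simp_all

lemma conv_sum_left: "conv (sum f S) G = (\<Sum>i\<in>S. conv (f i) G)"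
  by (induction S rule: infinite_finite_induct)
    (simp_all only: sum.infinite sum.empty sum.insert not_False_eq_True conv_add_left conv_zero_left)

lemma lder_sum: "lder x (sum f S) = (\<Sum>i\<in>S. lder x (f i))"
  by (induction S rule: infinite_finite_induct)
    (simp_all only: sum.infinite sum.empty sum.insert not_False_eq_True lder_linear)

lemma fix_empty_sum: "fix_empty (sum f S) = (\<Sum>i\<in>S. fix_empty (f i))"
  by (induction S rule: infinite_finite_induct)
    (simp_all only: sum.infinite sum.empty sum.insert not_False_eq_True fix_empty_linear)

section \<open>Decomposable tensors\<close>

lemma tcons_simps [simp]: "tcons a T [] = 0" "tcons a T (w # ws) = a w * T ws"
  by (simp_all add: tcons_def)

lemma pure_tensor_Nil: "pure_tensor [] = unit_cochain 0"
  by (rule ext) (simp add: pure_tensor_def unit_cochain_def)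

lemma pure_tensor_Cons: "pure_tensor (a # as) = tcons a (pure_tensor as)"
  by (rule ext) (simp add: pure_tensor_def tcons_def prod.lessThan_Suc_shift del: prod.lessThan_Suc split: list.split)

lemma supported_pure_tensor: "supported (length as) (pure_tensor as)"
  by (simp add: supported_def pure_tensor_def)

lemma pure_tensor_empty:
  assumes "as \<noteq> []" "\<And>a. a \<in> set as \<Longrightarrow> a [] = 0"
  shows "pure_tensor as (replicate (length as) []) = 0"
  using assms by (cases as) (simp_all add: pure_tensor_Cons)

lemma conv_tcons: "conv (tcons a S) (tcons b T) = tcons (sconv a b) (conv S T)"
proof
  fix ws
  show "conv (tcons a S) (tcons b T) ws = tcons (sconv a b) (conv S T) ws"
  proof (cases ws)
    case (Cons w ws')
    have "conv (\<lambda>us. a u * S us) (\<lambda>vs. b v * T vs) ws' = a u * b v * conv S T ws'" for u v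
      using conv_smul_left[of "a u" S "smul (b v) T"] conv_smul_right[of S "b v" T]
      by (simp add: smul_def)
    then show ?thesis
      by (simp add: Cons conv_slices sconv_def case_prod_unfold sum_list_mult_const)
  qed simp
qed

lemma conv_pure_tensor:
  "length as = length bs \<Longrightarrow>
     conv (pure_tensor as) (pure_tensor bs) = pure_tensor (map2 sconv as bs)"
  by (induction as bs rule: list_induct2)
    (simp_all add: pure_tensor_Nil pure_tensor_Cons conv_tcons conv_unit)

lemma fix_empty_tcons: "fix_empty (tcons a T) = smul (a []) T"
  by (rule ext) (simp add: fix_empty_def smul_def)

lemma lder_tcons: "lder x (tcons a T) = tcons (\<lambda>w. a (x # w)) T"
  by (rule ext) (simp add: lder_def tcons_def split: list.split)

lemma unit_cochain_Suc: "unit_cochain (Suc n) = tcons (\<lambda>w. if w = [] then 1 else 0) (unit_cochain n)"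
  by (rule ext) (simp add: unit_cochain_def tcons_def split: list.split)

text \<open>The first factor can stay anonymous, because the vanishing needed later is read off from
  the power of \<open>T\<close>.\<close>

lemma cpow_tcons: "\<exists>b. cpow (Suc n) (tcons a T) j = tcons b (cpow n T j)"
  by (induction j) (auto simp: unit_cochain_Suc conv_tcons)

text \<open>The truncated exponential solves the equation defining \<open>EE\<close>:
  differentiating it shifts the terms by one, and the only term left over contains T^p = 0.\<close>

lemma EE_tcons:
  fixes T :: "('g, 'k::field) cochain"
  assumes p: "CHAR('k) > 0" and T: "supported n T" "T (replicate n []) = 0"
    and a: "a [] = 0" and ws: "length ws = Suc n"
  shows "EE (tcons a T) ws
    = (\<Sum>j<CHAR('k). smul (1 / of_nat (fact j)) (cpow (Suc n) (tcons a T) j)) ws"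
  using ws
proof (induction "()" ws rule: words_size_induct)
  case (Empty ws)
  obtain q where q: "CHAR('k) = Suc q" using p gr0_conv_Suc by blast
  \<comment> \<open>As \<open>a\<close> vanishes on the empty word, both exponentials become the
    exponential of zero once the first word is empty.\<close>
  have z: "fix_empty (tcons a T) = 0"
    by (rule ext) (simp add: fix_empty_tcons a smul_def)
  have "(\<Sum>j<CHAR('k). smul (1 / of_nat (fact j)) (cpow (Suc n) (tcons a T) j)) ([] # ws)
      = fix_empty (\<Sum>j<CHAR('k). smul (1 / of_nat (fact j)) (cpow (Suc n) (tcons a T) j)) ws"
    by (simp add: fix_empty_def)
  also have "\<dots> = (\<Sum>j<CHAR('k). smul (1 / of_nat (fact j)) (cpow n 0 j)) ws"
    by (simp add: fix_empty_sum fix_empty_cpow z)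
  also have "\<dots> = all_one ws"
    using Empty by (simp add: q sum.lessThan_Suc_shift sum_fun_at smul_def unit_cochain_eq
        del: sum.lessThan_Suc)
  finally show ?case by (simp add: z EE_zero)
next
  case (Letter x w ws)
  obtain q where q: "CHAR('k) = Suc q" using p gr0_conv_Suc by blast
  let ?T = "tcons a T"
  let ?F = "\<lambda>m. \<Sum>j<m. smul (1 / of_nat (fact j)) (cpow (Suc n) ?T j)"
  have supp: "supported (Suc n) ?T"
    using T(1) by (simp add: supported_def tcons_def split: list.split)
  obtain b where b: "cpow (Suc n) ?T q = tcons b (cpow n T q)"
    using cpow_tcons by blast
  have "conv (cpow n T q) T = 0"
    using cpow_char[OF p T] by (simp add: q)
  \<comment> \<open>With q = p - 1, one further factor from the derivative completes the second
    tensor component to T^p.\<close>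
  then have top: "conv (cpow (Suc n) ?T q) (lder x ?T) = 0"
    by (simp add: b lder_tcons conv_tcons) (rule ext, simp add: tcons_def split: list.split)
  \<comment> \<open>Cancelling j + 1 is allowed because it lies strictly between 0 and p.\<close>
  have coeff: "1 / of_nat (fact (Suc j)) * of_nat (Suc j) = (1 / of_nat (fact j) :: 'k)" if "j < q" for j
  proof -
    have "\<not> CHAR('k) dvd Suc j" using that q by (auto dest: dvd_imp_le)
    then have "(of_nat (Suc j) :: 'k) \<noteq> 0"
      by (simp only: of_nat_eq_0_iff_char_dvd not_False_eq_True)
    then show ?thesis by (simp only: fact_Suc of_nat_mult of_nat_id) simp
  qed
  have "lder x (?F CHAR('k))
      = (\<Sum>j<q. smul (1 / of_nat (fact (Suc j))) (lder x (cpow (Suc n) ?T (Suc j))))"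
    unfolding q sum.lessThan_Suc_shift
    by (simp add: lder_sum smul_def[of _ 0]) (simp add: zero_fun_def)
  also have "\<dots> = (\<Sum>j<q. smul (1 / of_nat (fact j)) (conv (cpow (Suc n) ?T j) (lder x ?T)))"
  proof (rule sum.cong[OF refl])
    fix j assume "j \<in> {..<q}"
    then have "j < q" by simp
    then show "smul (1 / of_nat (fact (Suc j))) (lder x (cpow (Suc n) ?T (Suc j)))
        = smul (1 / of_nat (fact j)) (conv (cpow (Suc n) ?T j) (lder x ?T))"
      unfolding lder_cpow[OF supp] coeff[OF \<open>j < q\<close>, symmetric]
      by (simp add: smul_def mult.assoc)
  qed
  also have "\<dots> = conv (?F CHAR('k)) (lder x ?T)"
    by (simp add: q conv_sum_left conv_add_left conv_smul_left top) (simp add: smul_def zero_fun_def)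
  finally have D: "lder x (?F CHAR('k)) = conv (?F CHAR('k)) (lder x ?T)" .
  have "EE ?T ((x # w) # ws) = conv (EE ?T) (lder x ?T) (w # ws)" by simp
  also have "\<dots> = conv (?F CHAR('k)) (lder x ?T) (w # ws)"
    by (rule conv_cong) (use Letter in simp_all)
  also have "\<dots> = ?F CHAR('k) ((x # w) # ws)"
    unfolding D[symmetric] by simp
  finally show ?case .
qed simp

section \<open>Regularity of the exponential\<close>

lemma poly_fun_reindex: "q \<in> poly_fun \<Longrightarrow> (\<lambda>T. q (\<lambda>x. T (f x))) \<in> poly_fun"
  by (induction rule: poly_fun.induct) (auto intro: poly_fun.intros)

lemma poly_fun_sum_list:
  "(\<And>x. x \<in> set xs \<Longrightarrow> (\<lambda>T. f x T) \<in> poly_fun) \<Longrightarrow> (\<lambda>T. \<Sum>x\<leftarrow>xs. f x T) \<in> poly_fun"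
  by (induction xs) (auto intro: poly_fun.intros)

text \<open>Each recursion step is a finite sum of products of earlier values with values of
  \<open>T\<close>. This provides the regularity demanded in \<open>alg_group_hom_E\<close>.\<close>

lemma EE_poly_fun:
  fixes ws :: "'g list list"
  shows "(\<lambda>T. EE T ws :: 'k::field) \<in> poly_fun"
proof (induction "()" ws rule: words_size_induct)
  case (Empty ws)
  show ?case
    using poly_fun_reindex[OF Empty, of "Cons []"] by (simp add: fix_empty_def[abs_def])
next
  case (Letter x w ws)
  have "(\<lambda>T. EE T us * lder x T vs :: 'k) \<in> poly_fun"
    if "(us, vs) \<in> set (splits_list (w # ws))" for us vs
  proof -
    have *: "length us = Suc (length ws)" "vol us \<le> vol (w # ws)" "length vs = Suc (length ws)"
      using splits_list_length[OF that] by auto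
    have "(\<lambda>T. lder x T vs :: 'k) \<in> poly_fun"
      using *(3) by (cases vs) (auto intro: poly_fun.intros)
    then show ?thesis
      by (intro poly_fun.intros(4)[OF Letter.hyps[of us]] *)
  qed
  then show ?case
    unfolding EE.simps(3) by (intro poly_fun_sum_list) (auto simp del: splits_list.simps)
qed (auto intro: poly_fun.intros)

section \<open>Face maps\<close>

text \<open>Face maps without a degree argument, recursive in the tuple so that they interact with
  \<open>fix_empty\<close> and \<open>lder\<close>. The last face is recognised by index 1 meeting a
  single remaining word; an index \<ge> 2 passes over the first word.\<close>

fun lface :: "nat \<Rightarrow> ('g, 'k::field) cochain \<Rightarrow> ('g, 'k) cochain" where
  "lface i \<phi> [] = 0"
| "lface 0 \<phi> (w # ws) = (if w = [] then \<phi> ws else 0)"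
| "lface (Suc 0) \<phi> [w] = (if w = [] then \<phi> [] else 0)"
| "lface (Suc 0) \<phi> (u # v # ws) = \<phi> ((u @ v) # ws)"
| "lface (Suc (Suc i)) \<phi> (w # ws) = lface (Suc i) (\<lambda>us. \<phi> (w # us)) ws"

lemma face_eq_lface:
  "i \<le> Suc n \<Longrightarrow> length ws = Suc n \<Longrightarrow> face i n \<phi> ws = lface i \<phi> ws"
proof (induction i \<phi> ws arbitrary: n rule: lface.induct)
  case (5 i \<phi> w ws)
  then obtain m where m: "n = Suc m" by (cases n) auto
  have "lface (Suc (Suc i)) \<phi> (w # ws) = face (Suc i) m (\<lambda>us. \<phi> (w # us)) ws"
    using 5 m by simp
  also have "\<dots> = face (Suc (Suc i)) n \<phi> (w # ws)"
    using 5 m by (cases ws) (auto simp: face_def)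
  finally show ?case by simp
qed (auto simp: face_def)

lemma face_supported: "supported (Suc n) (face i n \<phi>)"
  by (simp add: supported_def face_def)

lemma lface_linear [simp]:
  fixes F G :: "('g, 'k::field) cochain"
  shows "lface i (0 :: ('g, 'k) cochain) = 0" "lface i (F + G) = lface i F + lface i G"
  "lface i (smul c F) = smul c (lface i F)"
proof -
  have "lface i \<phi> ws = 0" if "\<phi> = 0" for i ws and \<phi> :: "('g, 'k) cochain"
    using that by (induction i \<phi> ws rule: lface.induct) (auto simp: zero_fun_def)
  then show "lface i 0 = (0 :: ('g, 'k) cochain)" by (auto simp: fun_eq_iff)
  have "lface i H ws = lface i F ws + lface i G ws" if "H = F + G"
    for i ws and F G H :: "('g, 'k) cochain"
    using that
    by (induction i H ws arbitrary: F G rule: lface.induct) (auto simp: plus_fun_def)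
  from this[OF refl] show "lface i (F + G) = lface i F + lface i G" by (intro ext) simp
  have "lface i H ws = c * lface i F ws" if "H = smul c F"
    for i ws and F H :: "('g, 'k) cochain"
    using that
    by (induction i H ws arbitrary: F rule: lface.induct) (auto simp: smul_def)
  then show "lface i (smul c F) = smul c (lface i F)" by (auto simp: fun_eq_iff smul_def)
qed

lemma fix_empty_lface [simp]: "fix_empty (lface 0 F) = F" "fix_empty (lface (Suc 0) F) = F"
  "fix_empty (lface (Suc (Suc i)) F) = lface (Suc i) (fix_empty F)"
proof -
  show "fix_empty (lface (Suc 0) F) = F"
  proof
    fix ws show "fix_empty (lface (Suc 0) F) ws = F ws"
      by (cases ws) (simp_all add: fix_empty_def)
  qed
qed (rule ext, simp add: fix_empty_def[abs_def])+

text \<open>For \<open>i > 0\<close> the first letter of a concatenation \<open>u @ v\<close> with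
  nonempty \<open>u\<close> is that of \<open>u\<close>, so stripping it commutes with the face.
  Face 0 is supported on tuples beginning with the empty word, so its derivative is zero.\<close>

lemma lder_lface: "lder x (lface i F) = (if i = 0 then 0 else lface i (lder x F))"
proof
  fix ws show "lder x (lface i F) ws = (if i = 0 then 0 else lface i (lder x F)) ws"
    by (cases "(i, F, ws)" rule: lface.cases) auto
qed

text \<open>Dually, multiplication and unit of the enveloping algebra are coalgebra maps, so the
  faces are algebra homomorphisms.\<close>

lemma lface_conv: "lface i (conv F G) = conv (lface i F) (lface i G)"
proof
  fix ws show "lface i (conv F G) ws = conv (lface i F) (lface i G) ws"
  proof (induction ws arbitrary: i F G rule: words_induct)
    case (Empty ws)
    have "lface i (conv F G) ([] # ws) = fix_empty (lface i (conv F G)) ws"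
      by (simp add: fix_empty_def)
    also have "\<dots> = conv (fix_empty (lface i F)) (fix_empty (lface i G)) ws"
    proof (cases i)
      case (Suc j)
      then show ?thesis by (cases j) (simp_all add: Empty fix_empty_conv)
    qed simp
    finally show ?case by simp
  next
    case (Letter x w ws)
    have "lface i (conv F G) ((x # w) # ws) = lder x (lface i (conv F G)) (w # ws)"
      by simp
    also have "\<dots> = (conv (lder x (lface i F)) (lface i G)
        + conv (lface i F) (lder x (lface i G))) (w # ws)"
      by (simp add: lder_lface Letter lder_conv)
    finally show ?case by simp
  qed simp
qed

text \<open>The side conditions exclude the tuples on which \<open>lface\<close> runs off the end
  and returns 0, while an exponential has value 1 at empty words.\<close>

lemma EE_lface: "ws \<noteq> [] \<Longrightarrow> i \<le> length ws \<Longrightarrow> EE (lface i T) ws = lface i (EE T) ws"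
proof (induction "(i, T)" ws arbitrary: i T rule: words_size_induct)
  case (Empty ws)
  have "EE (fix_empty (lface i T)) ws = fix_empty (lface i (EE T)) ws"
  proof (cases i)
    case (Suc j)
    show ?thesis
    proof (cases j)
      case (Suc l)
      then show ?thesis
        using Empty \<open>i = Suc j\<close> by (cases ws) (simp_all add: fix_empty_EE)
    qed (simp add: \<open>i = Suc j\<close>)
  qed simp
  then show ?case by (simp add: fix_empty_def)
next
  case (Letter x w ws)
  have "EE (lface i T) ((x # w) # ws) = conv (EE (lface i T)) (lder x (lface i T)) (w # ws)"
    by simp
  also have "\<dots> = conv (lface i (EE T)) (lder x (lface i T)) (w # ws)"
    by (rule conv_cong) (use Letter.prems in \<open>auto intro!: Letter.hyps\<close>)
  also have "\<dots> = lder x (lface i (EE T)) (w # ws)"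
    by (simp add: lder_lface lder_EE lface_conv)
  finally show ?case by simp
qed simp

section \<open>The exponential in a fixed tensor degree\<close>

definition Exp :: "nat \<Rightarrow> ('g, 'k::field) cochain \<Rightarrow> ('g, 'k) cochain" where
  "Exp n T ws = (if length ws = n then EE T ws else 0)"

lemma supported_Exp [simp]: "supported n (Exp n T)"
  by (simp add: supported_def Exp_def)

lemma Exp_add: "Exp n (S + T) = conv (Exp n S) (Exp n T)"
proof
  fix ws show "Exp n (S + T) ws = conv (Exp n S) (Exp n T) ws"
  proof (cases "length ws = n")
    case True
    have "conv (EE S) (EE T) ws = conv (Exp n S) (Exp n T) ws"
      by (rule conv_length_cong) (simp_all add: Exp_def True)
    then show ?thesis by (simp add: Exp_def True EE_add)
  next
    case False
    then show ?thesis
      using supported_conv[OF supported_Exp[of n S], of "Exp n T"]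
      by (simp add: supported_def Exp_def[of n "S + T"])
  qed
qed

lemma Exp_zero: "Exp n 0 = unit_cochain n"
  by (rule ext) (simp add: Exp_def EE_zero unit_cochain_eq)

lemma Exp_uminus: "conv (Exp n T) (Exp n (- T)) = unit_cochain n"
  by (simp add: Exp_add[symmetric] Exp_zero)

lemma Exp_eq_unit_imp_zero:
  assumes "Exp n T = unit_cochain n" "supported n T" "T (replicate n []) = 0"
  shows "T = 0"
proof
  fix ws show "T ws = 0 ws"
  proof (cases "length ws = n")
    case True
    have "EE T us = all_one us" if "length us = n" for us
      using fun_cong[OF assms(1), of us] that by (simp add: Exp_def unit_cochain_eq)
    then show ?thesis using EE_eq_one_imp_zero[of ws T] assms(3) True by simp
  qed (use assms(2) in \<open>simp add: supported_def\<close>)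
qed

lemma face_Exp:
  assumes "i \<le> Suc n"
  shows "face i n (Exp n T) = Exp (Suc n) (face i n T)"
proof
  fix ws :: "'a list list"
  show "face i n (Exp n T) ws = Exp (Suc n) (face i n T) ws"
  proof (cases "length ws = Suc n")
    case True
    \<comment> \<open>\<open>face\<close> and \<open>lface\<close> agree only in length
      \<open>Suc n\<close>, which suffices because \<open>EE\<close> is local in the length.\<close>
    have "Exp (Suc n) (face i n T) ws = EE (lface i T) ws"
      unfolding Exp_def using True assms by (auto intro!: EE_length_cong simp: face_eq_lface)
    also have "\<dots> = lface i (EE T) ws"
      using True assms by (intro EE_lface) auto
    also have "\<dots> = face i n (EE T) ws"
      using True assms by (simp add: face_eq_lface)
    also have "\<dots> = face i n (Exp n T) ws"
      using True assms by (auto simp: face_def Exp_def)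
    finally show ?thesis by simp
  next
    case False
    then show ?thesis by (simp add: face_def Exp_def)
  qed
qed

lemma face_linear: "face i n 0 = 0" "face i n (F + G) = face i n F + face i n G"
  "face i n (smul c F) = smul c (face i n F)"
  by (rule ext, simp add: face_def smul_def)+

lemma face_unit: "i \<le> Suc n \<Longrightarrow> face i n (unit_cochain n) = unit_cochain (Suc n)"
  using face_Exp[of i n 0] by (simp add: Exp_zero face_linear)

lemma face_conv:
  assumes "i \<le> Suc n"
  shows "face i n (conv F G) = conv (face i n F) (face i n G)"
proof
  fix ws :: "'a list list"
  show "face i n (conv F G) ws = conv (face i n F) (face i n G) ws"
  proof (cases "length ws = Suc n")
    case True
    have "conv (face i n F) (face i n G) ws = conv (lface i F) (lface i G) ws"
      by (rule conv_length_cong) (simp_all add: face_eq_lface assms True)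
    then show ?thesis
      using True assms by (simp add: face_eq_lface lface_conv)
  next
    case False
    then show ?thesis
      using supported_conv[OF face_supported[of n i F], of "face i n G"]
      by (simp add: supported_def face_def[of _ _ "conv F G"])
  qed
qed

section \<open>The coordinate ring\<close>

text \<open>These are the four families of relations of the restricted enveloping algebra,
  multiplied by arbitrary words on both sides and evaluated. In this form membership in the
  coordinate ring can be tested without cosets.\<close>

definition respects_relations ::
  "('k::field \<Rightarrow> 'g::ab_group_add \<Rightarrow> 'g) \<Rightarrow> ('g \<Rightarrow> 'g \<Rightarrow> 'g) \<Rightarrow> ('g \<Rightarrow> 'g)
    \<Rightarrow> ('g list \<Rightarrow> 'k) \<Rightarrow> bool" where
  "respects_relations scale br pmap a \<longleftrightarrow>
     (\<forall>u v x y. a (u @ [x + y] @ v) = a (u @ [x] @ v) + a (u @ [y] @ v))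
   \<and> (\<forall>u v c x. a (u @ [scale c x] @ v) = c * a (u @ [x] @ v))
   \<and> (\<forall>u v x y. a (u @ [x, y] @ v) = a (u @ [y, x] @ v) + a (u @ [br x y] @ v))
   \<and> (\<forall>u v x. a (u @ replicate CHAR('k) x @ v) = a (u @ [pmap x] @ v))"

lemma respects_relationsD:
  fixes scale :: "'k::field \<Rightarrow> 'g::ab_group_add \<Rightarrow> 'g"
  assumes "respects_relations scale br pmap a"
  shows "a (u @ [x + y] @ v) = a (u @ [x] @ v) + a (u @ [y] @ v)"
    "a (u @ [scale c x] @ v) = c * a (u @ [x] @ v)"
    "a (u @ [x, y] @ v) = a (u @ [y, x] @ v) + a (u @ [br x y] @ v)"
    "a (u @ replicate CHAR('k) x @ v) = a (u @ [pmap x] @ v)"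
  using assms unfolding respects_relations_def by blast+

lemma word_elem_mult: "word_elem u * word_elem v = word_elem (u @ v)"
  by (simp add: word_elem_def mult_single plus_fmon_def)

lemma word_elem_Nil: "word_elem [] = 1"
  by (simp add: word_elem_def zero_fmon_def[symmetric])

lemma gen_power: "gen x ^ m = word_elem (replicate m x)"
  by (induction m) (simp_all add: word_elem_Nil word_elem_mult)

lemma single_eq_scalar: "Poly_Mapping.single m c = scalar c * word_elem (letters m)"
  by (simp add: word_elem_def scalar_def mult_single)

lemma poly_mapping_single_induct [case_names zero add single]:
  fixes P :: "'a \<Rightarrow>\<^sub>0 'b::comm_monoid_add"
  assumes "Q 0" "\<And>a b. Q a \<Longrightarrow> Q b \<Longrightarrow> Q (a + b)" "\<And>m c. Q (Poly_Mapping.single m c)"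
  shows "Q P"
proof -
  have "Q (\<Sum>m\<in>S. Poly_Mapping.single m (Poly_Mapping.lookup P m))" for S
    by (induction S rule: infinite_finite_induct) (use assms in auto)
  moreover have "(\<Sum>m\<in>Poly_Mapping.keys P. Poly_Mapping.single m (Poly_Mapping.lookup P m)) = P"
    by (rule poly_mapping_eqI) (simp add: lookup_sum lookup_single when_def in_keys_iff)
  ultimately show ?thesis by metis
qed

section \<open>Degrees zero and one\<close>

lemma free_alg_induct [case_names zero add word]:
  fixes P :: "('g, 'k::field) free_alg"
  assumes "Q 0" "\<And>a b. Q a \<Longrightarrow> Q b \<Longrightarrow> Q (a + b)" "\<And>c w. Q (scalar c * word_elem w)"
  shows "Q P"
  by (induction P rule: poly_mapping_single_induct) (simp_all only: assms single_eq_scalar)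

lemma scalar_commute: "scalar c * P = P * scalar c"
proof (induction P rule: free_alg_induct)
  case (word d w)
  then show ?case by (simp add: scalar_def word_elem_def mult_single mult.commute)
qed (simp_all add: ring_distribs)

lemma mult_scalar_left: "Q * (scalar c * P) = scalar c * (Q * P)"
  unfolding mult.assoc[symmetric] scalar_commute[of c Q] by (rule refl)

definition lin_ext :: "('g list \<Rightarrow> 'k::field) \<Rightarrow> ('g, 'k) free_alg \<Rightarrow> 'k" where
  "lin_ext a P = (\<Sum>m\<in>Poly_Mapping.keys P. Poly_Mapping.lookup P m * a (letters m))"

lemma lin_ext_superset:
  assumes "finite S" "Poly_Mapping.keys P \<subseteq> S"
  shows "lin_ext a P = (\<Sum>m\<in>S. Poly_Mapping.lookup P m * a (letters m))"
  unfolding lin_ext_def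
  by (rule sum.mono_neutral_left) (use assms in \<open>auto simp: in_keys_iff\<close>)

lemma lin_ext_add: "lin_ext a (P + Q) = lin_ext a P + lin_ext a Q"
proof -
  let ?S = "Poly_Mapping.keys P \<union> Poly_Mapping.keys Q"
  have "lin_ext a (P + Q) = (\<Sum>m\<in>?S. Poly_Mapping.lookup (P + Q) m * a (letters m))"
    by (rule lin_ext_superset) (use Poly_Mapping.keys_add[of P Q] in auto)
  also have "\<dots> = lin_ext a P + lin_ext a Q"
    by (simp add: lin_ext_superset[of ?S] lookup_add ring_distribs sum.distrib)
  finally show ?thesis .
qed

lemma lin_ext_zero: "lin_ext a 0 = 0"
  by (simp add: lin_ext_def)

lemma lin_ext_uminus: "lin_ext a (- P) = - lin_ext a P"
  using lin_ext_add[of a P "- P"] by (simp add: lin_ext_zero eq_neg_iff_add_eq_0 add.commute)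

lemma lin_ext_diff: "lin_ext a (P - Q) = lin_ext a P - lin_ext a Q"
  using lin_ext_add[of a P "- Q"] by (simp add: lin_ext_uminus)

lemma lin_ext_single: "lin_ext a (Poly_Mapping.single m c) = c * a (letters m)"
  using lin_ext_superset[of "{m}" "Poly_Mapping.single m c" a] by simp

lemma lin_ext_word: "lin_ext a (word_elem w) = a w"
  by (simp add: word_elem_def lin_ext_single)

lemma lin_ext_scalar: "lin_ext a (scalar c * P) = c * lin_ext a P"
proof (induction P rule: free_alg_induct)
  case (word d w)
  then show ?case by (simp add: scalar_def word_elem_def mult_single lin_ext_single)
qed (simp_all add: ring_distribs lin_ext_add lin_ext_zero)

text \<open>By linearity the two outer factors of a generator \<open>a * s * b\<close> of the ideal
  may be taken to be words.\<close>

lemma lin_ext_ideal: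
  assumes "\<And>u s v. s \<in> S \<Longrightarrow> lin_ext a (word_elem u * s * word_elem v) = 0"
    and "P \<in> two_sided_ideal S"
  shows "lin_ext a P = 0"
  using assms(2)
proof induction
  case (gens s P Q)
  have *: "lin_ext a (word_elem u * s * Q) = 0" for u
  proof (induction Q rule: free_alg_induct)
    case (word c w)
    have "word_elem u * s * (scalar c * word_elem w) = scalar c * (word_elem u * s * word_elem w)"
      by (rule mult_scalar_left)
    then show ?case using assms(1)[OF gens] by (simp add: lin_ext_scalar)
  qed (simp_all add: ring_distribs lin_ext_add lin_ext_zero)
  show ?case
  proof (induction P rule: free_alg_induct)
    case (word c w)
    have "scalar c * word_elem w * s * Q = scalar c * (word_elem w * s * Q)"
      by (simp add: mult.assoc)
    then show ?case using * by (simp add: lin_ext_scalar)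
  qed (simp_all add: ring_distribs lin_ext_add lin_ext_zero)
qed (simp_all add: lin_ext_add lin_ext_zero)

lemma two_sided_ideal_uminus: "a \<in> two_sided_ideal S \<Longrightarrow> - a \<in> two_sided_ideal S"
proof (induction rule: two_sided_ideal.induct)
  case (gens s a b)
  then show ?case using two_sided_ideal.gens[of s S "- a" b] by simp
next
  case (add a b)
  then show ?case using two_sided_ideal.add[of "- a" S "- b"] by simp
qed (simp add: two_sided_ideal.zero)

lemma coord_ring_respects_relations:
  fixes scale :: "'k::field \<Rightarrow> 'g::ab_group_add \<Rightarrow> 'g"
  assumes "a \<in> coord_ring scale br pmap"
  shows "respects_relations scale br pmap a"
proof -
  let ?cl = "u_class scale br pmap" and ?R = "u_relations scale br pmap"
  from assms obtain f where f: "f \<in> u_dual scale br pmap"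
    and a: "a = (\<lambda>w. f (?cl (word_elem w)))"
    by (auto simp: coord_ring_def)
  define g where "g P = f (?cl P)" for P
  have add: "g (P + Q) = g P + g Q" for P Q using f by (simp add: g_def u_dual_def)
  have scal: "g (scalar c * P) = c * g P" for c P using f by (simp add: g_def u_dual_def)
  have zero: "g 0 = 0" using scal[of 0 0] by simp
  have diff: "g (P - Q) = g P - g Q" for P Q using add[of "P - Q" Q] by simp
  have ideal: "g P = 0" if P: "P \<in> two_sided_ideal ?R" for P
  proof -
    \<comment> \<open>An element of \<open>u_dual\<close> is merely a function on cosets, so its
      vanishing on the ideal has to come from an equality of cosets: that of \<open>P\<close> is
      that of 0.\<close>
    have "Q - P \<in> two_sided_ideal ?R \<longleftrightarrow> Q - 0 \<in> two_sided_ideal ?R" for Q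
      using two_sided_ideal.add[OF _ P, of "Q - P"]
        two_sided_ideal.add[OF _ two_sided_ideal_uminus[OF P], of Q] by auto
    then have "?cl P = ?cl 0" by (simp only: u_class_def)
    then show ?thesis using zero by (simp add: g_def)
  qed
  have gw: "g (word_elem w) = a w" for w by (simp add: g_def a)
  have rel: "g (word_elem u * s * word_elem v) = 0" if "s \<in> ?R" for u s v
    using ideal two_sided_ideal.gens[OF that] by blast
  show ?thesis
    unfolding respects_relations_def
  proof (intro conjI allI)
    fix u v x y c
    have "gen (x + y) - gen x - gen y \<in> ?R" by (auto simp: u_relations_def)
    from rel[OF this, of u v] show "a (u @ [x + y] @ v) = a (u @ [x] @ v) + a (u @ [y] @ v)"
      by (simp add: ring_distribs diff word_elem_mult gw diff_eq_eq add.commute)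
    have "gen (scale c x) - scalar c * gen x \<in> ?R" by (auto simp: u_relations_def)
    from rel[OF this, of u v] show "a (u @ [scale c x] @ v) = c * a (u @ [x] @ v)"
      by (simp add: right_diff_distrib left_diff_distrib diff mult_scalar_left mult.assoc word_elem_mult gw scal)
    have "gen x * gen y - gen y * gen x - gen (br x y) \<in> ?R" by (auto simp: u_relations_def)
    from rel[OF this, of u v]
    show "a (u @ [x, y] @ v) = a (u @ [y, x] @ v) + a (u @ [br x y] @ v)"
      by (simp add: ring_distribs diff word_elem_mult gw diff_eq_eq add.commute)
    have "gen x ^ CHAR('k) - gen (pmap x) \<in> ?R" by (auto simp: u_relations_def)
    from rel[OF this, of u v]
    show "a (u @ replicate CHAR('k) x @ v) = a (u @ [pmap x] @ v)"
      by (simp add: ring_distribs diff word_elem_mult gw gen_power)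
  qed
qed

lemma respects_relations_coord_ring:
  fixes scale :: "'k::field \<Rightarrow> 'g::ab_group_add \<Rightarrow> 'g"
  assumes "respects_relations scale br pmap a"
  shows "a \<in> coord_ring scale br pmap"
proof -
  let ?cl = "u_class scale br pmap" and ?R = "u_relations scale br pmap"
  have rel: "lin_ext a (word_elem u * s * word_elem v) = 0" if "s \<in> ?R" for u s v
  proof -
    note R = respects_relationsD[OF assms, simplified]
    note simps = right_diff_distrib left_diff_distrib lin_ext_diff lin_ext_word mult.assoc
      mult_scalar_left lin_ext_scalar gen_power word_elem_mult
    from that consider (1) x y where "s = gen (x + y) - gen x - gen y"
      | (2) c x where "s = gen (scale c x) - scalar c * gen x"
      | (3) x y where "s = gen x * gen y - gen y * gen x - gen (br x y)"
      | (4) x where "s = gen x ^ CHAR('k) - gen (pmap x)"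
      unfolding u_relations_def by blast
    then show ?thesis
    proof cases
      case 1
      then show ?thesis using R(1)[of u x y v] by (simp add: simps)
    next
      case 2
      then show ?thesis using R(2)[of u c x v] by (simp add: simps)
    next
      case 3
      then show ?thesis using R(3)[of u x y v] by (simp add: simps)
    next
      case 4
      then show ?thesis using R(4)[of u x v] by (simp add: simps)
    qed
  qed
  \<comment> \<open>The functional reads off an arbitrary representative; the choice is harmless
    because \<open>lin_ext a\<close> kills the ideal.\<close>
  define f where "f C = lin_ext a (SOME P. P \<in> C)" for C
  have f: "f (?cl P) = lin_ext a P" for P
  proof -
    have "P \<in> ?cl P" by (simp add: u_class_def two_sided_ideal.zero)
    then have "(SOME Q. Q \<in> ?cl P) \<in> ?cl P" by (rule someI)
    then have "(SOME Q. Q \<in> ?cl P) - P \<in> two_sided_ideal ?R"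
      by (subst (asm) (2) u_class_def) (rule CollectD)
    with rel have "lin_ext a ((SOME Q. Q \<in> ?cl P) - P) = 0"
      by (rule lin_ext_ideal)
    then show ?thesis by (simp add: f_def lin_ext_diff)
  qed
  have "f \<in> u_dual scale br pmap"
    by (simp add: u_dual_def f lin_ext_add lin_ext_scalar)
  moreover have "a = (\<lambda>w. f (?cl (word_elem w)))"
    by (simp add: f lin_ext_word)
  ultimately show ?thesis by (auto simp: coord_ring_def)
qed

lemma coord_ring_iff: "a \<in> coord_ring scale br pmap \<longleftrightarrow> respects_relations scale br pmap a"
  using coord_ring_respects_relations respects_relations_coord_ring by blast

section \<open>The coordinate ring is closed under the product\<close>

text \<open>The context \<open>u\<close>, \<open>v\<close> of a relation is split off and absorbed
  into the two functionals, so that only the comultiplication of the middle word \<open>m\<close>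
  remains to be examined.\<close>

lemma sconv_append:
  fixes a b :: "'a list \<Rightarrow> 'b::field"
  shows "sconv a b (u @ m @ v) = (\<Sum>(u1, u2)\<leftarrow>splits u. \<Sum>(v1, v2)\<leftarrow>splits v.
      sconv (\<lambda>w. a (u1 @ w @ v1)) (\<lambda>w. b (u2 @ w @ v2)) m)"
proof -
  have swap: "(\<Sum>x\<leftarrow>xs. \<Sum>y\<leftarrow>ys. h x y) = (\<Sum>y\<leftarrow>ys. \<Sum>x\<leftarrow>xs. (h x y :: 'b))"
    for xs ys and h :: "'a list \<times> 'a list \<Rightarrow> 'a list \<times> 'a list \<Rightarrow> 'b"
    by (induction xs) (simp_all add: sum_list_addf)
  show ?thesis
    by (simp add: sconv_def splits_append sum_list_concat_map case_prod_unfold comp_def)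
      (subst swap, simp)
qed

text \<open>For primitive x the binomial theorem gives \<Delta>(x^m) as the sum of (m choose i) x^i
  \<otimes> x^(m-i); the induction is Pascal's rule.\<close>

lemma sconv_replicate:
  "sconv a b (replicate m x)
     = (\<Sum>i\<le>m. of_nat (m choose i) * a (replicate i x) * b (replicate (m - i) x))"
proof (induction m arbitrary: a b)
  case 0
  show ?case by (simp add: sconv_def)
next
  case (Suc m)
  let ?A = "\<lambda>i. a (replicate i x)" and ?B = "\<lambda>i. b (replicate i x)"
  have "sconv a b (replicate (Suc m) x)
      = sconv (\<lambda>w. a (x # w)) b (replicate m x) + sconv a (\<lambda>w. b (x # w)) (replicate m x)"
    by (simp add: sconv_def comp_def case_prod_unfold)
  also have "\<dots> = (\<Sum>i\<le>m. of_nat (m choose i) * ?A (Suc i) * ?B (m - i))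
      + (\<Sum>i\<le>m. of_nat (m choose i) * ?A i * ?B (Suc (m - i)))"
    by (simp add: Suc)
  also have "(\<Sum>i\<le>m. of_nat (m choose i) * ?A i * ?B (Suc (m - i)))
      = (\<Sum>i\<le>Suc m. of_nat (m choose i) * ?A i * ?B (Suc m - i))"
    by (simp add: Suc_diff_le binomial_eq_0)
  also have "\<dots> = ?A 0 * ?B (Suc m) + (\<Sum>i\<le>m. of_nat (m choose Suc i) * ?A (Suc i) * ?B (m - i))"
    by (subst sum.atMost_Suc_shift) simp
  also have "(\<Sum>i\<le>m. of_nat (m choose i) * ?A (Suc i) * ?B (m - i))
      + (?A 0 * ?B (Suc m) + (\<Sum>i\<le>m. of_nat (m choose Suc i) * ?A (Suc i) * ?B (m - i)))
      = ?A 0 * ?B (Suc m) + (\<Sum>i\<le>m. of_nat (Suc m choose Suc i) * ?A (Suc i) * ?B (m - i))"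
    by (simp add: sum.distrib ring_distribs)
  also have "\<dots> = (\<Sum>i\<le>Suc m. of_nat (Suc m choose i) * ?A i * ?B (Suc m - i))"
    by (subst sum.atMost_Suc_shift) simp
  finally show ?case .
qed

text \<open>The \<open>p\<close>-th power of a primitive element is primitive.\<close>

lemma sconv_replicate_char:
  fixes a b :: "'g list \<Rightarrow> 'k::field"
  assumes "CHAR('k) > 0"
  shows "sconv a b (replicate CHAR('k) x)
    = a (replicate CHAR('k) x) * b [] + a [] * b (replicate CHAR('k) x)"
proof -
  let ?p = "CHAR('k)"
  have "Factorial_Ring.prime ?p" using assms by (rule prime_CHAR_semidom)
  then have "of_nat (?p choose i) = (0 :: 'k)" if "0 < i" "i < ?p" for i
    using that dvd_choose_prime[of i ?p] by (simp add: of_nat_eq_0_iff_char_dvd)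
  then have "(\<Sum>i\<in>{..?p} - {0, ?p}. of_nat (?p choose i) * a (replicate i x) * b (replicate (?p - i) x)) = 0"
    by (intro sum.neutral) auto
  moreover have "(\<Sum>i\<le>?p. of_nat (?p choose i) * a (replicate i x) * b (replicate (?p - i) x))
      = (\<Sum>i\<in>{..?p} - {0, ?p}. of_nat (?p choose i) * a (replicate i x) * b (replicate (?p - i) x))
        + (\<Sum>i\<in>{0, ?p}. of_nat (?p choose i) * a (replicate i x) * b (replicate (?p - i) x))"
    by (rule sum.subset_diff) auto
  ultimately show ?thesis
    using assms by (simp add: sconv_replicate)
qed

text \<open>All four relations equate primitive elements, so the ideal they generate is a coideal,
  and the functionals vanishing on it are closed under convolution. The facts \<open>1\<close> and
  \<open>2\<close> carry an identity for the middle word back to its context.\<close>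

lemma respects_relations_sconv:
  fixes a b :: "'g::ab_group_add list \<Rightarrow> 'k::field"
  assumes p: "CHAR('k) > 0"
    and a: "respects_relations scale br pmap a" and b: "respects_relations scale br pmap b"
  shows "respects_relations scale br pmap (sconv a b)"
proof -
  note A = respects_relationsD[OF a] and B = respects_relationsD[OF b]
  have 1: "sconv a b (u @ m @ v) = sconv a b (u @ m' @ v) + sconv a b (u @ m'' @ v)"
    if "\<And>u1 u2 v1 v2. sconv (\<lambda>w. a (u1 @ w @ v1)) (\<lambda>w. b (u2 @ w @ v2)) m
      = sconv (\<lambda>w. a (u1 @ w @ v1)) (\<lambda>w. b (u2 @ w @ v2)) m'
        + sconv (\<lambda>w. a (u1 @ w @ v1)) (\<lambda>w. b (u2 @ w @ v2)) m''" for u m m' m'' v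
    unfolding sconv_append that by (simp add: case_prod_unfold sum_list_addf)
  have 2: "sconv a b (u @ m @ v) = c * sconv a b (u @ m' @ v)"
    if "\<And>u1 u2 v1 v2. sconv (\<lambda>w. a (u1 @ w @ v1)) (\<lambda>w. b (u2 @ w @ v2)) m
      = c * sconv (\<lambda>w. a (u1 @ w @ v1)) (\<lambda>w. b (u2 @ w @ v2)) m'" for u m m' c v
    unfolding sconv_append that by (simp add: case_prod_unfold sum_list_const_mult)
  show ?thesis
    unfolding respects_relations_def
  proof (intro conjI allI)
    fix u v x y c
    show "sconv a b (u @ [x + y] @ v) = sconv a b (u @ [x] @ v) + sconv a b (u @ [y] @ v)"
    proof (rule 1, goal_cases)
      case (1 u1 u2 v1 v2)
      show ?case using A(1)[of u1 x y v1] B(1)[of u2 x y v2] by (simp add: sconv_def ring_distribs)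
    qed
    show "sconv a b (u @ [scale c x] @ v) = c * sconv a b (u @ [x] @ v)"
    proof (rule 2, goal_cases)
      case (1 u1 u2 v1 v2)
      show ?case using A(2)[of u1 c x v1] B(2)[of u2 c x v2] by (simp add: sconv_def ring_distribs)
    qed
    show "sconv a b (u @ [x, y] @ v) = sconv a b (u @ [y, x] @ v) + sconv a b (u @ [br x y] @ v)"
    proof (rule 1, goal_cases)
      case (1 u1 u2 v1 v2)
      \<comment> \<open>The mixed terms, pairing one functional with x and the other with y, are the
        same for xy and yx; only the primitive part contributes the bracket.\<close>
      show ?case using A(3)[of u1 x y v1] B(3)[of u2 x y v2]
        by (simp add: sconv_def ring_distribs ac_simps)
    qed
    \<comment> \<open>The factor 1 brings the restriction relation into the shape of the transfer
      rule \<open>2\<close>.\<close>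
    have "sconv a b (u @ replicate CHAR('k) x @ v) = 1 * sconv a b (u @ [pmap x] @ v)"
    proof (rule 2, goal_cases)
      case (1 u1 u2 v1 v2)
      show ?case using A(4)[of u1 x v1] B(4)[of u2 x v2]
        by (simp add: sconv_replicate_char[OF p] sconv_def[of _ _ "[_]"])
    qed
    then show "sconv a b (u @ replicate CHAR('k) x @ v) = sconv a b (u @ [pmap x] @ v)" by simp
  qed
qed

lemma respects_relations_translate:
  assumes "respects_relations scale br pmap a"
  shows "respects_relations scale br pmap (\<lambda>w. a (u @ w))"
    and "respects_relations scale br pmap (\<lambda>w. a (w @ v))"
proof -
  note R = respects_relationsD[OF assms]
  show "respects_relations scale br pmap (\<lambda>w. a (u @ w))"
    unfolding respects_relations_def
  proof (intro conjI allI, goal_cases)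
    case (1 u' v x y)
    show ?case using R(1)[of "u @ u'" x y v] by simp
  next
    case (2 u' v c x)
    show ?case using R(2)[of "u @ u'" c x v] by simp
  next
    case (3 u' v x y)
    show ?case using R(3)[of "u @ u'" x y v] by simp
  next
    case (4 u' v x)
    show ?case using R(4)[of "u @ u'" x v] by simp
  qed
  show "respects_relations scale br pmap (\<lambda>w. a (w @ v))"
    unfolding respects_relations_def
  proof (intro conjI allI, goal_cases)
    case (1 u v' x y)
    show ?case using R(1)[of u x y "v' @ v"] by simp
  next
    case (2 u v' c x)
    show ?case using R(2)[of u c x "v' @ v"] by simp
  next
    case (3 u v' x y)
    show ?case using R(3)[of u x y "v' @ v"] by simp
  next
    case (4 u v' x)
    show ?case using R(4)[of u x "v' @ v"] by simp
  qed
qed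

lemma respects_relations_add:
  assumes "respects_relations scale br pmap a" "respects_relations scale br pmap b"
  shows "respects_relations scale br pmap (a + b)"
proof -
  note A = respects_relationsD[OF assms(1)] and B = respects_relationsD[OF assms(2)]
  show ?thesis
    unfolding respects_relations_def
  proof (intro conjI allI, goal_cases)
    case (1 u v x y)
    show ?case using A(1)[of u x y v] B(1)[of u x y v] by simp
  next
    case (2 u v c x)
    show ?case using A(2)[of u c x v] B(2)[of u c x v] by (simp add: distrib_left)
  next
    case (3 u v x y)
    show ?case using A(3)[of u x y v] B(3)[of u x y v] by simp
  next
    case (4 u v x)
    show ?case using A(4)[of u x v] B(4)[of u x v] by simp
  qed
qed

lemma respects_relations_smul:
  assumes "respects_relations scale br pmap a"
  shows "respects_relations scale br pmap (smul d a)"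
proof -
  note A = respects_relationsD[OF assms(1)]
  show ?thesis
    unfolding respects_relations_def smul_def
  proof (intro conjI allI, goal_cases)
    case (1 u v x y)
    show ?case using A(1)[of u x y v] by (simp add: distrib_left)
  next
    case (2 u v c x)
    show ?case using A(2)[of u c x v] by simp
  next
    case (3 u v x y)
    show ?case using A(3)[of u x y v] by (simp add: distrib_left)
  next
    case (4 u v x)
    show ?case using A(4)[of u x v] by simp
  qed
qed

section \<open>Finite dimension of the coordinate ring\<close>

text \<open>A functional is linear in each letter. Letters are exchanged for elements of
  \<open>B\<close> one at a time from the right, with \<open>v\<close> collecting those already in
  \<open>B\<close>.\<close>

lemma respects_relations_vanish_span:
  fixes scale :: "'k::field \<Rightarrow> 'g::ab_group_add \<Rightarrow> 'g"
  assumes "vector_space scale" and R: "respects_relations scale br pmap a"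
    and span: "module.span scale B = UNIV"
    and B: "\<And>w. set w \<subseteq> B \<Longrightarrow> length w = m \<Longrightarrow> a w = 0"
  shows "length w = m \<Longrightarrow> a w = 0"
proof -
  interpret vector_space scale by fact
  note R = respects_relationsD[OF R]
  have *: "a (u @ v) = 0" if "set v \<subseteq> B" "length u + length v = m" for u v
    using that
  proof (induction u arbitrary: v rule: rev_induct)
    case Nil
    then show ?case using B by simp
  next
    case (snoc x u)
    have "x \<in> span B" using span by simp
    then have "a (u @ [x] @ v) = 0"
    proof (induction rule: span_induct_alt)
      case base
      show ?case using R(2)[of u 0 0 v] by simp
    next
      case (step c x y)
      have "a (u @ [scale c x + y] @ v) = c * a (u @ [x] @ v) + a (u @ [y] @ v)"
        by (simp only: R(1,2))
      moreover have "a (u @ [x] @ v) = 0"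
        using snoc.IH[of "x # v"] snoc.prems step by simp
      ultimately show ?case using step by simp
    qed
    then show ?case by simp
  qed
  show "length w = m \<Longrightarrow> a w = 0"
    using *[of "[]" w] by simp
qed

text \<open>On words of length \<open>m\<close> such an \<open>a\<close> is symmetric, since it vanishes on shorter words.\<close>

lemma respects_relations_gather:
  fixes scale :: "'k::field \<Rightarrow> 'g::ab_group_add \<Rightarrow> 'g"
  assumes R: "respects_relations scale br pmap a"
    and short: "\<And>w. length w < m \<Longrightarrow> a w = 0"
    and "length w = m" "k \<le> count_list w b"
  shows "\<exists>r. length w = k + length r \<and> count_list w b = k + count_list r b
      \<and> a w = a (replicate k b @ r)"
  using assms(4)
proof (induction k)
  case 0
  show ?case by auto
next
  case (Suc k)
  then obtain r where r: "length w = k + length r" "count_list w b = k + count_list r b"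
      "a w = a (replicate k b @ r)" by auto
  then have "count_list r b \<noteq> 0" using Suc.prems by simp
  then have "b \<in> set r" by (simp add: count_list_0_iff)
  then obtain s t where st: "r = s @ b # t" by (meson split_list)
  have swap: "a (u @ [x, y] @ v) = a (u @ [y, x] @ v)" if "length u + length v + 2 = m" for u v x y
    using respects_relationsD(3)[OF R, of u x y v] short[of "u @ [br x y] @ v"] that by simp
  have "a (u @ s' @ b # v) = a (u @ b # s' @ v)" if "length u + length s' + length v + 1 = m" for u s' v
    using that
  proof (induction s' arbitrary: v rule: rev_induct)
    case (snoc y s')
    have "a (u @ (s' @ [y]) @ b # v) = a ((u @ s') @ [y, b] @ v)" by simp
    also have "\<dots> = a ((u @ s') @ [b, y] @ v)" by (rule swap) (use snoc.prems in simp)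
    also have "\<dots> = a (u @ b # s' @ y # v)" using snoc.IH[of "y # v"] snoc.prems by simp
    finally show ?case by simp
  qed simp
  from this[of "replicate k b" s t] have "a w = a (replicate (Suc k) b @ s @ t)"
    using r st assms(3) by (simp add: replicate_app_Cons_same)
  then show ?case using r st by (intro exI[of _ "s @ t"]) auto
qed

text \<open>This is the spanning half of the Poincare-Birkhoff-Witt theorem for the restricted
  enveloping algebra, in dual form. In a long word over a finite spanning set some letter occurs p
  times; modulo shorter words its occurrences can be gathered, and then x^p is replaced by the
  single letter \<open>pmap x\<close>.\<close>

lemma coord_ring_finitely_determined:
  fixes scale :: "'k::field \<Rightarrow> 'g::ab_group_add \<Rightarrow> 'g"
  assumes p: "CHAR('k) > 0" and vs: "vector_space scale" and fin: "fin_dim scale"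
  shows "\<exists>W. finite W \<and> (\<forall>a\<in>coord_ring scale br pmap. (\<forall>w\<in>W. a w = 0) \<longrightarrow> a = (\<lambda>_. 0))"
proof -
  obtain B where B: "finite B" "module.span scale B = UNIV" using fin by (auto simp: fin_dim_def)
  \<comment> \<open>The bound comes from the pigeonhole principle: a word in which each letter of
    \<open>B\<close> occurs at most p - 1 times has length at most \<open>N\<close>.\<close>
  define N where "N = card B * (CHAR('k) - 1)"
  define W where "W = {w. set w \<subseteq> B \<and> length w \<le> N}"
  have p2: "CHAR('k) \<ge> 2"
    using p CHAR_not_1[where ?'a = 'k] by (metis One_nat_def Suc_1 Suc_leI le_neq_implies_less)
  have "a w = 0" if a: "a \<in> coord_ring scale br pmap" and W: "\<forall>w\<in>W. a w = 0" for a w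
  proof (induction "length w" arbitrary: w rule: less_induct)
    case less
    have R: "respects_relations scale br pmap a" using a by (simp add: coord_ring_iff)
    have "a v = 0" if v: "set v \<subseteq> B" "length v = length w" for v
    proof (cases "length v \<le> N")
      case True
      then show ?thesis using v W by (simp add: W_def)
    next
      case False
      have "\<exists>b. CHAR('k) \<le> count_list v b"
      proof (rule ccontr)
        assume "\<nexists>b. CHAR('k) \<le> count_list v b"
        then have "count_list v b \<le> CHAR('k) - 1" for b
          by (metis Suc_pred' linorder_not_less not_less_eq_eq p)
        then have "sum (count_list v) B \<le> N"
          unfolding N_def using sum_bounded_above[of B "count_list v" "CHAR('k) - 1"] by simp
        then show False using sum_count_set[OF v(1) B(1)] False by simp
      qed
      then obtain b where "CHAR('k) \<le> count_list v b" by blast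
      then obtain r where r: "length v = CHAR('k) + length r" "a v = a (replicate CHAR('k) b @ r)"
        using respects_relations_gather[OF R less v(2), of "CHAR('k)" b] by blast
      have "a v = a ([] @ [pmap b] @ r)"
        using respects_relationsD(4)[OF R, of "[]" b r] r(2) by simp
      \<comment> \<open>The new word is shorter by p - 1 letters, and p - 1 > 0.\<close>
      also have "\<dots> = 0" by (rule less) (use r(1) v(2) p2 in simp)
      finally show ?thesis .
    qed
    then show ?case using respects_relations_vanish_span[OF vs R B(2)] by blast
  qed
  moreover have "finite W" unfolding W_def using B(1) by (rule finite_lists_length_le)
  ultimately show ?thesis by blast
qed

text \<open>This is Gaussian elimination, one evaluation point at a time, passing to the subspace
  vanishing at that point. The evaluations may be dependent, so the family need not be a basis; a
  point at which all of \<open>V\<close> vanishes receives the vector 0.\<close>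

lemma finitely_determined_dual_family:
  fixes V :: "('x \<Rightarrow> 'k::field) set"
  assumes "finite W" "\<And>a b. a \<in> V \<Longrightarrow> b \<in> V \<Longrightarrow> a + b \<in> V" "\<And>c a. a \<in> V \<Longrightarrow> smul c a \<in> V"
    "0 \<in> V" "\<And>a. a \<in> V \<Longrightarrow> (\<forall>w\<in>W. a w = 0) \<Longrightarrow> a = 0"
  shows "\<exists>e. (\<forall>w\<in>W. e w \<in> V) \<and> (\<forall>a\<in>V. \<forall>x. a x = (\<Sum>w\<in>W. a w * e w x))"
  using assms
proof (induction W arbitrary: V rule: finite_induct)
  case empty
  then show ?case by (metis empty_iff sum.empty zero_fun_apply)
next
  case (insert w W)
  note V = insert.prems
  let ?V' = "{a \<in> V. a w = 0}"
  have "\<exists>e. (\<forall>w\<in>W. e w \<in> ?V') \<and> (\<forall>a\<in>?V'. \<forall>x. a x = (\<Sum>w\<in>W. a w * e w x))"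
  proof (rule insert.IH)
    fix a b c assume a: "a \<in> ?V'"
    then show "smul c a \<in> ?V'" using V(2)[of a c] by (simp add: smul_def)
    show "b \<in> ?V' \<Longrightarrow> a + b \<in> ?V'" using a V(1)[of a b] by (simp add: plus_fun_def)
    show "\<forall>v\<in>W. a v = 0 \<Longrightarrow> a = 0" using a V(4)[of a] by (simp add: zero_fun_def)
  qed (use V(3) in \<open>simp add: zero_fun_def\<close>)
  then obtain e where e: "\<And>v. v \<in> W \<Longrightarrow> e v \<in> V" "\<And>v. v \<in> W \<Longrightarrow> e v w = 0"
    and e': "\<And>a x. a \<in> V \<Longrightarrow> a w = 0 \<Longrightarrow> a x = (\<Sum>v\<in>W. a v * e v x)" by blast
  have sub: "(\<lambda>x. a x - c * b x) \<in> V" if "a \<in> V" "b \<in> V" for a b c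
    using V(1)[OF that(1) V(2)[OF that(2), of "- c"]] by (simp add: smul_def plus_fun_def)
  show ?case
  proof (cases "\<exists>a\<in>V. a w \<noteq> 0")
    case False
    have "a x = (\<Sum>v\<in>insert w W. a v * (e(w := 0)) v x)" if a: "a \<in> V" for a x
    proof -
      have "(\<Sum>v\<in>W. a v * e v x) = (\<Sum>v\<in>W. a v * (e(w := 0)) v x)"
        using insert.hyps(2) by (intro sum.cong) auto
      moreover have "a x = (\<Sum>v\<in>W. a v * e v x)"
        by (rule e'[OF a]) (use False a in blast)
      ultimately show ?thesis
        by (simp only: sum.insert[OF insert.hyps] fun_upd_same zero_fun_apply mult_zero_right add_0)
    qed
    then show ?thesis
      using V(3) e(1) by (intro exI[of _ "e(w := 0)"]) (auto simp: zero_fun_def)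
  next
    case True
    then obtain b where b: "b \<in> V" "b w \<noteq> 0" by blast
    define f where "f = smul (1 / b w) b"
    have f: "f \<in> V" "f w = 1"
      using V(2)[OF b(1), of "1 / b w"] b(2) by (simp_all add: f_def smul_def)
    \<comment> \<open>For \<open>a\<close> in \<open>V\<close>, the difference a - a(w) f vanishes
      at \<open>w\<close> and expands in the family of the subspace; collecting the coefficient of
      a(w) leaves exactly this \<open>g\<close>.\<close>
    define g where "g x = f x - (\<Sum>v\<in>W. f v * e v x)" for x
    have "(\<lambda>x. f x - (\<Sum>v\<in>U. f v * e v x)) \<in> V" if "finite U" "U \<subseteq> W" for U
      using that
    proof (induction U rule: finite_induct)
      case (insert u U)
      then show ?case
        using sub[of "\<lambda>x. f x - (\<Sum>v\<in>U. f v * e v x)" "e u" "f u"] e(1)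
        by (simp add: algebra_simps)
    qed (use f in simp)
    from this[OF insert.hyps(1) subset_refl] have g: "g \<in> V" by (simp add: g_def[abs_def])
    have "a x = (\<Sum>v\<in>insert w W. a v * (e(w := g)) v x)" if a: "a \<in> V" for a x
    proof -
      have "a x - a w * f x = (\<Sum>v\<in>W. (a v - a w * f v) * e v x)"
        by (rule e'[OF sub[OF a f(1)]]) (simp add: f)
      then have "a x = a w * g x + (\<Sum>v\<in>W. a v * e v x)"
        by (simp add: g_def algebra_simps sum_subtractf sum_distrib_left)
      moreover have "(\<Sum>v\<in>W. a v * e v x) = (\<Sum>v\<in>W. a v * (e(w := g)) v x)"
        using insert.hyps(2) by (intro sum.cong) auto
      ultimately show ?thesis using insert.hyps by simp
    qed
    then show ?thesis using g e(1) by (intro exI[of _ "e(w := g)"]) auto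
  qed
qed

text \<open>The properties of the coordinate ring on which the remaining argument rests.
  \<open>A_comult\<close> says that \<Delta> maps into A \<otimes> A, with \<Delta>(a) written as a
  finite sum of right translates of \<open>a\<close> tensored with fixed elements.
  \<open>A_bounded\<close> makes the filtration by word length finite.\<close>

locale coord_algebra =
  fixes A :: "('g list \<Rightarrow> 'k::field) set"
  assumes char_pos: "CHAR('k) > 0"
    and A_add: "a \<in> A \<Longrightarrow> b \<in> A \<Longrightarrow> a + b \<in> A"
    and A_smul: "a \<in> A \<Longrightarrow> smul c a \<in> A"
    and A_one: "(\<lambda>w. if w = [] then 1 else 0) \<in> A"
    and A_sconv: "a \<in> A \<Longrightarrow> b \<in> A \<Longrightarrow> sconv a b \<in> A"
    and A_translate: "a \<in> A \<Longrightarrow> (\<lambda>w. a (w @ v)) \<in> A"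
    and A_comult: "\<exists>W e. finite W \<and> (\<forall>w\<in>W. e w \<in> A)
      \<and> (\<forall>a\<in>A. \<forall>u v. a (u @ v) = (\<Sum>w\<in>W. a (u @ w) * e w v))"
    and A_bounded: "\<exists>N. \<forall>a\<in>A. (\<forall>w. length w < N \<longrightarrow> a w = 0) \<longrightarrow> a = (\<lambda>_. 0)"

lemma coord_algebra_coord_ring:
  fixes scale :: "'k::field \<Rightarrow> 'g::ab_group_add \<Rightarrow> 'g"
  assumes p: "CHAR('k) > 0" and vs: "vector_space scale" and fin: "fin_dim scale"
  shows "coord_algebra (coord_ring scale br pmap)"
proof -
  let ?A = "coord_ring scale br pmap"
  obtain W where W: "finite W" "\<And>a. a \<in> ?A \<Longrightarrow> (\<forall>w\<in>W. a w = 0) \<Longrightarrow> a = (\<lambda>_. 0)"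
    using coord_ring_finitely_determined[OF p vs fin, of br pmap] by metis
  have add: "a + b \<in> ?A" if "a \<in> ?A" "b \<in> ?A" for a b
    using that respects_relations_add by (simp add: coord_ring_iff)
  have smul: "smul c a \<in> ?A" if "a \<in> ?A" for c a
    using that respects_relations_smul by (simp add: coord_ring_iff)
  have one: "(\<lambda>w. if w = [] then 1 else 0) \<in> ?A"
    using p by (auto simp: coord_ring_iff respects_relations_def)
  have zero: "0 \<in> ?A" using smul[OF one, of 0] by (simp add: smul_def zero_fun_def)
  obtain e where e: "\<And>w. w \<in> W \<Longrightarrow> e w \<in> ?A"
    and e': "\<And>a x. a \<in> ?A \<Longrightarrow> a x = (\<Sum>w\<in>W. a w * e w x)"
    using finitely_determined_dual_family[OF W(1) add smul zero, folded zero_fun_def]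
      W(2)[folded zero_fun_def] by blast
  have left: "(\<lambda>w. a (u @ w)) \<in> ?A" and right: "(\<lambda>w. a (w @ u)) \<in> ?A" if "a \<in> ?A" for a u
    using that respects_relations_translate by (auto simp: coord_ring_iff)
  show ?thesis
  proof
    show "sconv a b \<in> ?A" if "a \<in> ?A" "b \<in> ?A" for a b
      using that respects_relations_sconv[OF p] by (simp add: coord_ring_iff)
    \<comment> \<open>The comultiplication comes from expanding the left translate of
      \<open>a\<close> by \<open>u\<close> in the family \<open>e\<close>, with \<open>v\<close> as
      the variable.\<close>
    show "\<exists>W e. finite W \<and> (\<forall>w\<in>W. e w \<in> ?A)
        \<and> (\<forall>a\<in>?A. \<forall>u v. a (u @ v) = (\<Sum>w\<in>W. a (u @ w) * e w v))"
      using W(1) e e'[OF left] by blast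
    show "\<exists>N. \<forall>a\<in>?A. (\<forall>w. length w < N \<longrightarrow> a w = 0) \<longrightarrow> a = (\<lambda>_. 0)"
    proof (intro exI ballI impI)
      \<comment> \<open>Every word of \<open>W\<close> has length at most the maximum, hence below
        its successor.\<close>
      fix a assume a: "a \<in> ?A" "\<forall>w. length w < Suc (Max (length ` W)) \<longrightarrow> a w = 0"
      then show "a = (\<lambda>_. 0)"
        using W by (metis Max_ge finite_imageI imageI less_Suc_eq_le)
    qed
  qed (fact p add smul one right)+
qed

section \<open>Tensor powers of the augmentation ideal\<close>

interpretation funsp: vector_space "smul :: 'k::field \<Rightarrow> ('x \<Rightarrow> 'k) \<Rightarrow> 'x \<Rightarrow> 'k"
  by standard (auto simp: smul_def fun_eq_iff algebra_simps)

lemma tensor_power_eq: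
  "tensor_power V n = funsp.span {pure_tensor as | as. length as = n \<and> set as \<subseteq> V}"
  unfolding tensor_power_def smul_def[abs_def] by (rule refl)

lemma pure_tensor_in [intro]: "length as = n \<Longrightarrow> set as \<subseteq> V \<Longrightarrow> pure_tensor as \<in> tensor_power V n"
  unfolding tensor_power_eq by (intro funsp.span_base) blast

lemma tensor_power_closed:
  "0 \<in> tensor_power V n"
  "x \<in> tensor_power V n \<Longrightarrow> y \<in> tensor_power V n \<Longrightarrow> x + y \<in> tensor_power V n"
  "x \<in> tensor_power V n \<Longrightarrow> y \<in> tensor_power V n \<Longrightarrow> x - y \<in> tensor_power V n"
  "x \<in> tensor_power V n \<Longrightarrow> - x \<in> tensor_power V n"
  "x \<in> tensor_power V n \<Longrightarrow> smul c x \<in> tensor_power V n"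
  unfolding tensor_power_eq
  by (intro funsp.span_zero funsp.span_add funsp.span_diff funsp.span_neg funsp.span_scale; assumption)+

text \<open>When the generators absorb scalars, their span is generated by them under addition
  alone. The exponential is additive but not linear, so no induction step with a scalar multiple
  could be handled.\<close>

lemma span_smul_induct [consumes 2, case_names zero add]:
  assumes "x \<in> funsp.span S" "\<forall>s\<in>S. \<forall>c. smul c s \<in> S"
    and "P 0" "\<And>s y. s \<in> S \<Longrightarrow> y \<in> funsp.span S \<Longrightarrow> P y \<Longrightarrow> P (s + y)"
  shows "P x"
proof -
  have "P x \<and> x \<in> funsp.span S"
    using assms(1)
  proof (induction rule: funsp.span_induct_alt)
    case base
    show ?case using assms(3) funsp.span_zero by blast
  next
    case (step c s y)
    then show ?case
      using assms(2) assms(4)[of "smul c s" y] by (blast intro: funsp.span_add funsp.span_base)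
  qed
  then show ?thesis by simp
qed

lemma smul_pure_tensor: "smul c (pure_tensor (a # as)) = pure_tensor (smul c a # as)"
  by (rule ext) (simp add: pure_tensor_Cons tcons_def smul_def split: list.split)

lemma conv_span:
  assumes "x \<in> funsp.span S" "y \<in> funsp.span T"
    and "\<And>s t. s \<in> S \<Longrightarrow> t \<in> T \<Longrightarrow> conv s t \<in> funsp.span U"
  shows "conv x y \<in> funsp.span U"
  using assms(1)
proof (induction rule: funsp.span_induct_alt)
  case base
  then show ?case by (simp only: conv_zero_left funsp.span_zero)
next
  case (step c s x')
  have "conv s y \<in> funsp.span U"
    using assms(2)
  proof (induction rule: funsp.span_induct_alt)
    case base
    then show ?case by (simp only: conv_zero_right funsp.span_zero)
  next
    case (step d t y')
    have "conv s t \<in> funsp.span U" using \<open>s \<in> S\<close> step(1) by (rule assms(3))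
    with step(2) show ?case
      by (simp only: conv_add_right conv_smul_right) (intro funsp.span_add funsp.span_scale)
  qed
  with step show ?case
    by (simp only: conv_add_left conv_smul_left) (intro funsp.span_add funsp.span_scale)
qed

lemma supported_span:
  assumes "x \<in> funsp.span S" "\<And>s. s \<in> S \<Longrightarrow> supported n s"
  shows "supported n x"
  using assms(1)
  by (induction rule: funsp.span_induct_alt) (use assms(2) in \<open>auto simp: supported_def smul_def\<close>)

lemma supported_tensor_power: "x \<in> tensor_power V n \<Longrightarrow> supported n x"
  unfolding tensor_power_eq
  by (rule supported_span) (use supported_pure_tensor in auto)

lemma tensor_power_mono: "V \<subseteq> V' \<Longrightarrow> tensor_power V n \<subseteq> tensor_power V' n"
  unfolding tensor_power_eq by (intro funsp.span_mono) auto

lemma unit_cochain_pure: "unit_cochain n = pure_tensor (replicate n (\<lambda>w. if w = [] then 1 else 0))"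
  by (induction n) (simp_all add: pure_tensor_Nil pure_tensor_Cons unit_cochain_Suc)

text \<open>On A^{\<otimes>n} this is the projection onto I^{\<otimes>n}, the tensor power of the
  projection of A onto I along the constants. Its fixed points characterise I^{\<otimes>n} by
  vanishing whenever some entry is the empty word.\<close>

definition kill_empty :: "('g, 'k::field) cochain \<Rightarrow> ('g, 'k) cochain" where
  "kill_empty \<phi> ws = (if [] \<in> set ws then 0 else \<phi> ws)"

lemma kill_empty_pure:
  "kill_empty (pure_tensor as) = pure_tensor (map (\<lambda>a w. if w = [] then 0 else a w) as)"
proof
  fix ws show "kill_empty (pure_tensor as) ws = pure_tensor (map (\<lambda>a w. if w = [] then 0 else a w) as) ws"
  proof (induction as arbitrary: ws)
    case Nil
    then show ?case by (simp add: kill_empty_def pure_tensor_Nil unit_cochain_def)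
  next
    case (Cons a as)
    show ?case
      using Cons[of "tl ws"] by (cases ws) (auto simp: kill_empty_def pure_tensor_Cons)
  qed
qed

section \<open>The filtration by word length in the first factor\<close>

definition low_filt :: "('g list \<Rightarrow> 'k::field) set \<Rightarrow> nat \<Rightarrow> ('g list \<Rightarrow> 'k) set" where
  "low_filt A m = {a \<in> aug_ideal A. \<forall>w. length w < m \<longrightarrow> a w = 0}"

text \<open>The index \<open>n\<close> counts the factors after the first, so the degree is
  \<open>n + 1\<close>; \<open>m\<close> is the filtration level.\<close>

definition filt_gens :: "('g list \<Rightarrow> 'k::field) set \<Rightarrow> nat \<Rightarrow> nat \<Rightarrow> ('g, 'k) cochain set" where
  "filt_gens A n m = {pure_tensor (a # as) | a as.
     a \<in> low_filt A m \<and> length as = n \<and> set as \<subseteq> aug_ideal A}"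

abbreviation tensor_filt :: "('g list \<Rightarrow> 'k::field) set \<Rightarrow> nat \<Rightarrow> nat \<Rightarrow> ('g, 'k) cochain set" where
  "tensor_filt A n m \<equiv> funsp.span (filt_gens A n m)"

lemma tensor_filt_mono: "m \<le> l \<Longrightarrow> tensor_filt A n l \<subseteq> tensor_filt A n m"
proof (rule funsp.span_mono)
  assume "m \<le> l"
  then have "low_filt A l \<subseteq> low_filt A m" by (auto simp: low_filt_def)
  then show "filt_gens A n l \<subseteq> filt_gens A n m" unfolding filt_gens_def by blast
qed

text \<open>Level 1 imposes no extra condition: vanishing on words of length 0 already defines the
  augmentation ideal.\<close>

lemma tensor_filt_one: "tensor_filt A n (Suc 0) = tensor_power (aug_ideal A) (Suc n)"
proof -
  have "filt_gens A n (Suc 0) = {pure_tensor as | as. length as = Suc n \<and> set as \<subseteq> aug_ideal A}"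
    (is "?L = ?R")
  proof
    show "?L \<subseteq> ?R"
      unfolding filt_gens_def low_filt_def by (force intro: exI[of _ "_ # _"])
    show "?R \<subseteq> ?L"
    proof
      fix x assume "x \<in> ?R"
      then obtain as where as: "x = pure_tensor as" "length as = Suc n" "set as \<subseteq> aug_ideal A" by auto
      then show "x \<in> ?L"
        by (cases as) (auto simp: filt_gens_def low_filt_def aug_ideal_def)
    qed
  qed
  then show ?thesis unfolding tensor_power_eq by (rule arg_cong)
qed

context coord_algebra
begin

abbreviation "I \<equiv> aug_ideal A"

lemma p_ge_2: "CHAR('k) \<ge> 2"
  using char_pos CHAR_not_1[where ?'a = 'k] by (metis One_nat_def Suc_1 Suc_leI le_neq_implies_less)

lemma I_subset: "I \<subseteq> A"
  by (auto simp: aug_ideal_def)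

lemma A_zero: "0 \<in> A"
  using A_smul[OF A_one, of 0] by (simp add: smul_def zero_fun_def)

lemma I_smul: "a \<in> I \<Longrightarrow> smul c a \<in> I"
  using A_smul by (auto simp: aug_ideal_def smul_def)

lemma I_zero: "0 \<in> I"
  using A_zero by (simp add: aug_ideal_def)

lemma I_sconv: "a \<in> I \<Longrightarrow> b \<in> I \<Longrightarrow> sconv a b \<in> I"
  using A_sconv by (auto simp: aug_ideal_def sconv_def)

lemma kill_A: "a \<in> A \<Longrightarrow> (\<lambda>w. if w = [] then 0 else a w) \<in> I"
proof -
  assume a: "a \<in> A"
  have "a + smul (- a []) (\<lambda>w. if w = [] then 1 else 0) \<in> A"
    by (intro A_add A_smul A_one a)
  moreover have "a + smul (- a []) (\<lambda>w. if w = [] then 1 else 0) = (\<lambda>w. if w = [] then 0 else a w)"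
    by (rule ext) (simp add: smul_def)
  ultimately show ?thesis by (simp add: aug_ideal_def)
qed

lemma tensor_power_conv:
  assumes V: "\<And>a b. a \<in> V \<Longrightarrow> b \<in> V \<Longrightarrow> sconv a b \<in> V"
    and "x \<in> tensor_power V n" "y \<in> tensor_power V n"
  shows "conv x y \<in> tensor_power V n"
  using assms(2,3) unfolding tensor_power_eq
proof (rule conv_span)
  fix s t
  assume "s \<in> {pure_tensor as |as. length as = n \<and> set as \<subseteq> V}"
    "t \<in> {pure_tensor as |as. length as = n \<and> set as \<subseteq> V}"
  then obtain as bs where *: "s = pure_tensor as" "t = pure_tensor bs" "length as = n" "length bs = n"
    "set as \<subseteq> V" "set bs \<subseteq> V" by blast
  have "conv s t = pure_tensor (map2 sconv as bs)" using * by (simp add: conv_pure_tensor)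
  moreover have "set (map2 sconv as bs) \<subseteq> V"
    using *(5,6) by (auto elim!: in_set_zipE intro!: V)
  ultimately show "conv s t \<in> funsp.span {pure_tensor as |as. length as = n \<and> set as \<subseteq> V}"
    using * by (intro funsp.span_base) (auto intro!: exI[of _ "map2 sconv as bs"])
qed

lemma tensor_power_unit: "unit_cochain n \<in> tensor_power A n"
  unfolding unit_cochain_pure by (rule pure_tensor_in) (use A_one in auto)

lemma tensor_power_I_subset: "tensor_power I n \<subseteq> tensor_power A n"
  by (rule tensor_power_mono[OF I_subset])

lemma tensor_power_I_vanish:
  assumes "x \<in> tensor_power I n" "[] \<in> set ws"
  shows "x ws = 0"
proof -
  have "kill_empty x = x"
    using assms(1) unfolding tensor_power_eq
  proof (induction rule: funsp.span_induct_alt)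
    case base
    then show ?case by (simp add: kill_empty_def fun_eq_iff)
  next
    case (step c s y)
    then obtain as where as: "s = pure_tensor as" "set as \<subseteq> I" by blast
    have "map (\<lambda>a w. if w = [] then 0 else a w) as = as"
      using as(2) by (intro map_idI ext) (auto simp: aug_ideal_def)
    then have "kill_empty s = s" by (simp add: as(1) kill_empty_pure)
    with step(2) have "s ws = 0" "y ws = 0" if "[] \<in> set ws" for ws
      using that by (metis kill_empty_def)+
    then show ?case by (intro ext) (simp add: kill_empty_def smul_def)
  qed
  then show ?thesis using assms(2) by (metis kill_empty_def)
qed

lemma kill_empty_tensor_power: "x \<in> tensor_power A n \<Longrightarrow> kill_empty x \<in> tensor_power I n"
  unfolding tensor_power_eq[of A]
proof (induction rule: funsp.span_induct_alt)
  case base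
  have "kill_empty 0 = (0 :: ('g, 'k) cochain)" by (simp add: kill_empty_def fun_eq_iff)
  then show ?case using tensor_power_closed(1) by metis
next
  case (step c s y)
  then obtain as where as: "s = pure_tensor as" "length as = n" "set as \<subseteq> A" by blast
  have "kill_empty s \<in> tensor_power I n"
    unfolding as(1) kill_empty_pure by (rule pure_tensor_in) (use as kill_A in auto)
  moreover have "kill_empty (smul c s + y) = smul c (kill_empty s) + kill_empty y"
    by (simp add: kill_empty_def fun_eq_iff smul_def)
  ultimately show ?case using step(2) tensor_power_closed(2,5) by metis
qed

text \<open>Applying the counit to a factor inserts an empty word there, so normalised means
  vanishing at all tuples with an empty entry, i.e. being fixed by
  \<open>kill_empty\<close>.\<close>

lemma C_add_eq: "C_add A n = tensor_power I n"
proof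
  show "C_add A n \<subseteq> tensor_power I n"
  proof
    fix x assume x: "x \<in> C_add A n"
    have "x ws = 0" if "[] \<in> set ws" for ws
    proof (cases "length ws = n")
      case True
      obtain us vs where ws: "ws = us @ [] # vs" using \<open>[] \<in> set ws\<close> by (meson split_list)
      have "counit_at (length us) x (us @ vs) = 0"
        using x True ws by (simp add: C_add_def)
      then show ?thesis by (simp add: counit_at_def ws)
    next
      case False
      then show ?thesis
        using x supported_tensor_power[of x A n] by (simp add: C_add_def supported_def)
    qed
    then have "kill_empty x = x" by (auto simp: kill_empty_def fun_eq_iff)
    moreover have "x \<in> tensor_power A n" using x by (simp add: C_add_def)
    ultimately show "x \<in> tensor_power I n" using kill_empty_tensor_power by metis
  qed
  show "tensor_power I n \<subseteq> C_add A n"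
    using tensor_power_I_subset tensor_power_I_vanish
    by (auto simp: C_add_def counit_at_def fun_eq_iff)
qed

lemma one_plus_eq: "one_plus A n = (\<lambda>\<phi>. unit_cochain n + \<phi>) ` tensor_power I n"
  by (auto simp: one_plus_def plus_fun_def)

text \<open>If u and v together have fewer than m + l letters, then u has fewer than m or v fewer
  than l.\<close>

lemma low_filt_sconv:
  assumes "a \<in> low_filt A m" "b \<in> low_filt A l"
  shows "sconv a b \<in> low_filt A (m + l)"
proof -
  have "sconv a b w = 0" if "length w < m + l" for w
  proof -
    have "a u * b v = 0" if "(u, v) \<in> set (splits w)" for u v
      using splits_length[OF that] \<open>length w < m + l\<close> assms
      by (cases "length u < m") (auto simp: low_filt_def)
    then have *: "map (\<lambda>(u, v). a u * b v) (splits w) = map (\<lambda>_. 0) (splits w)"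
      by (intro map_cong) auto
    show ?thesis by (simp only: sconv_def * sum_list_0)
  qed
  then show ?thesis using assms I_sconv by (auto simp: low_filt_def)
qed

lemma tensor_filt_conv:
  assumes "x \<in> tensor_filt A n m" "y \<in> tensor_filt A n l"
  shows "conv x y \<in> tensor_filt A n (m + l)"
  using assms
proof (rule conv_span)
  fix s t assume "s \<in> filt_gens A n m" "t \<in> filt_gens A n l"
  then obtain a as b bs where *: "s = pure_tensor (a # as)" "t = pure_tensor (b # bs)"
    "a \<in> low_filt A m" "b \<in> low_filt A l" "length as = n" "length bs = n"
    "set as \<subseteq> I" "set bs \<subseteq> I" unfolding filt_gens_def by blast
  have "conv s t = pure_tensor (sconv a b # map2 sconv as bs)"
    using * by (simp add: conv_pure_tensor)
  moreover have "set (map2 sconv as bs) \<subseteq> I"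
    using *(7,8) by (auto elim!: in_set_zipE intro!: I_sconv)
  ultimately have "conv s t \<in> filt_gens A n (m + l)"
    unfolding filt_gens_def using * low_filt_sconv[of a m b l]
    by (auto intro!: exI[of _ "sconv a b"] exI[of _ "map2 sconv as bs"])
  then show "conv s t \<in> tensor_filt A n (m + l)" by (rule funsp.span_base)
qed

lemma filt_gens_smul: "\<forall>s\<in>filt_gens A n m. \<forall>c. smul c s \<in> filt_gens A n m"
proof (intro ballI allI)
  fix s c assume "s \<in> filt_gens A n m"
  then obtain a as where *: "s = pure_tensor (a # as)" "a \<in> low_filt A m" "length as = n" "set as \<subseteq> I"
    unfolding filt_gens_def by blast
  have "smul c a \<in> low_filt A m" using *(2) I_smul by (auto simp: low_filt_def smul_def)
  then show "smul c s \<in> filt_gens A n m"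
    unfolding filt_gens_def using * smul_pure_tensor[of c a as] by blast
qed

section \<open>Surjectivity of the exponential\<close>

text \<open>The bound on \<open>n\<close> leaves at least one factor in the tail; since it lies in
  I, the tail has no constant term and \<open>EE_tcons\<close> applies.\<close>

lemma Exp_pure_tensor:
  assumes "n \<ge> 2" "length as = n" "set as \<subseteq> I"
  shows "Exp n (pure_tensor as) = (\<Sum>j<CHAR('k). smul (1 / of_nat (fact j)) (cpow n (pure_tensor as) j))"
proof
  fix ws :: "'g list list"
  obtain a bs where as: "as = a # bs" "bs \<noteq> []" "n = Suc (length bs)"
    using assms(1,2) by (cases as; cases "tl as") auto
  show "Exp n (pure_tensor as) ws
      = (\<Sum>j<CHAR('k). smul (1 / of_nat (fact j)) (cpow n (pure_tensor as) j)) ws"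
  proof (cases "length ws = n")
    case True
    have "pure_tensor bs (replicate (length bs) []) = 0"
      by (rule pure_tensor_empty) (use as assms(3) in \<open>auto simp: aug_ideal_def\<close>)
    moreover have "a [] = 0" using as assms(3) by (simp add: aug_ideal_def)
    ultimately show ?thesis
      using EE_tcons[OF char_pos supported_pure_tensor, of bs a ws] True as(3)
      by (simp add: Exp_def as(1) pure_tensor_Cons)
  next
    case False
    then show ?thesis
      using supported_cpow[of n "pure_tensor as"]
      by (simp add: Exp_def sum_fun_at smul_def supported_def)
  qed
qed

text \<open>Apart from 1 + s, the truncated exponential consists of powers of s of exponent at least
  2, which lie in level 2m \<ge> m + 1.\<close>

lemma Exp_gen_filt:
  assumes "n \<ge> 1" "m \<ge> 1" "s \<in> filt_gens A n m"
  shows "Exp (Suc n) s - unit_cochain (Suc n) - s \<in> tensor_filt A n (Suc m)"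
proof -
  obtain a as where s: "s = pure_tensor (a # as)" "a \<in> low_filt A m" "length as = n" "set as \<subseteq> I"
    using assms(3) unfolding filt_gens_def by blast
  \<comment> \<open>The number of terms beyond the constant and the linear one; for p = 2 there are
    none.\<close>
  define q where "q = CHAR('k) - 2"
  have q: "CHAR('k) = Suc (Suc q)" using p_ge_2 by (simp add: q_def)
  have supp: "supported (Suc n) s" unfolding s(1) using supported_pure_tensor[of "a # as"] s(3) by simp
  have base: "s \<in> tensor_filt A n m" using assms(3) by (rule funsp.span_base)
  have c1: "cpow (Suc n) s (Suc j) \<in> tensor_filt A n m" for j
  proof (induction j)
    case 0
    then show ?case using base by (simp add: conv_unit supp)
  next
    case (Suc j)
    have "cpow (Suc n) s (Suc (Suc j)) \<in> tensor_filt A n (m + m)"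
      using tensor_filt_conv[OF Suc base] by simp
    then show ?case using tensor_filt_mono[of m "m + m" A n] by auto
  qed
  have c2: "cpow (Suc n) s (Suc (Suc j)) \<in> tensor_filt A n (Suc m)" for j
    using tensor_filt_conv[OF c1[of j] base] tensor_filt_mono[of "Suc m" "m + m" A n] assms(2) by auto
  have "Exp (Suc n) s = (\<Sum>j<CHAR('k). smul (1 / of_nat (fact j)) (cpow (Suc n) s j))"
    unfolding s(1) by (rule Exp_pure_tensor) (use assms(1) s in \<open>auto simp: low_filt_def\<close>)
  also have "\<dots> = unit_cochain (Suc n) + s
      + (\<Sum>j<q. smul (1 / of_nat (fact (Suc (Suc j)))) (cpow (Suc n) s (Suc (Suc j))))"
    unfolding q sum.lessThan_Suc_shift
    by (simp add: conv_unit supp smul_def comp_def del: fact_Suc cpow.simps(2)) 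
      (simp add: conv_unit supp add.assoc)
  finally have "Exp (Suc n) s - unit_cochain (Suc n) - s
      = (\<Sum>j<q. smul (1 / of_nat (fact (Suc (Suc j)))) (cpow (Suc n) s (Suc (Suc j))))"
    by simp
  also have "\<dots> \<in> tensor_filt A n (Suc m)"
    by (intro funsp.span_sum funsp.span_scale c2)
  finally show ?thesis .
qed

text \<open>With Exp s = 1 + s + r and Exp y = 1 + y + t, the product is 1 + (s + y) + (r + t) + (s
  + r)(y + t), and the last term lies in level 2m.\<close>

lemma Exp_filt:
  assumes "n \<ge> 1" "m \<ge> 1" "x \<in> tensor_filt A n m"
  shows "Exp (Suc n) x - unit_cochain (Suc n) - x \<in> tensor_filt A n (Suc m)"
  using assms(3) filt_gens_smul
proof (induction rule: span_smul_induct)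
  case zero
  have "Exp (Suc n) 0 - unit_cochain (Suc n) - 0 = (0 :: ('g, 'k) cochain)" by (simp add: Exp_zero)
  then show ?case using funsp.span_zero by metis
next
  case (add s y)
  let ?u = "unit_cochain (Suc n) :: ('g, 'k) cochain"
  define r where "r = Exp (Suc n) s - ?u - s"
  define t where "t = Exp (Suc n) y - ?u - y"
  have r: "r \<in> tensor_filt A n (Suc m)" unfolding r_def by (rule Exp_gen_filt[OF assms(1,2) add(1)])
  have t: "t \<in> tensor_filt A n (Suc m)" unfolding t_def by (rule add)
  have s: "s \<in> tensor_filt A n m" using add(1) by (rule funsp.span_base)
  have mono: "tensor_filt A n (m + l) \<subseteq> tensor_filt A n (Suc m)" if "l \<ge> 1" for l
    by (rule tensor_filt_mono) (use that in simp)
  have r': "s + r \<in> tensor_filt A n m" and t': "y + t \<in> tensor_filt A n m"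
    using r t s add(2) tensor_filt_mono[of m "Suc m" A n] by (auto intro!: funsp.span_add)
  have supp: "supported (Suc n) z" if "z \<in> tensor_filt A n m" for z
    using that tensor_filt_mono[of 1 m A n] assms(2) supported_tensor_power
    by (auto simp: tensor_filt_one)
  have "Exp (Suc n) (s + y) = conv (?u + (s + r)) (?u + (y + t))"
    by (simp add: Exp_add r_def t_def)
  also have "\<dots> = ?u + (s + r) + (y + t + conv (s + r) (y + t))"
    by (simp only: conv_add_left[of ?u] conv_add_right[of _ ?u] conv_unit[OF supported_unit]
        conv_unit[OF supp[OF t']] conv_unit_right[OF supp[OF r']] add.assoc)
  finally have "Exp (Suc n) (s + y) - ?u - (s + y) = t + r + conv (s + r) (y + t)"
    by (simp add: algebra_simps)
  also have "\<dots> \<in> tensor_filt A n (Suc m)"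
    using r t tensor_filt_conv[OF r' t'] mono[of m] assms(2)
    by (intro funsp.span_add) auto
  finally show ?case .
qed

lemma tensor_filt_eventually_zero: "\<exists>N. tensor_filt A n N = {0}"
proof -
  obtain N where N: "\<And>a. a \<in> A \<Longrightarrow> (\<forall>w. length w < N \<longrightarrow> a w = 0) \<Longrightarrow> a = (\<lambda>_. 0)"
    using A_bounded by blast
  have "x = 0" if gens: "x \<in> filt_gens A n N" for x
  proof -
    obtain a as where x: "x = pure_tensor (a # as)" "a \<in> low_filt A N"
      using gens unfolding filt_gens_def by blast
    have "a = (\<lambda>_. 0)" by (rule N) (use x(2) in \<open>auto simp: low_filt_def aug_ideal_def\<close>)
    then show ?thesis
      by (intro ext) (simp add: x(1) pure_tensor_Cons tcons_def split: list.split)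
  qed
  then have "filt_gens A n N \<subseteq> {0}" by blast
  then have "tensor_filt A n N \<subseteq> funsp.span {0}" by (rule funsp.span_mono)
  then show ?thesis using funsp.span_zero by (metis funsp.span_delete_0 funsp.span_empty Diff_cancel subset_singleton_iff empty_iff)
qed

text \<open>For x in level m, the product (1 + x) Exp(-x) is 1 + y with y in level m + 1. If T
  solves the problem for y, then T + x solves it for x. The induction counts the levels left until
  the filtration vanishes.\<close>

lemma Exp_surj_filt:
  assumes "n \<ge> 1" "m \<ge> 1" "x \<in> tensor_filt A n m"
  shows "\<exists>T \<in> tensor_power I (Suc n). Exp (Suc n) T = unit_cochain (Suc n) + x"
proof -
  obtain N where N: "tensor_filt A n N = {0}" using tensor_filt_eventually_zero by blast
  show ?thesis
    using assms(2,3)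
  proof (induction "N - m" arbitrary: m x)
    case 0
    then have "x = 0" using N tensor_filt_mono[of N m A n] by auto
    then have "Exp (Suc n) 0 = unit_cochain (Suc n) + x" by (simp only: Exp_zero add_0_right)
    then show ?case using tensor_power_closed(1) by blast
  next
    case (Suc d)
    let ?u = "unit_cochain (Suc n) :: ('g, 'k) cochain"
    define r where "r = Exp (Suc n) (- x) - ?u - (- x)"
    have nx: "- x \<in> tensor_filt A n m" using Suc.prems(2) by (rule funsp.span_neg)
    have r: "r \<in> tensor_filt A n (Suc m)"
      unfolding r_def by (rule Exp_filt[OF assms(1) Suc.prems(1) nx])
    have rm: "r \<in> tensor_filt A n m" using r tensor_filt_mono[of m "Suc m" A n] by auto
    have xI: "z \<in> tensor_power I (Suc n)" if "z \<in> tensor_filt A n m" for z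
      using that tensor_filt_mono[of 1 m A n] Suc.prems(1) by (auto simp: tensor_filt_one)
    have supp: "supported (Suc n) z" if "z \<in> tensor_filt A n m" for z
      using xI[OF that] by (rule supported_tensor_power)
    have nr: "- x + r \<in> tensor_filt A n m" by (intro funsp.span_add nx rm)
    have "conv x (- x + r) \<in> tensor_filt A n (Suc m)"
      using tensor_filt_conv[OF Suc.prems(2) nr] tensor_filt_mono[of "Suc m" "m + m" A n] Suc.prems(1)
      by auto
    \<comment> \<open>Since Exp(-x) = 1 - x + r, the linear terms of (1 + x)(1 - x + r) cancel and
      this is what remains besides 1.\<close>
    then have y: "r + conv x (- x + r) \<in> tensor_filt A n (Suc m)"
      by (intro funsp.span_add r)
    have "d = N - Suc m" "1 \<le> Suc m" using Suc.hyps(2) by simp_all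
    from Suc.hyps(1)[OF this y] obtain T where T: "T \<in> tensor_power I (Suc n)"
        "Exp (Suc n) T = ?u + (r + conv x (- x + r))" by blast
    have "conv (?u + x) (Exp (Suc n) (- x)) = conv (?u + x) (?u + (- x + r))"
      by (simp add: r_def)
    also have "\<dots> = ?u + x + (- x + r + conv x (- x + r))"
      by (simp only: conv_add_left[of ?u] conv_add_right[of _ ?u] conv_unit[OF supported_unit]
          conv_unit[OF supp[OF nr]] conv_unit_right[OF supp[OF Suc.prems(2)]] add.assoc)
    also have "\<dots> = Exp (Suc n) T" by (rule ext) (simp add: T(2))
    finally have "Exp (Suc n) (T + x) = conv (conv (?u + x) (Exp (Suc n) (- x))) (Exp (Suc n) x)"
      by (simp add: Exp_add)
    also have "\<dots> = conv (?u + x) ?u"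
      using Exp_uminus[of "Suc n" x] by (simp add: conv_assoc conv_commute[of "Exp (Suc n) (- x)"])
    also have "\<dots> = ?u + x"
      by (simp only: conv_add_left conv_unit[OF supported_unit] conv_unit_right[OF supp[OF Suc.prems(2)]])
    finally show ?case
      using T(1) xI[OF Suc.prems(2)] tensor_power_closed(2) by blast
  qed
qed

lemma Exp_image:
  assumes "n \<ge> 2"
  shows "Exp n ` tensor_power I n = one_plus A n"
proof -
  obtain l where l: "n = Suc l" "l \<ge> 1" using assms by (cases n) auto
  show ?thesis
  proof
    show "Exp n ` tensor_power I n \<subseteq> one_plus A n"
    proof (rule image_subsetI)
      fix x assume x: "x \<in> tensor_power I n"
      then have "x \<in> tensor_filt A l 1" by (simp add: tensor_filt_one l(1))
      from Exp_filt[OF l(2) _ this] have "Exp n x - unit_cochain n - x \<in> tensor_filt A l 1"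
        using tensor_filt_mono[of 1 2 A l] l(1) by (auto simp: numeral_2_eq_2)
      then have "Exp n x - unit_cochain n - x + x \<in> tensor_power I n"
        using x by (intro tensor_power_closed(2)) (simp_all add: tensor_filt_one l(1))
      then show "Exp n x \<in> one_plus A n"
        unfolding one_plus_eq by (intro image_eqI[of _ _ "Exp n x - unit_cochain n"]) simp_all
    qed
    show "one_plus A n \<subseteq> Exp n ` tensor_power I n"
      unfolding one_plus_eq
    proof (rule image_subsetI)
      fix x assume x: "x \<in> tensor_power I n"
      then have "x \<in> tensor_filt A l 1" by (simp add: tensor_filt_one l(1))
      from Exp_surj_filt[OF l(2) order_refl this] obtain T
        where "T \<in> tensor_power I n" "Exp n T = unit_cochain n + x" unfolding l(1) by blast
      then show "unit_cochain n + x \<in> Exp n ` tensor_power I n" by (metis imageI)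
    qed
  qed
qed

end

section \<open>The differentials\<close>

lemma smul_neg_one: "smul (- 1) F = - F"
  by (rule ext) (simp add: smul_def)

lemma lface_if:
  fixes \<phi> :: "('g, 'k::field) cochain"
  shows "lface i (\<lambda>us. if b then \<phi> us else 0) ws = (if b then lface i \<phi> ws else 0)"
proof -
  have "lface i (0 :: ('g, 'k) cochain) ws = 0" by simp
  then show ?thesis by (simp add: zero_fun_def)
qed

text \<open>This is the cosimplicial identity. Two faces raise the degree by two, so the tuple has
  at least two entries.\<close>

lemma lface_lface:
  "i < j \<Longrightarrow> 2 \<le> length ws \<Longrightarrow> j \<le> length ws \<Longrightarrow>
     lface j (lface i \<phi>) ws = lface i (lface (j - 1) \<phi>) ws"
proof (induction i arbitrary: j \<phi> ws)
  case 0
  then obtain w v vs where ws: "ws = w # v # vs" by (cases ws; cases "tl ws") auto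
  show ?case
  proof (cases "j = 1")
    case True
    then show ?thesis by (simp add: ws)
  next
    case False
    then obtain k where "j = Suc (Suc k)" using 0 by (cases j; cases "j - 1") auto
    then show ?thesis by (simp add: ws lface_if)
  qed
next
  case (Suc i)
  from Suc.prems obtain w v vs where ws: "ws = w # v # vs" by (cases ws; cases "tl ws") auto
  obtain k where j: "j = Suc (Suc k)" using Suc.prems by (cases j; cases "j - 1") auto
  show ?case
  proof (cases i)
    case 0
    show ?thesis
    proof (cases k)
      case 0
      then show ?thesis using \<open>i = 0\<close> by (cases vs) (simp_all add: ws j)
    next
      case (Suc l)
      then show ?thesis using \<open>i = 0\<close> by (simp add: ws j)
    qed
  next
    case (Suc i')
    then obtain l where k: "k = Suc l" using Suc.prems j by (cases k) auto
    have "3 \<le> length ws" using Suc.prems(1,3) j k by simp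
    then have "lface (Suc k) (lface i (\<lambda>us. \<phi> (w # us))) (v # vs)
        = lface i (lface k (\<lambda>us. \<phi> (w # us))) (v # vs)"
      using Suc.IH[of "Suc k" "v # vs" "\<lambda>us. \<phi> (w # us)"] Suc.prems j ws by simp
    then show ?thesis by (simp add: ws j k Suc)
  qed
qed

lemma d_add_lface: "length ws = Suc n \<Longrightarrow> d_add n \<phi> ws = (\<Sum>i\<le>Suc n. (- 1) ^ i * lface i \<phi> ws)"
  by (simp add: d_add_def face_eq_lface)

lemma d_add_eq: "d_add n \<phi> = (\<Sum>i\<le>Suc n. smul ((- 1) ^ i) (face i n \<phi>))"
  by (rule ext) (simp add: d_add_def sum_fun_at smul_def del: sum.atMost_Suc)

lemma d_add_linear: "d_add n 0 = 0" "d_add n (F + G) = d_add n F + d_add n G"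
  "d_add n (- F) = - d_add n F"
proof -
  show "d_add n 0 = 0" by (rule ext) (simp add: d_add_def face_linear del: sum.atMost_Suc)
  show "d_add n (F + G) = d_add n F + d_add n G"
    by (rule ext) (simp add: d_add_def face_linear distrib_left sum.distrib del: sum.atMost_Suc)
  have "face i n (- F) ws = - face i n F ws" for i ws
    by (simp add: face_def)
  then show "d_add n (- F) = - d_add n F"
    by (intro ext) (simp add: d_add_def sum_negf del: sum.atMost_Suc)
qed

lemma lface_sum: "lface i (sum f S) = (\<Sum>j\<in>S. lface i (f j))"
  by (induction S rule: infinite_finite_induct)
    (simp_all only: sum.infinite sum.empty sum.insert not_False_eq_True lface_linear)

lemma lface_length_cong:
  "i \<le> length ws \<Longrightarrow> (\<And>us. Suc (length us) = length ws \<Longrightarrow> \<phi> us = \<psi> us) \<Longrightarrow>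
     lface i \<phi> ws = lface i \<psi> ws"
  by (induction i \<phi> ws arbitrary: \<psi> rule: lface.induct) auto

text \<open>The cosimplicial identity pairs the terms with \<open>i < j\<close> with those with
  \<open>j \<le> i\<close>, and paired terms have opposite signs.\<close>

lemma d_add_d_add: "d_add (Suc n) (d_add n \<phi>) = 0"
proof
  fix ws :: "'a list list"
  show "d_add (Suc n) (d_add n \<phi>) ws = 0 ws"
  proof (cases "length ws = Suc (Suc n)")
    case False
    then show ?thesis by (simp add: d_add_def face_def)
  next
    case True
    define f where "f = (\<lambda>(j, i). lface j (lface i \<phi>) ws)"
    define s :: "nat \<times> nat \<Rightarrow> 'b" where "s = (\<lambda>(j, i). (- 1) ^ (j + i) * f (j, i))"
    let ?N = "Suc n"
    let ?L = "{(j, i). i < j \<and> j \<le> Suc ?N}" and ?U = "{(j, i). j \<le> i \<and> i \<le> ?N}"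
    have fin: "finite ?L" "finite ?U"
      by (rule finite_subset[of _ "{..Suc ?N} \<times> {..Suc ?N}"]; auto)+
    have "lface j (d_add n \<phi>) ws = (\<Sum>i\<le>?N. (- 1) ^ i * lface j (lface i \<phi>) ws)" if "j \<le> Suc ?N" for j
    proof -
      have "lface j (d_add n \<phi>) ws = lface j (\<Sum>i\<le>?N. smul ((- 1) ^ i) (lface i \<phi>)) ws"
        using that True
        by (intro lface_length_cong) (simp_all add: d_add_lface sum_fun_at smul_def del: sum.atMost_Suc)
      then show ?thesis
        by (simp only: lface_sum lface_linear sum_fun_at) (simp add: smul_def del: sum.atMost_Suc)
    qed
    then have "d_add (Suc n) (d_add n \<phi>) ws
        = (\<Sum>j\<le>Suc ?N. \<Sum>i\<le>?N. (- 1) ^ j * ((- 1) ^ i * lface j (lface i \<phi>) ws))"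
      using True by (simp add: d_add_lface sum_distrib_left del: sum.atMost_Suc)
    also have "\<dots> = (\<Sum>x\<in>{..Suc ?N} \<times> {..?N}. s x)"
      by (simp add: sum.cartesian_product s_def f_def power_add mult.assoc case_prod_unfold
          del: sum.atMost_Suc)
    also have "{..Suc ?N} \<times> {..?N} = ?L \<union> ?U" by auto
    also have "(\<Sum>x\<in>?L \<union> ?U. s x) = sum s ?L + sum s ?U"
      using fin by (rule sum.union_disjoint) fastforce
    also have "sum s ?L = (\<Sum>x\<in>?U. - s x)"
    \<comment> \<open>The pair (j, i) with i < j corresponds to (i, j - 1), which lowers the
      exponent of the sign by one.\<close>
    proof (rule sum.reindex_bij_witness[of _ "\<lambda>(j, i). (Suc i, j)" "\<lambda>(j, i). (i, j - 1)"])
      fix x assume "x \<in> ?L"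
      then obtain j i where x: "x = (j, i)" "i < j" "j \<le> Suc ?N" by auto
      have "f (j, i) = f (i, j - 1)"
        unfolding f_def using lface_lface[of i j ws \<phi>] x True by simp
      moreover have "(- 1 :: 'b) ^ (j + i) = - ((- 1) ^ (i + (j - 1)))"
        using x(2) by (cases j) (simp_all add: add.commute)
      ultimately show "- s (case x of (j, i) \<Rightarrow> (i, j - 1)) = s x"
        by (simp add: x s_def)
    qed auto
    finally show ?thesis by (simp add: sum_negf)
  qed
qed

text \<open>The two faces adjacent to the empty entry remove it, by merging it with a neighbour or
  by applying the unit at an end. Every other face keeps an empty entry, where \<phi>
  vanishes.\<close>

lemma lface_vanish:
  assumes "\<And>ws. [] \<in> set ws \<Longrightarrow> \<phi> ws = 0" "j \<le> Suc (length us + length vs)"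
  shows "lface j \<phi> (us @ [] # vs) = (if j = length us \<or> j = Suc (length us) then \<phi> (us @ vs) else 0)"
  using assms
proof (induction us arbitrary: j \<phi>)
  case Nil
  show ?case
  proof (cases j)
    case (Suc k)
    show ?thesis
    proof (cases k)
      case 0
      then show ?thesis using Suc by (cases vs) auto
    next
      case (Suc l)
      have "(\<lambda>us. \<phi> ([] # us)) = 0" by (rule ext) (simp add: Nil.prems)
      then have "lface (Suc l) (\<lambda>us. \<phi> ([] # us)) vs = 0" by (metis lface_linear(1) zero_fun_apply)
      then show ?thesis using Suc \<open>j = Suc k\<close> by simp
    qed
  qed simp
next
  case (Cons w us)
  show ?case
  proof (cases j)
    case 0
    then show ?thesis using Cons.prems(1) by simp
  next
    case (Suc k)
    show ?thesis
    proof (cases k)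
      case 0
      then show ?thesis using Suc Cons.prems(1) by (cases us) auto
    next
      case (Suc l)
      then show ?thesis
        using Cons.IH[of "\<lambda>us. \<phi> (w # us)" k] Cons.prems \<open>j = Suc k\<close> by auto
    qed
  qed
qed

text \<open>Only two consecutive faces survive, with equal values and opposite signs; hence the
  normalised cochains form a subcomplex.\<close>

lemma d_add_vanish:
  assumes "\<And>ws. [] \<in> set ws \<Longrightarrow> \<phi> ws = 0" "[] \<in> set ws"
  shows "d_add n \<phi> ws = 0"
proof (cases "length ws = Suc n")
  case True
  obtain us vs where ws: "ws = us @ [] # vs" using assms(2) by (meson split_list)
  have "d_add n \<phi> ws = (\<Sum>i\<le>Suc n. (- 1) ^ i * lface i \<phi> ws)" by (rule d_add_lface[OF True])
  also have "\<dots> = (\<Sum>i\<le>Suc n. if i = length us \<or> i = Suc (length us) then (- 1) ^ i * \<phi> (us @ vs) else 0)"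
    using lface_vanish[where us = us and vs = vs, OF assms(1)] True by (intro sum.cong) (auto simp: ws)
  also have "\<dots> = (\<Sum>i\<in>{length us, Suc (length us)}. (- 1) ^ i * \<phi> (us @ vs))"
    using True by (intro sum.mono_neutral_cong_right) (auto simp: ws)
  finally show ?thesis by simp
qed (simp add: d_add_def face_def)

lemma tcons_tensor_power:
  assumes "a \<in> V" "T \<in> tensor_power V n"
  shows "tcons a T \<in> tensor_power V (Suc n)"
  using assms(2) unfolding tensor_power_eq[of V n]
proof (induction rule: funsp.span_induct_alt)
  case base
  have "tcons a 0 = 0" by (rule ext) (simp add: tcons_def split: list.split)
  then show ?case using tensor_power_closed(1) by metis
next
  case (step c s y)
  then obtain as where as: "s = pure_tensor as" "length as = n" "set as \<subseteq> V" by blast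
  have "tcons a s \<in> tensor_power V (Suc n)"
    unfolding as(1) pure_tensor_Cons[symmetric] by (rule pure_tensor_in) (use as assms(1) in auto)
  moreover have "tcons a (smul c s + y) = smul c (tcons a s) + tcons a y"
    by (rule ext) (simp add: tcons_def smul_def algebra_simps split: list.split)
  ultimately show ?case using step(2) tensor_power_closed(2,5) by metis
qed

lemma lface_tcons:
  "lface 0 T = tcons (\<lambda>w. if w = [] then 1 else 0) T"
  "lface (Suc (Suc i)) (tcons a T) = tcons a (lface (Suc i) T)"
proof -
  show "lface 0 T = tcons (\<lambda>w. if w = [] then 1 else 0) T"
  proof
    fix ws show "lface 0 T ws = tcons (\<lambda>w. if w = [] then 1 else 0) T ws" by (cases ws) auto
  qed
  show "lface (Suc (Suc i)) (tcons a T) = tcons a (lface (Suc i) T)"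
  proof
    fix ws show "lface (Suc (Suc i)) (tcons a T) ws = tcons a (lface (Suc i) T) ws"
    proof (cases ws)
      case (Cons w ws')
      then show ?thesis
        using fun_cong[OF lface_linear(3)[of "Suc i" "a w" T], of ws'] by (simp add: smul_def)
    qed simp
  qed
qed

section \<open>Cochains over the coordinate ring and their face maps\<close>

lemma cochain_ring_simps [simp]:
  "carrier (cochain_ring A n) = tensor_power A n" "monoid.mult (cochain_ring A n) = conv"
  "monoid.one (cochain_ring A n) = unit_cochain n" "ring.zero (cochain_ring A n) = 0"
  "ring.add (cochain_ring A n) = (+)"
  by (simp_all add: cochain_ring_def fun_eq_iff)

lemma counit_unit:
  assumes "i < n"
  shows "counit_at i (unit_cochain n) = unit_cochain (n - 1)"
proof
  fix ws :: "'g list list"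
  have "set (take i ws) \<union> set (drop i ws) = set ws"
    by (metis append_take_drop_id set_append)
  then have "set (take i ws @ [[]] @ drop i ws) \<subseteq> {[]} \<longleftrightarrow> set ws \<subseteq> {[]}"
    by auto
  then show "counit_at i (unit_cochain n) ws = (unit_cochain (n - 1) ws :: 'k::field)"
    using assms by (auto simp: counit_at_def unit_cochain_eq all_one_def)
qed

context coord_algebra
begin

text \<open>An index \<ge> 2 passes over the first factor, so by induction only two cases carry
  content: inserting the unit, and comultiplying the first factor.\<close>

lemma lface_pure:
  "set as \<subseteq> A \<Longrightarrow> i \<le> Suc (length as) \<Longrightarrow> lface i (pure_tensor as) \<in> tensor_power A (Suc (length as))"
proof (induction as arbitrary: i)
  case Nil
  show ?case
  proof (cases i)
    case 0
    then show ?thesis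
      unfolding 0 lface_tcons(1) by (intro tcons_tensor_power A_one pure_tensor_in) simp_all
  next
    case (Suc k)
    have "lface (Suc 0) (pure_tensor []) ws = unit_cochain 1 ws" for ws :: "'g list list"
      by (cases "(Suc 0, pure_tensor [] :: ('g, 'k) cochain, ws)" rule: lface.cases)
        (auto simp: pure_tensor_Nil unit_cochain_def)
    then have "lface (Suc 0) (pure_tensor []) = (unit_cochain 1 :: ('g, 'k) cochain)" by (rule ext)
    then show ?thesis using tensor_power_unit[of 1] Suc Nil by simp
  qed
next
  case (Cons a as)
  consider "i = 0" | "i = 1" | j where "i = Suc (Suc j)" by (cases i; cases "i - 1") auto
  then show ?case
  proof cases
    case 1
    then show ?thesis
      unfolding 1 lface_tcons(1) by (intro tcons_tensor_power A_one pure_tensor_in) (use Cons in auto)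
  next
    case 2
    \<comment> \<open>Here the finite expansion of \<Delta>(a) turns a function of the concatenated
      word into a sum of decomposable tensors.\<close>
    obtain W e where W: "finite W" "\<And>w. w \<in> W \<Longrightarrow> e w \<in> A"
      "\<And>a u v. a \<in> A \<Longrightarrow> a (u @ v) = (\<Sum>w\<in>W. a (u @ w) * e w v)"
      using A_comult by blast
    have a: "a \<in> A" using Cons.prems by simp
    have "lface (Suc 0) (pure_tensor (a # as)) ws
        = (\<Sum>w\<in>W. pure_tensor ((\<lambda>u. a (u @ w)) # e w # as)) ws" for ws :: "'g list list"
    proof -
      consider "ws = []" | w where "ws = [w]" | u v vs where "ws = u # v # vs"
        by (cases ws; cases "tl ws") auto
      then show ?thesis
      proof cases
        case 3
        have "a (u @ v) * pure_tensor as vs = (\<Sum>w\<in>W. a (u @ w) * (e w v * pure_tensor as vs))"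
          by (subst W(3)[OF a, of u v]) (simp add: sum_distrib_right mult.assoc)
        then show ?thesis by (simp add: 3 pure_tensor_Cons sum_fun_at)
      qed (simp_all add: pure_tensor_Cons sum_fun_at)
    qed
    then have "lface i (pure_tensor (a # as)) = (\<Sum>w\<in>W. pure_tensor ((\<lambda>u. a (u @ w)) # e w # as))"
      unfolding 2 One_nat_def by (rule ext)
    also have "\<dots> \<in> tensor_power A (Suc (length (a # as)))"
      unfolding tensor_power_eq
      by (intro funsp.span_sum funsp.span_base)
        (use Cons.prems A_translate[OF a] W(2) in \<open>auto intro!: exI[of _ "_ # _ # as"]\<close>)
    finally show ?thesis .
  next
    case 3
    then show ?thesis
      using Cons by (auto simp: pure_tensor_Cons lface_tcons intro!: tcons_tensor_power)
  qed
qed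

lemma face_tensor_power:
  assumes "i \<le> Suc n" "x \<in> tensor_power A n"
  shows "face i n x \<in> tensor_power A (Suc n)"
  using assms(2) unfolding tensor_power_eq[of A n]
proof (induction rule: funsp.span_induct_alt)
  case base
  then show ?case using tensor_power_closed(1) by (simp only: face_linear)
next
  case (step c s y)
  then obtain as where as: "s = pure_tensor as" "length as = n" "set as \<subseteq> A" by blast
  have l: "lface i s \<in> tensor_power A (Suc n)"
    using lface_pure[of as i] as assms(1) by simp
  have "face i n s ws = lface i s ws" for ws
    using face_supported[of n i s] supported_tensor_power[OF l] assms(1)
    by (cases "length ws = Suc n") (simp_all add: face_eq_lface supported_def)
  then have "face i n s = lface i s" by (rule ext)
  with l step(2) show ?case
    unfolding face_linear by (metis tensor_power_closed(2,5))
qed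

lemma d_add_closed:
  assumes "x \<in> tensor_power I n"
  shows "d_add n x \<in> tensor_power I (Suc n)"
proof -
  have "x \<in> tensor_power A n" using assms tensor_power_I_subset by blast
  then have "d_add n x \<in> tensor_power A (Suc n)"
    unfolding d_add_eq
    by (subst tensor_power_eq, intro funsp.span_sum funsp.span_scale, fold tensor_power_eq)
      (auto intro: face_tensor_power)
  moreover have "kill_empty (d_add n x) = d_add n x"
  proof
    fix ws show "kill_empty (d_add n x) ws = d_add n x ws"
      using d_add_vanish[of x ws n] tensor_power_I_vanish[OF assms] by (simp add: kill_empty_def)
  qed
  ultimately show ?thesis using kill_empty_tensor_power by metis
qed

lemma cochain_comm_monoid: "comm_monoid (cochain_ring A n)"
  by (rule comm_monoidI)
    (auto simp: tensor_power_unit conv_assoc conv_unit supported_tensor_power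
      intro: tensor_power_conv[OF A_sconv] conv_commute)

lemma cochain_inv:
  assumes "x \<in> tensor_power A n" "y \<in> tensor_power A n" "conv x y = unit_cochain n"
  shows "x \<in> Units (cochain_ring A n)" "inv\<^bsub>cochain_ring A n\<^esub> x = y"
proof -
  show "x \<in> Units (cochain_ring A n)"
    using assms conv_commute[of x y] by (auto simp: Units_def)
  show "inv\<^bsub>cochain_ring A n\<^esub> x = y"
    by (rule comm_monoid.comm_inv_char[OF cochain_comm_monoid]) (use assms in auto)
qed

lemma Exp_inj:
  assumes "n \<ge> 1"
  shows "inj_on (Exp n) (tensor_power I n)"
proof (rule inj_onI)
  fix x y assume xy: "x \<in> tensor_power I n" "y \<in> tensor_power I n" "Exp n x = Exp n y"
  have d: "x - y \<in> tensor_power I n" using xy by (intro tensor_power_closed)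
  have "Exp n (x + - y) = conv (Exp n y) (Exp n (- y))" by (simp only: Exp_add xy(3))
  then have "Exp n (x - y) = unit_cochain n" by (simp add: Exp_uminus)
  moreover have "(x - y) (replicate n []) = 0"
    by (rule tensor_power_I_vanish[OF d]) (use assms in simp)
  ultimately have "x - y = 0"
    using Exp_eq_unit_imp_zero[of n "x - y"] supported_tensor_power[OF d] by blast
  then show "x = y" by simp
qed

lemma one_plus_subset: "one_plus A n \<subseteq> tensor_power A n"
  unfolding one_plus_eq
  using tensor_power_unit tensor_power_I_subset tensor_power_closed(2) by blast

lemma Exp_closed: "n \<ge> 2 \<Longrightarrow> x \<in> tensor_power I n \<Longrightarrow> Exp n x \<in> one_plus A n"
  using Exp_image by blast

lemma Exp_unit:
  assumes "n \<ge> 2" "x \<in> tensor_power I n"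
  shows "Exp n x \<in> Units (cochain_ring A n)"
proof (rule cochain_inv(1)[of _ _ "Exp n (- x)"])
  have "- x \<in> tensor_power I n" using assms(2) by (rule tensor_power_closed)
  then show "Exp n x \<in> tensor_power A n" "Exp n (- x) \<in> tensor_power A n"
    using assms Exp_closed one_plus_subset by blast+
qed (rule Exp_uminus)

section \<open>Identification of the map E and of the multiplicative cochains\<close>

lemma alg_group_hom_Exp:
  assumes "n \<ge> 2"
  shows "alg_group_hom_E A n (restrict (Exp n) (tensor_power I n))"
  unfolding alg_group_hom_E_def
proof (intro conjI allI impI)
  show "restrict (Exp n) (tensor_power I n)
      \<in> hom (add_monoid (cochain_ring A n)\<lparr>carrier := tensor_power I n\<rparr>)
          (units_of (cochain_ring A n)\<lparr>carrier := one_plus A n\<rparr>)"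
    using assms
    by (auto simp: hom_def units_of_def Exp_add tensor_power_closed(2) intro: Exp_closed)
  fix ws :: "'g list list"
  show "\<exists>q\<in>poly_fun. \<forall>T\<in>tensor_power I n. restrict (Exp n) (tensor_power I n) T ws = q T"
  proof (cases "length ws = n")
    case True
    then show ?thesis by (intro bexI[OF _ EE_poly_fun[of ws]]) (simp add: Exp_def)
  next
    case False
    then show ?thesis
      by (intro bexI[of _ "\<lambda>_. 0"]) (auto simp: Exp_def intro: poly_fun.intros)
  qed
next
  fix as :: "('g list \<Rightarrow> 'k) list" assume as: "length as = n \<and> set as \<subseteq> I"
  then show "restrict (Exp n) (tensor_power I n) (pure_tensor as)
      = (\<lambda>ws. \<Sum>j<CHAR('k). (pure_tensor as [^]\<^bsub>cochain_ring A n\<^esub> j) ws / of_nat (fact j))"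
    using Exp_pure_tensor[OF assms, of as] pure_tensor_in[of as n I]
    by (simp add: nat_pow_cochain_ring sum_fun_at smul_def fun_eq_iff)
qed

lemma pure_gens_smul:
  assumes "n \<ge> 1"
  shows "\<forall>s\<in>{pure_tensor as | as. length as = n \<and> set as \<subseteq> I}. \<forall>c.
      smul c s \<in> {pure_tensor as | as. length as = n \<and> set as \<subseteq> I}"
proof (intro ballI allI)
  fix s c assume "s \<in> {pure_tensor as | as. length as = n \<and> set as \<subseteq> I}"
  then obtain as where as: "s = pure_tensor as" "length as = n" "set as \<subseteq> I" by blast
  then obtain a bs where "as = a # bs" using assms by (cases as) auto
  then have "smul c s = pure_tensor (smul c a # bs)" "length (smul c a # bs) = n"
    "set (smul c a # bs) \<subseteq> I"
    using as I_smul by (auto simp: smul_pure_tensor)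
  then show "smul c s \<in> {pure_tensor as | as. length as = n \<and> set as \<subseteq> I}" by blast
qed

text \<open>Scalars can be absorbed into a factor, so decomposable tensors generate the additive group.\<close>

lemma alg_group_hom_unique:
  assumes n: "n \<ge> 1" and e: "alg_group_hom_E A n e" and f: "alg_group_hom_E A n f"
    and x: "x \<in> tensor_power I n"
  shows "e x = f x"
proof -
  have add: "h (x + y) = conv (h x) (h y)"
    if "alg_group_hom_E A n h" "x \<in> tensor_power I n" "y \<in> tensor_power I n" for h x y
    using that by (auto simp: alg_group_hom_E_def hom_def units_of_def)
  have pure: "e (pure_tensor as) = f (pure_tensor as)" if "length as = n" "set as \<subseteq> I" for as
    using that e f by (simp add: alg_group_hom_E_def)
  show ?thesis
    using x[unfolded tensor_power_eq] pure_gens_smul[OF n]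
  proof (induction rule: span_smul_induct)
    case zero
    obtain m where m: "n = Suc m" using n by (cases n) auto
    have "(0 :: ('g, 'k) cochain) = pure_tensor (replicate n 0)"
      by (rule ext) (simp add: m pure_tensor_Cons tcons_def split: list.split)
    moreover have "e (pure_tensor (replicate n 0)) = f (pure_tensor (replicate n 0))"
      by (rule pure) (use I_zero in auto)
    ultimately show ?case by metis
  next
    case (add s y)
    then obtain as where as: "s = pure_tensor as" "length as = n" "set as \<subseteq> I" by blast
    have "s \<in> tensor_power I n" "y \<in> tensor_power I n"
      using as add(2) by (auto simp: tensor_power_eq[symmetric])
    then show ?case
      using \<open>\<And>x y h. alg_group_hom_E A n h \<Longrightarrow> x \<in> tensor_power I n \<Longrightarrow> y \<in> tensor_power I n
          \<Longrightarrow> h (x + y) = conv (h x) (h y)\<close>[of _ s y] e f pure[OF as(2,3)] add(3) as(1) by metis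
  qed
qed

text \<open>The homomorphism conditions fix values on I^{\<otimes>n} only; extensionality fixes the
  rest, so that the definite description denotes.\<close>

lemma E_map_eq:
  assumes "n \<ge> 2"
  shows "E_map A n = restrict (Exp n) (tensor_power I n)"
  unfolding E_map_def
proof (rule the_equality)
  show "restrict (Exp n) (tensor_power I n) \<in> extensional (tensor_power I n)
      \<and> alg_group_hom_E A n (restrict (Exp n) (tensor_power I n))"
    using alg_group_hom_Exp[OF assms] by simp
  fix e assume e: "e \<in> extensional (tensor_power I n) \<and> alg_group_hom_E A n e"
  then show "e = restrict (Exp n) (tensor_power I n)"
    using alg_group_hom_unique[OF _ _ alg_group_hom_Exp[OF assms], of e] assms
    by (intro extensionalityI[of _ "tensor_power I n"]) auto
qed

lemma C_mult_subset: "C_mult A n \<subseteq> one_plus A n"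
proof
  fix x assume x: "x \<in> C_mult A n"
  have "counit_at i (x - unit_cochain n) = (\<lambda>_. 0)" if "i < n" for i
  proof -
    have "counit_at i x = counit_at i (unit_cochain n)"
      using x that by (simp add: C_mult_def counit_unit)
    then show ?thesis by (simp add: counit_at_def fun_eq_iff)
  qed
  moreover have "x - unit_cochain n \<in> tensor_power A n"
    using x by (intro tensor_power_closed tensor_power_unit) (auto simp: C_mult_def Units_def)
  ultimately have "x - unit_cochain n \<in> tensor_power I n"
    unfolding C_add_eq[symmetric] C_add_def by simp
  then show "x \<in> one_plus A n"
    unfolding one_plus_eq by (intro image_eqI[of _ _ "x - unit_cochain n"]) simp_all
qed

text \<open>Every element of 1 + I^{\<otimes>n} is some Exp(y) and therefore has the inverse
  Exp(-y).\<close>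

lemma C_mult_eq:
  assumes "n \<ge> 2"
  shows "C_mult A n = one_plus A n"
proof
  show "one_plus A n \<subseteq> C_mult A n"
  proof
    fix x assume x: "x \<in> one_plus A n"
    then obtain y where "y \<in> tensor_power I n" "x = Exp n y"
      unfolding Exp_image[OF assms, symmetric] by blast
    then have "x \<in> Units (cochain_ring A n)" using Exp_unit[OF assms] by simp
    moreover obtain \<phi> where \<phi>: "\<phi> \<in> C_add A n" "x = unit_cochain n + \<phi>"
      using x unfolding one_plus_eq C_add_eq by blast
    moreover have "counit_at i x = unit_cochain (n - 1)" if "i < n" for i
    proof -
      have "counit_at i x = counit_at i (unit_cochain n)"
        using \<phi> that by (auto simp: C_add_def counit_at_def fun_eq_iff)
      then show ?thesis using that by (simp add: counit_unit)
    qed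
    ultimately show "x \<in> C_mult A n" by (simp add: C_mult_def)
  qed
qed (rule C_mult_subset)

text \<open>Faces commute with the exponential and an exponent -1 becomes a sign inside it, so the
  alternating product is the exponential of the alternating sum.\<close>

lemma d_mult_Exp:
  assumes n: "n \<ge> 2" and x: "x \<in> tensor_power I n"
  shows "d_mult A n (Exp n x) = Exp (Suc n) (d_add n x)"
proof -
  let ?R = "cochain_ring A (Suc n)"
  interpret comm_monoid ?R by (rule cochain_comm_monoid)
  have nx: "- x \<in> tensor_power I n" using x by (rule tensor_power_closed)
  have fx: "face i n (- x) = - face i n x" for i
    by (rule ext) (simp add: face_def)
  \<comment> \<open>This is applied both to x and to -x, the latter because the odd faces enter
    through their inverses.\<close>
  have mem: "Exp (Suc n) (face i n z) \<in> tensor_power A (Suc n)"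
    if "i \<le> Suc n" "z \<in> tensor_power I n" for i z
    using that face_tensor_power[of i n "Exp n z"] Exp_closed[OF n] one_plus_subset
    by (auto simp: face_Exp)
  have pow: "face i n (Exp n x) [^]\<^bsub>?R\<^esub> ((- 1) ^ i :: int) = Exp (Suc n) (smul ((- 1) ^ i) (face i n x))"
    if i: "i \<le> Suc n" for i
  proof (cases "even i")
    case True
    then show ?thesis using i mem[OF i x] by (simp add: face_Exp int_pow_def2 conv_unit)
  next
    case False
    have "inv\<^bsub>?R\<^esub> Exp (Suc n) (face i n x) = Exp (Suc n) (face i n (- x))"
      by (rule cochain_inv(2)) (use mem[OF i x] mem[OF i nx] in \<open>auto simp: fx Exp_uminus\<close>)
    then show ?thesis
      using False i mem[OF i x]
      by (simp add: face_Exp int_pow_def2 conv_unit fx smul_neg_one)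
  qed
  have mem': "Exp (Suc n) (smul ((- 1) ^ i) (face i n x)) \<in> tensor_power A (Suc n)" if "i \<le> Suc n" for i
  proof (cases "even i")
    case True
    then show ?thesis using mem[OF that x] by simp
  next
    case False
    then show ?thesis using mem[OF that nx] by (simp add: fx smul_neg_one)
  qed
  have "finprod ?R (\<lambda>i. face i n (Exp n x) [^]\<^bsub>?R\<^esub> ((- 1) ^ i :: int)) {..<m}
      = Exp (Suc n) (\<Sum>i<m. smul ((- 1) ^ i) (face i n x))" if "m \<le> Suc (Suc n)" for m
    using that
  proof (induction m)
    case 0
    then show ?case by (simp only: lessThan_0 finprod_empty sum.empty Exp_zero cochain_ring_simps)
  next
    case (Suc m)
    have "finprod ?R (\<lambda>i. face i n (Exp n x) [^]\<^bsub>?R\<^esub> ((- 1) ^ i :: int)) (insert m {..<m})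
        = face m n (Exp n x) [^]\<^bsub>?R\<^esub> ((- 1) ^ m :: int) \<otimes>\<^bsub>?R\<^esub>
          finprod ?R (\<lambda>i. face i n (Exp n x) [^]\<^bsub>?R\<^esub> ((- 1) ^ i :: int)) {..<m}"
      using Suc.prems by (intro finprod_insert) (auto simp: pow mem')
    also have "\<dots> = conv (Exp (Suc n) (smul ((- 1) ^ m) (face m n x)))
        (Exp (Suc n) (\<Sum>i<m. smul ((- 1) ^ i) (face i n x)))"
      using Suc by (simp add: pow)
    also have "\<dots> = Exp (Suc n) (\<Sum>i<Suc m. smul ((- 1) ^ i) (face i n x))"
      by (simp only: Exp_add[symmetric] sum.lessThan_Suc add.commute)
    finally show ?case by (simp only: lessThan_Suc)
  qed
  from this[OF order_refl] show ?thesis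
    unfolding d_mult_def d_add_eq lessThan_Suc_atMost .
qed

end

section \<open>Cocycles and cohomology in higher degrees\<close>

lemma iso_left_inverse:
  assumes "group G" "h \<in> iso G H" "\<And>x. x \<in> carrier G \<Longrightarrow> g (h x) = x"
  shows "g \<in> iso H G"
proof -
  interpret group G by fact
  have bij: "bij_betw h (carrier G) (carrier H)" and hom: "h \<in> hom G H"
    using assms(2) by (auto simp: iso_def)
  have im: "h ` carrier G = carrier H" using bij by (simp add: bij_betw_def)
  have "g y \<in> carrier G" if "y \<in> carrier H" for y
    using that assms(3) unfolding im[symmetric] by auto
  moreover have "g (y \<otimes>\<^bsub>H\<^esub> z) = g y \<otimes>\<^bsub>G\<^esub> g z" if y: "y \<in> carrier H" and z: "z \<in> carrier H" for y z
  proof -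
    obtain a b where ab: "a \<in> carrier G" "b \<in> carrier G" "y = h a" "z = h b"
      using y z unfolding im[symmetric] by blast
    have "y \<otimes>\<^bsub>H\<^esub> z = h (a \<otimes>\<^bsub>G\<^esub> b)" using hom_mult[OF hom] ab by simp
    then show ?thesis using ab assms(3) by simp
  qed
  ultimately have "g \<in> hom H G" by (auto simp: hom_def)
  moreover have "bij_betw g (carrier H) (carrier G)"
    by (rule bij_betw_byWitness[of _ h]) (use assms(3) in \<open>auto simp: im[symmetric]\<close>)
  ultimately show ?thesis by (simp add: iso_def)
qed

lemma image_r_coset:
  assumes "h \<in> hom G H" "B \<subseteq> carrier G" "x \<in> carrier G"
  shows "h ` (B #>\<^bsub>G\<^esub> x) = (h ` B) #>\<^bsub>H\<^esub> h x"
proof -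
  have "h (b \<otimes>\<^bsub>G\<^esub> x) = h b \<otimes>\<^bsub>H\<^esub> h x" if "b \<in> B" for b
    using assms that by (intro hom_mult[OF assms(1)]) auto
  then show ?thesis unfolding r_coset_def image_UN by simp
qed

text \<open>The structure \<open>H\<close> is not assumed to be a group: its group laws are
  transported along \<open>h\<close>. In degrees n \<ge> 2 this avoids checking directly that
  multiplicative cocycles form a group. The unit of \<open>H\<close> has to be matched explicitly,
  since a priori it is only a record field.\<close>

lemma iso_imp_comm_group:
  assumes "comm_group G" "h \<in> iso G H" "h \<one>\<^bsub>G\<^esub> = \<one>\<^bsub>H\<^esub>"
  shows "comm_group H"
proof -
  interpret comm_group G by fact
  have hom: "h \<in> hom G H" and im: "h ` carrier G = carrier H"
    using assms(2) by (auto simp: iso_def bij_betw_def)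
  show ?thesis
  proof (rule comm_groupI)
    show "\<one>\<^bsub>H\<^esub> \<in> carrier H" using assms(3) im by (metis imageI one_closed)
  next
    fix x y assume "x \<in> carrier H" "y \<in> carrier H"
    then obtain a b where *: "x = h a" "y = h b" "a \<in> carrier G" "b \<in> carrier G"
      unfolding im[symmetric] by blast
    then have "x \<otimes>\<^bsub>H\<^esub> y = h (a \<otimes>\<^bsub>G\<^esub> b)" "y \<otimes>\<^bsub>H\<^esub> x = h (b \<otimes>\<^bsub>G\<^esub> a)" using hom_mult[OF hom] by simp_all
    then show "x \<otimes>\<^bsub>H\<^esub> y \<in> carrier H" "x \<otimes>\<^bsub>H\<^esub> y = y \<otimes>\<^bsub>H\<^esub> x"
      using * im m_comm by auto
  next
    fix x y z assume "x \<in> carrier H" "y \<in> carrier H" "z \<in> carrier H"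
    then obtain a b c where "x = h a" "y = h b" "z = h c" "a \<in> carrier G" "b \<in> carrier G" "c \<in> carrier G"
      unfolding im[symmetric] by blast
    then show "x \<otimes>\<^bsub>H\<^esub> y \<otimes>\<^bsub>H\<^esub> z = x \<otimes>\<^bsub>H\<^esub> (y \<otimes>\<^bsub>H\<^esub> z)"
      using m_assoc by (simp flip: hom_mult[OF hom])
  next
    fix x assume "x \<in> carrier H"
    then obtain a where a: "x = h a" "a \<in> carrier G" unfolding im[symmetric] by blast
    then show "\<one>\<^bsub>H\<^esub> \<otimes>\<^bsub>H\<^esub> x = x"
      using hom_mult[OF hom, of "\<one>\<^bsub>G\<^esub>" a] assms(3) by simp
    have "h (inv\<^bsub>G\<^esub> a) \<otimes>\<^bsub>H\<^esub> x = \<one>\<^bsub>H\<^esub>"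
      using a hom_mult[OF hom, of "inv\<^bsub>G\<^esub> a" a] assms(3) by simp
    then show "\<exists>y\<in>carrier H. y \<otimes>\<^bsub>H\<^esub> x = \<one>\<^bsub>H\<^esub>"
      using a im by (metis imageI inv_closed)
  qed
qed

lemma image_iso_quotient:
  assumes "comm_group G" "comm_group H" "h \<in> iso G H" "subgroup B G"
  shows "subgroup (h ` B) H" "(\<lambda>S. h ` S) \<in> iso (G Mod B) (H Mod (h ` B))"
proof -
  interpret G: comm_group G by fact
  interpret H: comm_group H by fact
  have hom: "h \<in> hom G H" and inj: "inj_on h (carrier G)" and im: "h ` carrier G = carrier H"
    using assms(3) by (auto simp: iso_def bij_betw_def)
  interpret gh: group_hom G H h by unfold_locales (fact hom)
  show "subgroup (h ` B) H" using assms(4) by (rule gh.subgroup_img_is_subgroup)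
  interpret B: normal B G using assms(4) by (rule G.subgroup_imp_normal)
  have sub: "S \<subseteq> carrier G" if "S \<in> carrier (G Mod B)" for S
    using that G.r_coset_subset_G[OF B.subset] by (auto simp: carrier_FactGroup)
  have coset: "h ` (B #>\<^bsub>G\<^esub> x) = (h ` B) #>\<^bsub>H\<^esub> h x" if "x \<in> carrier G" for x
    by (rule image_r_coset[OF hom B.subset that])
  have "h ` (S <#>\<^bsub>G\<^esub> T) = h ` S <#>\<^bsub>H\<^esub> h ` T" if "S \<subseteq> carrier G" "T \<subseteq> carrier G" for S T
  proof -
    have "h (x \<otimes>\<^bsub>G\<^esub> y) = h x \<otimes>\<^bsub>H\<^esub> h y" if "x \<in> S" "y \<in> T" for x y
      using that \<open>S \<subseteq> carrier G\<close> \<open>T \<subseteq> carrier G\<close> by (auto intro: hom_mult[OF hom])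
    then show ?thesis unfolding set_mult_def by force
  qed
  then have "(\<lambda>S. h ` S) \<in> hom (G Mod B) (H Mod (h ` B))"
    using sub im by (auto simp: hom_def carrier_FactGroup coset)
  moreover have "bij_betw (\<lambda>S. h ` S) (carrier (G Mod B)) (carrier (H Mod (h ` B)))"
    unfolding bij_betw_def
  proof
    show "inj_on (\<lambda>S. h ` S) (carrier (G Mod B))"
      using sub inj by (intro inj_onI) (metis inj_on_image_eq_iff)
    show "(\<lambda>S. h ` S) ` carrier (G Mod B) = carrier (H Mod (h ` B))"
      unfolding carrier_FactGroup image_image im[symmetric] using coset by (intro image_cong) auto
  qed
  ultimately show "(\<lambda>S. h ` S) \<in> iso (G Mod B) (H Mod (h ` B))" by (simp add: iso_def)
qed

lemma Z_mult_simps [simp]: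
  "carrier (Z_mult A n) = {\<Phi> \<in> C_mult A n. d_mult A n \<Phi> = unit_cochain (Suc n)}"
  "monoid.mult (Z_mult A n) = conv" "monoid.one (Z_mult A n) = unit_cochain n"
  by (simp_all add: Z_mult_def units_of_def)

context coord_algebra
begin

lemma Z_add_simps [simp]:
  "carrier (Z_add A n) = {\<phi> \<in> tensor_power I n. d_add n \<phi> = 0}"
  "monoid.mult (Z_add A n) = (+)" "monoid.one (Z_add A n) = 0"
  by (simp_all add: Z_add_def C_add_eq zero_fun_def)

lemma Z_add_group: "comm_group (Z_add A n)"
proof (rule comm_groupI)
  fix x assume x: "x \<in> carrier (Z_add A n)"
  then have "- x \<in> carrier (Z_add A n)"
    by (simp add: tensor_power_closed d_add_linear)
  moreover have "- x + x = 0" by simp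
  ultimately show "\<exists>y\<in>carrier (Z_add A n). y \<otimes>\<^bsub>Z_add A n\<^esub> x = \<one>\<^bsub>Z_add A n\<^esub>"
    by (metis Z_add_simps(2,3))
qed (simp_all add: tensor_power_closed d_add_linear ac_simps)

text \<open>The multiplicative coboundary of Exp(x) is Exp(dx), which equals 1 = Exp(0) exactly when
  dx = 0, by injectivity in degree n + 1.\<close>

lemma Z_mult_carrier:
  assumes "n \<ge> 2"
  shows "carrier (Z_mult A n) = Exp n ` carrier (Z_add A n)"
proof -
  have "d_mult A n (Exp n x) = unit_cochain (Suc n) \<longleftrightarrow> d_add n x = 0" if x: "x \<in> tensor_power I n" for x
  proof -
    have "Exp (Suc n) (d_add n x) = Exp (Suc n) 0 \<longleftrightarrow> d_add n x = 0"
      using inj_on_eq_iff[OF Exp_inj[of "Suc n"] d_add_closed[OF x] tensor_power_closed(1)] by simp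
    then show ?thesis by (simp only: d_mult_Exp[OF assms x] Exp_zero)
  qed
  then show ?thesis
    unfolding Z_mult_simps Z_add_simps C_mult_eq[OF assms] Exp_image[OF assms, symmetric] by blast
qed

lemma Exp_iso:
  assumes "n \<ge> 2"
  shows "Exp n \<in> iso (Z_add A n) (Z_mult A n)"
proof -
  have "inj_on (Exp n) (carrier (Z_add A n))"
    using Exp_inj[of n] assms by (auto intro: inj_on_subset)
  then show ?thesis
    unfolding iso_def hom_def bij_betw_def Z_mult_carrier[OF assms] by (auto simp: Exp_add)
qed

lemma E_map_Exp: "n \<ge> 2 \<Longrightarrow> x \<in> tensor_power I n \<Longrightarrow> E_map A n x = Exp n x"
  by (simp add: E_map_eq)

lemma E_iso:
  assumes "n \<ge> 2"
  shows "E_map A n \<in> iso (Z_add A n) (Z_mult A n)"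
proof -
  interpret comm_group "Z_add A n" by (rule Z_add_group)
  show ?thesis
    by (rule iso_eq[OF Exp_iso[OF assms]]) (simp add: E_map_Exp[OF assms])
qed

lemma L_E: "n \<ge> 2 \<Longrightarrow> x \<in> tensor_power I n \<Longrightarrow> L_map A n (E_map A n x) = x"
  unfolding L_map_def using Exp_inj[of n] by (intro inv_into_f_f) (auto simp: E_map_eq inj_on_def)

lemma E_L:
  assumes "n \<ge> 2" "y \<in> carrier (Z_mult A n)"
  shows "E_map A n (L_map A n y) = y"
proof -
  obtain x where "x \<in> tensor_power I n" "y = Exp n x"
    using assms(2) unfolding Z_mult_carrier[OF assms(1)] by auto
  then show ?thesis using L_E[OF assms(1)] by (simp add: E_map_Exp[OF assms(1)])
qed

lemma Z_mult_group: "n \<ge> 2 \<Longrightarrow> comm_group (Z_mult A n)"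
  by (rule iso_imp_comm_group[OF Z_add_group Exp_iso]) (simp_all add: Exp_zero)

lemma L_iso: "n \<ge> 2 \<Longrightarrow> L_map A n \<in> iso (Z_mult A n) (Z_add A n)"
  by (rule iso_left_inverse[OF comm_group.axioms(2)[OF Z_add_group] E_iso]) (auto intro: L_E)

lemma E_map_cocycle_iso:
  assumes "n \<ge> 2"
  shows "group_iso (E_map A n) (Z_add A n) (Z_mult A n)
    \<and> group_iso (L_map A n) (Z_mult A n) (Z_add A n)
    \<and> (\<forall>\<phi>\<in>carrier (Z_add A n). L_map A n (E_map A n \<phi>) = \<phi>)
    \<and> (\<forall>\<Phi>\<in>carrier (Z_mult A n). E_map A n (L_map A n \<Phi>) = \<Phi>)"
  using E_iso[OF assms] L_iso[OF assms] L_E[OF assms] E_L[OF assms]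
    comm_group.axioms(2)[OF Z_add_group] comm_group.axioms(2)[OF Z_mult_group[OF assms]]
  by (simp add: group_iso_def)

lemma B_add_subgroup:
  assumes "n \<ge> 1"
  shows "subgroup (B_add A n) (Z_add A n)"
proof -
  interpret comm_group "Z_add A n" by (rule Z_add_group)
  obtain m where m: "n = Suc m" using assms by (cases n) auto
  have B: "B_add A n = d_add m ` tensor_power I m" by (simp add: B_add_def m C_add_eq)
  show ?thesis
  proof (rule subgroupI)
    show sub: "B_add A n \<subseteq> carrier (Z_add A n)"
      unfolding B using d_add_closed[of _ m] by (auto simp: m d_add_d_add)
    show "B_add A n \<noteq> {}" using tensor_power_closed(1) by (auto simp: B)
    fix x assume x: "x \<in> B_add A n"
    then obtain z where z: "z \<in> tensor_power I m" "x = d_add m z" by (auto simp: B)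
    have "- x \<in> B_add A n"
      unfolding B z(2) d_add_linear(3)[symmetric] by (intro imageI tensor_power_closed z)
    moreover have "inv\<^bsub>Z_add A n\<^esub> x = - x"
      by (rule comm_inv_char) (use sub x \<open>- x \<in> B_add A n\<close> in auto)
    ultimately show "inv\<^bsub>Z_add A n\<^esub> x \<in> B_add A n" by simp
    fix y assume "y \<in> B_add A n"
    then obtain z' where z': "z' \<in> tensor_power I m" "y = d_add m z'" by (auto simp: B)
    have "x + y \<in> B_add A n"
      unfolding B z(2) z'(2) d_add_linear(2)[symmetric] by (intro imageI tensor_power_closed z z')
    then show "x \<otimes>\<^bsub>Z_add A n\<^esub> y \<in> B_add A n" by simp
  qed
qed

text \<open>Coboundaries in degree n come from cochains in degree n - 1, and these are exponentials
  once n - 1 \<ge> 2. This is the source of the bound n \<ge> 3.\<close>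

lemma B_mult_eq:
  assumes "n \<ge> 3"
  shows "B_mult A n = E_map A n ` B_add A n"
proof -
  obtain m where m: "n = Suc m" "m \<ge> 2" using assms by (cases n) auto
  have "B_mult A n = d_mult A m ` Exp m ` tensor_power I m"
    by (simp add: B_mult_def m(1) C_mult_eq[OF m(2)] Exp_image[OF m(2)])
  also have "\<dots> = Exp n ` d_add m ` tensor_power I m"
    unfolding image_image m(1) by (intro image_cong refl d_mult_Exp m(2))
  also have "\<dots> = E_map A n ` d_add m ` tensor_power I m"
    using d_add_closed[of _ m] m by (intro image_cong refl) (auto simp: E_map_Exp)
  finally show ?thesis by (simp add: B_add_def m(1) C_add_eq)
qed

text \<open>The maps on classes are taken to be direct images of cosets. Well-definedness is then
  automatic, and the formulas on representatives follow because a homomorphism maps cosets to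
  cosets.\<close>

lemma E_map_cohomology_iso:
  assumes n3: "n \<ge> 3"
  shows "\<exists>EE LL.
           (\<forall>\<phi>\<in>carrier (Z_add A n). EE (cls_add A n \<phi>) = cls_mult A n (E_map A n \<phi>))
           \<and> (\<forall>\<Phi>\<in>carrier (Z_mult A n). LL (cls_mult A n \<Phi>) = cls_add A n (L_map A n \<Phi>))
           \<and> group_iso EE (H_add A n) (H_mult A n)
           \<and> group_iso LL (H_mult A n) (H_add A n)
           \<and> (\<forall>x\<in>carrier (H_add A n). LL (EE x) = x)
           \<and> (\<forall>y\<in>carrier (H_mult A n). EE (LL y) = y)"
proof -
  have n: "n \<ge> 2" using n3 by simp
  let ?G = "Z_add A n" and ?H = "Z_mult A n" and ?E = "E_map A n" and ?L = "L_map A n"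
  let ?B = "B_add A n" and ?C = "B_mult A n"
  interpret G: comm_group ?G by (rule Z_add_group)
  interpret H: comm_group ?H by (rule Z_mult_group[OF n])
  have BG: "subgroup ?B ?G" using n by (intro B_add_subgroup) simp
  note E = image_iso_quotient[OF G.comm_group_axioms H.comm_group_axioms E_iso[OF n] BG,
      folded B_mult_eq[OF n3]]
  interpret B: normal ?B ?G using BG by (rule G.subgroup_imp_normal)
  interpret C: normal ?C ?H using E(1) by (rule H.subgroup_imp_normal)
  have LE: "?L (?E x) = x" if "x \<in> carrier ?G" for x using that L_E[OF n] by simp
  have "?L ` ?C = ?B"
    unfolding B_mult_eq[OF n3] image_image using LE B.subset by force
  with image_iso_quotient(2)[OF H.comm_group_axioms G.comm_group_axioms L_iso[OF n] E(1)]
  have L: "(\<lambda>S. ?L ` S) \<in> iso (?H Mod ?C) (?G Mod ?B)" by simp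
  have homE: "?E \<in> hom ?G ?H" and homL: "?L \<in> hom ?H ?G"
    using E_iso[OF n] L_iso[OF n] by (auto simp: iso_def)
  have subG: "S \<subseteq> carrier ?G" if "S \<in> carrier (?G Mod ?B)" for S
    using that G.r_coset_subset_G[OF B.subset] unfolding carrier_FactGroup by blast
  have subH: "S \<subseteq> carrier ?H" if "S \<in> carrier (?H Mod ?C)" for S
    using that H.r_coset_subset_G[OF C.subset] unfolding carrier_FactGroup by blast
  show ?thesis
  proof (intro exI conjI ballI)
    show "?E ` cls_add A n x = cls_mult A n (?E x)" if "x \<in> carrier ?G" for x
      unfolding cls_add_def cls_mult_def B_mult_eq[OF n3] by (rule image_r_coset[OF homE B.subset that])
    show "?L ` cls_mult A n y = cls_add A n (?L y)" if "y \<in> carrier ?H" for y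
      using image_r_coset[OF homL C.subset that] \<open>?L ` ?C = ?B\<close> by (simp add: cls_add_def cls_mult_def)
    show "group_iso (\<lambda>S. ?E ` S) (H_add A n) (H_mult A n)"
      using E(2) B.factorgroup_is_group C.factorgroup_is_group
      by (simp add: group_iso_def H_add_def H_mult_def)
    show "group_iso (\<lambda>S. ?L ` S) (H_mult A n) (H_add A n)"
      using L B.factorgroup_is_group C.factorgroup_is_group
      by (simp add: group_iso_def H_add_def H_mult_def)
    fix S assume "S \<in> carrier (H_add A n)"
    then have "S \<subseteq> carrier ?G" using subG by (simp add: H_add_def)
    then show "?L ` ?E ` S = S" unfolding image_image using LE by force
  next
    fix T assume "T \<in> carrier (H_mult A n)"
    then have "T \<subseteq> carrier ?H" using subH by (simp add: H_mult_def)
    then show "?E ` ?L ` T = T" unfolding image_image using E_L[OF n] by force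
  qed
qed

end

section \<open>Units in degree zero and characters in degree one\<close>

lemma iso_trivial_quotient:
  assumes "group G" "B = {\<one>\<^bsub>G\<^esub>}"
  shows "group (G Mod B)" "(\<lambda>x. B #>\<^bsub>G\<^esub> x) \<in> iso G (G Mod B)"
proof -
  interpret group G by fact
  interpret B: normal B G unfolding assms(2) by (rule one_is_normal)
  show "group (G Mod B)" by (rule B.factorgroup_is_group)
  have "B #>\<^bsub>G\<^esub> x = {x}" if "x \<in> carrier G" for x
    using that by (simp add: r_coset_def assms(2))
  then have "inj_on (\<lambda>x. B #>\<^bsub>G\<^esub> x) (carrier G)" by (auto intro!: inj_onI)
  then show "(\<lambda>x. B #>\<^bsub>G\<^esub> x) \<in> iso G (G Mod B)"
    using B.r_coset_hom_Mod by (auto simp: iso_def bij_betw_def carrier_FactGroup)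
qed

lemma group_iso_trivial_quotient:
  assumes "group F" "group G" "f \<in> iso F G" "B = {\<one>\<^bsub>G\<^esub>}"
  shows "group_iso (\<lambda>x. B #>\<^bsub>G\<^esub> f x) F (G Mod B)"
  using iso_trivial_quotient[OF assms(2,4)] iso_set_trans[OF assms(3)] assms(1)
  unfolding group_iso_def by (fastforce simp: compose_def o_def)

lemma mult_group_of_field_comm_group: "comm_group (mult_group_of_field :: 'k::field monoid)"
  by (rule comm_groupI)
    (auto simp: mult_group_of_field_def ac_simps intro!: bexI[of _ "inverse _"])

text \<open>The algebra homomorphism from Laurent polynomials that sends t to \<Phi>. The group
  \<open>G\<close> supplies the negative powers; it will be the group of multiplicative
  1-cocycles.\<close>

definition char_ext :: "('g, 'k::field) cochain monoid \<Rightarrow> ('g, 'k) cochain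
    \<Rightarrow> (int \<Rightarrow>\<^sub>0 'k) \<Rightarrow> ('g, 'k) cochain" where
  "char_ext G \<Phi> P ws = (\<Sum>m\<in>Poly_Mapping.keys P. Poly_Mapping.lookup P m * (\<Phi> [^]\<^bsub>G\<^esub> m) ws)"

lemma char_ext_superset:
  assumes "finite S" "Poly_Mapping.keys P \<subseteq> S"
  shows "char_ext G \<Phi> P ws = (\<Sum>m\<in>S. Poly_Mapping.lookup P m * (\<Phi> [^]\<^bsub>G\<^esub> m) ws)"
  unfolding char_ext_def
  by (rule sum.mono_neutral_left) (use assms in \<open>auto simp: in_keys_iff\<close>)

lemma char_ext_add: "char_ext G \<Phi> (P + Q) = char_ext G \<Phi> P + char_ext G \<Phi> Q"
proof
  fix ws
  let ?S = "Poly_Mapping.keys P \<union> Poly_Mapping.keys Q"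
  have "char_ext G \<Phi> (P + Q) ws = (\<Sum>m\<in>?S. Poly_Mapping.lookup (P + Q) m * (\<Phi> [^]\<^bsub>G\<^esub> m) ws)"
    by (rule char_ext_superset) (use Poly_Mapping.keys_add[of P Q] in auto)
  also have "\<dots> = char_ext G \<Phi> P ws + char_ext G \<Phi> Q ws"
    by (simp add: char_ext_superset[of ?S] lookup_add ring_distribs sum.distrib)
  finally show "char_ext G \<Phi> (P + Q) ws = (char_ext G \<Phi> P + char_ext G \<Phi> Q) ws" by simp
qed

lemma char_ext_zero: "char_ext G \<Phi> 0 = 0"
  by (rule ext) (simp add: char_ext_def)

lemma char_ext_single: "char_ext G \<Phi> (Poly_Mapping.single m c) = smul c (\<Phi> [^]\<^bsub>G\<^esub> m)"
  using char_ext_superset[of "{m}" "Poly_Mapping.single m c" G \<Phi>]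
  by (intro ext) (simp add: smul_def)

lemma char_ext_lpow: "char_ext G \<Phi> (lpow m) = \<Phi> [^]\<^bsub>G\<^esub> m"
  by (simp add: lpow_def char_ext_single)

context coord_algebra
begin

lemma face_unit_inv:
  assumes "i \<le> Suc n" "x \<in> Units (cochain_ring A n)"
  shows "face i n x \<in> Units (cochain_ring A (Suc n))"
    "inv\<^bsub>cochain_ring A (Suc n)\<^esub> face i n x = face i n (inv\<^bsub>cochain_ring A n\<^esub> x)"
proof -
  interpret comm_monoid "cochain_ring A n" by (rule cochain_comm_monoid)
  let ?y = "inv\<^bsub>cochain_ring A n\<^esub> x"
  have x: "x \<in> tensor_power A n" and y: "?y \<in> tensor_power A n"
    using assms(2) Units_closed Units_inv_closed by auto
  have "conv x ?y = unit_cochain n" using Units_r_inv[OF assms(2)] by simp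
  then have "conv (face i n x) (face i n ?y) = unit_cochain (Suc n)"
    by (simp add: face_conv[OF assms(1), symmetric] face_unit[OF assms(1)])
  from cochain_inv[OF face_tensor_power[OF assms(1) x] face_tensor_power[OF assms(1) y] this]
  show "face i n x \<in> Units (cochain_ring A (Suc n))"
    "inv\<^bsub>cochain_ring A (Suc n)\<^esub> face i n x = face i n ?y" .
qed

lemma unit_int_pow:
  assumes "x \<in> Units (cochain_ring A n)"
  shows "x [^]\<^bsub>cochain_ring A n\<^esub> (1 :: int) = x"
    "x [^]\<^bsub>cochain_ring A n\<^esub> (- 1 :: int) = inv\<^bsub>cochain_ring A n\<^esub> x"
proof -
  interpret comm_monoid "cochain_ring A n" by (rule cochain_comm_monoid)
  have "x \<in> carrier (cochain_ring A n)" using assms by (rule Units_closed)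
  then show "x [^]\<^bsub>cochain_ring A n\<^esub> (1 :: int) = x"
    "x [^]\<^bsub>cochain_ring A n\<^esub> (- 1 :: int) = inv\<^bsub>cochain_ring A n\<^esub> x"
    by (simp_all add: int_pow_def2 conv_unit supported_tensor_power)
qed

text \<open>The coefficients are trivial, so both faces of a 0-cochain agree and the coboundary is a
  quotient of equal elements. Hence every unit is a 0-cocycle and the 1-coboundaries are
  trivial.\<close>

lemma d_mult_0:
  assumes "x \<in> Units (cochain_ring A 0)"
  shows "d_mult A 0 x = unit_cochain 1"
proof -
  let ?R = "cochain_ring A (Suc 0)"
  interpret R: comm_monoid ?R by (rule cochain_comm_monoid)
  have eq: "face (Suc 0) 0 x = face 0 0 x"
    by (rule ext) (simp add: face_def length_Suc_conv, auto)
  have u: "face 0 0 x \<in> Units ?R" using assms by (intro face_unit_inv) auto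
  have "(\<lambda>i. face i 0 x [^]\<^bsub>?R\<^esub> ((- 1) ^ i :: int)) \<in> {..Suc 0} \<rightarrow> carrier ?R"
    using R.Units_closed[OF u] R.Units_inv_closed[OF u]
    by (auto simp: le_Suc_eq eq unit_int_pow[OF u] simp del: cochain_ring_simps)
  then show ?thesis
    unfolding d_mult_def
    using R.Units_l_inv[OF u] R.Units_closed[OF u]
    by (simp add: R.finprod_Suc eq unit_int_pow[OF u] conv_unit_right supported_tensor_power)
qed

text \<open>The coboundary is the product of face 0, the inverse of face 1, and face 2.\<close>

lemma d_mult_1:
  assumes "x \<in> Units (cochain_ring A 1)"
  shows "d_mult A 1 x = unit_cochain 2 \<longleftrightarrow> face 1 1 x = conv (face 0 1 x) (face 2 1 x)"
proof -
  let ?R = "cochain_ring A (Suc (Suc 0))"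
  interpret R: comm_monoid ?R by (rule cochain_comm_monoid)
  have u: "face i (Suc 0) x \<in> Units ?R" if "i \<le> Suc (Suc 0)" for i
    using assms that by (intro face_unit_inv) auto
  let ?f = "\<lambda>i. face i (Suc 0) x"
  have u': "?f 0 \<in> Units ?R" "?f (Suc 0) \<in> Units ?R" "?f (Suc (Suc 0)) \<in> Units ?R"
    by (rule u; simp)+
  note c = u'[THEN R.Units_closed] and ic = u'[THEN R.Units_inv_closed]
  have "(\<lambda>i. ?f i [^]\<^bsub>?R\<^esub> ((- 1) ^ i :: int)) \<in> {..Suc (Suc 0)} \<rightarrow> carrier ?R"
    using c ic by (auto simp: le_Suc_eq u'[THEN unit_int_pow(1)] u'[THEN unit_int_pow(2)]
        simp del: cochain_ring_simps)
  moreover have "(\<lambda>i. ?f i [^]\<^bsub>?R\<^esub> ((- 1) ^ i :: int)) \<in> {..Suc 0} \<rightarrow> carrier ?R"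
    using c ic by (auto simp: le_Suc_eq u'[THEN unit_int_pow(1)] u'[THEN unit_int_pow(2)]
        simp del: cochain_ring_simps)
  ultimately have d: "d_mult A (Suc 0) x
      = ?f (Suc (Suc 0)) \<otimes>\<^bsub>?R\<^esub> (inv\<^bsub>?R\<^esub> (?f (Suc 0)) \<otimes>\<^bsub>?R\<^esub> ?f 0)"
    unfolding d_mult_def using c
    by (simp add: R.finprod_Suc R.finprod_0 u'[THEN unit_int_pow(1)] u'[THEN unit_int_pow(2)]
        del: cochain_ring_simps)
  also have "\<dots> = inv\<^bsub>?R\<^esub> (?f (Suc 0)) \<otimes>\<^bsub>?R\<^esub> (?f 0 \<otimes>\<^bsub>?R\<^esub> ?f (Suc (Suc 0)))"
    using c ic by (simp add: R.m_ac del: cochain_ring_simps)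
  finally have "d_mult A (Suc 0) x = \<one>\<^bsub>?R\<^esub> \<longleftrightarrow> ?f (Suc 0) = ?f 0 \<otimes>\<^bsub>?R\<^esub> ?f (Suc (Suc 0))"
    using c ic u'(2) R.Units_l_inv[OF u'(2)] R.Units_l_cancel[OF R.Units_inv_Units[OF u'(2)] c(2), of "?f 0 \<otimes>\<^bsub>?R\<^esub> ?f (Suc (Suc 0))"]
    by (metis R.m_closed)
  then show ?thesis by (simp add: numeral_2_eq_2)
qed

lemma tensor_power_0: "tensor_power A 0 = {smul c (unit_cochain 0) | c. True}"
proof -
  have "{pure_tensor as | as. length as = 0 \<and> set as \<subseteq> A} = {unit_cochain 0}"
    by (auto simp: pure_tensor_Nil)
  then show ?thesis
    unfolding tensor_power_eq by (auto simp: funsp.span_singleton)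
qed

lemma smul_unit_0_inj: "smul c (unit_cochain 0) = smul d (unit_cochain 0) \<Longrightarrow> c = d"
  by (drule fun_cong[of _ _ "[]"]) (simp add: smul_def unit_cochain_def)

lemma C_mult_0: "C_mult A 0 = {smul c (unit_cochain 0) | c. c \<noteq> 0}"
proof -
  have mult: "conv (smul c (unit_cochain 0)) (smul d (unit_cochain 0)) = smul (c * d) (unit_cochain 0)"
    for c d :: 'k
    by (simp add: conv_smul_left conv_smul_right conv_unit)
  have "smul c (unit_cochain 0) \<in> Units (cochain_ring A 0)" if "c \<noteq> 0" for c
    by (rule cochain_inv(1)[of _ _ "smul (inverse c) (unit_cochain 0)"])
      (use that in \<open>auto simp: tensor_power_0 mult\<close>)
  moreover have "c \<noteq> 0" if "smul c (unit_cochain 0) \<in> Units (cochain_ring A 0)" for c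
  proof
    assume "c = 0"
    then have "unit_cochain 0 = (0 :: ('g, 'k) cochain)" using that by (auto simp: Units_def)
    then show False by (drule_tac fun_cong[of _ _ "[]"]) (simp add: unit_cochain_def)
  qed
  moreover have "Units (cochain_ring A 0) \<subseteq> tensor_power A 0" by (auto simp: Units_def)
  moreover have "C_mult A 0 = Units (cochain_ring A 0)" by (simp add: C_mult_def)
  ultimately show ?thesis unfolding tensor_power_0 by blast
qed

lemma H_mult_0_iso:
  "group_iso (\<lambda>c. cls_mult A 0 (\<lambda>ws. c * unit_cochain 0 ws)) mult_group_of_field (H_mult A 0)"
proof -
  have Z: "carrier (Z_mult A 0) = {smul c (unit_cochain 0) | c. c \<noteq> 0}"
    using d_mult_0 by (auto simp: C_mult_0[symmetric]) (auto simp: C_mult_def)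
  have iso: "(\<lambda>c. smul c (unit_cochain 0)) \<in> iso mult_group_of_field (Z_mult A 0)"
    unfolding iso_def hom_def bij_betw_def Z
    by (auto simp: mult_group_of_field_def conv_smul_left conv_smul_right conv_unit
        intro!: inj_onI dest: smul_unit_0_inj)
  then have Zg: "comm_group (Z_mult A 0)"
    by (rule iso_imp_comm_group[OF mult_group_of_field_comm_group]) (simp add: mult_group_of_field_def)
  from group_iso_trivial_quotient[OF comm_group.axioms(2)[OF mult_group_of_field_comm_group]
      comm_group.axioms(2)[OF Zg] iso, of "B_mult A 0"]
  show ?thesis by (simp add: cls_mult_def H_mult_def B_mult_def smul_def)
qed

lemma B_mult_1: "B_mult A 1 = {unit_cochain 1}"
proof -
  have "smul 1 (unit_cochain 0) \<in> C_mult A 0"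
    unfolding C_mult_0 by (intro CollectI exI[of _ 1] conjI refl) simp
  then have "(\<lambda>_. unit_cochain 1) ` C_mult A 0 = {unit_cochain 1 :: ('g, 'k) cochain}"
    by (rule image_constant)
  moreover have "d_mult A 0 ` C_mult A 0 = (\<lambda>_. unit_cochain 1) ` C_mult A 0"
    by (intro image_cong refl d_mult_0) (simp add: C_mult_def)
  ultimately show ?thesis by (simp add: B_mult_def)
qed

lemma Z_mult_1_carrier:
  "x \<in> carrier (Z_mult A 1) \<longleftrightarrow> x \<in> Units (cochain_ring A 1) \<and> x [[]] = 1
     \<and> face 1 1 x = conv (face 0 1 x) (face 2 1 x)"
proof -
  have "counit_at 0 x = unit_cochain 0 \<longleftrightarrow> x [[]] = 1" if "x \<in> Units (cochain_ring A 1)"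
  proof -
    have s: "supported 1 x" using that by (intro supported_tensor_power[of x A]) (simp add: Units_def)
    show ?thesis
    proof
      assume "counit_at 0 x = unit_cochain 0"
      then show "x [[]] = 1"
        by (drule_tac fun_cong[of _ _ "[]"]) (simp add: counit_at_def unit_cochain_def)
    next
      assume "x [[]] = 1"
      then show "counit_at 0 x = unit_cochain 0"
        using s by (intro ext) (auto simp: counit_at_def unit_cochain_def supported_def)
    qed
  qed
  then show ?thesis using d_mult_1[of x] by (auto simp: C_mult_def numeral_2_eq_2)
qed

text \<open>Face 1 is \<Delta>(x), and (1 \<otimes> x)(x \<otimes> 1) = x \<otimes> x, so the
  cocycle condition says that x is grouplike, i.e. a multiplicative functional.\<close>

lemma multiplicative_iff:
  assumes "x \<in> tensor_power A 1"
  shows "face 1 1 x = conv (face 0 1 x) (face 2 1 x) \<longleftrightarrow> (\<forall>u v. x [u @ v] = x [u] * x [v])"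
proof -
  let ?e = "\<lambda>w :: 'g list. if w = [] then 1 else 0 :: 'k"
  define a where "a w = x [w]" for w
  have one: "unit_cochain (Suc 0) = tcons ?e (unit_cochain 0)" by (rule unit_cochain_Suc)
  \<comment> \<open>The counit of the enveloping algebra is neutral for \<open>sconv\<close>; this
    is obtained from \<open>conv_unit\<close> by viewing \<open>a\<close> as a cochain of degree
    1.\<close>
  have "sconv ?e a w = a w" "sconv a ?e w = a w" for w
  proof -
    have s: "supported (Suc 0) (tcons a (unit_cochain 0))"
      by (simp add: supported_def tcons_def unit_cochain_def split: list.split)
    have "conv (unit_cochain (Suc 0)) (tcons a (unit_cochain 0)) [w] = a w"
      by (simp add: conv_unit[OF s] unit_cochain_def)
    then show "sconv ?e a w = a w"
      unfolding one conv_tcons by (simp add: unit_cochain_def)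
    have "conv (tcons a (unit_cochain 0)) (unit_cochain (Suc 0)) [w] = a w"
      by (simp add: conv_unit_right[OF s] unit_cochain_def)
    then show "sconv a ?e w = a w"
      unfolding one conv_tcons by (simp add: unit_cochain_def)
  qed
  then have sc: "sconv ?e a = a" "sconv a ?e = a" by auto
  have s: "supported 1 x" using assms by (rule supported_tensor_power)
  have x: "x = tcons a (unit_cochain 0)"
    using s by (intro ext) (auto simp: a_def tcons_def unit_cochain_def supported_def split: list.split)
  have f0: "face 0 1 x = tcons ?e (tcons a (unit_cochain 0))"
    by (rule ext) (auto simp: x face_def tcons_def unit_cochain_def split: list.split)
  have f2: "face 2 1 x = tcons a (tcons ?e (unit_cochain 0))"
    by (rule ext) (auto simp: x face_def tcons_def unit_cochain_def split: list.split)
  have eq: "conv (face 0 1 x) (face 2 1 x) = tcons a (tcons a (unit_cochain 0))"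
    unfolding f0 f2 conv_tcons sc by (simp add: conv_unit)
  have f1: "face 1 1 x [u, v] = a (u @ v)" for u v
    by (simp add: face_def a_def)
  show ?thesis
  proof
    assume *: "face 1 1 x = conv (face 0 1 x) (face 2 1 x)"
    show "\<forall>u v. x [u @ v] = x [u] * x [v]"
    proof (intro allI)
      fix u v
      show "x [u @ v] = x [u] * x [v]"
        using fun_cong[OF *[unfolded eq], of "[u, v]"] f1[of u v] by (simp add: a_def unit_cochain_def)
    qed
  next
    assume *: "\<forall>u v. x [u @ v] = x [u] * x [v]"
    show "face 1 1 x = conv (face 0 1 x) (face 2 1 x)"
      unfolding eq
    proof
      fix ws :: "'g list list"
      show "face 1 1 x ws = tcons a (tcons a (unit_cochain 0)) ws"
      proof (cases "length ws = 2")
        case True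
        then obtain u v where "ws = [u, v]" by (auto simp: length_Suc_conv numeral_2_eq_2)
        then show ?thesis using f1[of u v] * by (simp add: a_def unit_cochain_def)
      next
        case False
        then show ?thesis
          by (auto simp: face_def tcons_def unit_cochain_def split: list.split)
      qed
    qed
  qed
qed

lemma Z_mult_1_group: "comm_group (Z_mult A 1)"
proof (rule comm_groupI)
  interpret R: comm_monoid "cochain_ring A 1" by (rule cochain_comm_monoid)
  interpret S: comm_monoid "cochain_ring A (Suc 1)" by (rule cochain_comm_monoid)
  show "\<one>\<^bsub>Z_mult A 1\<^esub> \<in> carrier (Z_mult A 1)"
    unfolding Z_mult_1_carrier using R.Units_one_closed
    by (simp add: face_unit conv_unit) (simp add: unit_cochain_def)
  fix x assume x: "x \<in> carrier (Z_mult A 1)"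
  note X = x[unfolded Z_mult_1_carrier]
  have xs: "supported 1 x" using X by (intro supported_tensor_power[of x A]) (simp add: Units_def)
  show "\<one>\<^bsub>Z_mult A 1\<^esub> \<otimes>\<^bsub>Z_mult A 1\<^esub> x = x" using conv_unit[OF xs] by simp
  show "\<exists>y\<in>carrier (Z_mult A 1). y \<otimes>\<^bsub>Z_mult A 1\<^esub> x = \<one>\<^bsub>Z_mult A 1\<^esub>"
  proof
    let ?y = "inv\<^bsub>cochain_ring A 1\<^esub> x"
    have inv: "conv ?y x = unit_cochain 1" using R.Units_l_inv[of x] X by simp
    show "?y \<otimes>\<^bsub>Z_mult A 1\<^esub> x = \<one>\<^bsub>Z_mult A 1\<^esub>" using inv by simp
    have "?y [[]] = 1"
      using fun_cong[OF inv, of "[[]]"] X by (simp add: fix_empty_def unit_cochain_def)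
    moreover have "face 1 1 ?y = conv (face 0 1 ?y) (face 2 1 ?y)"
    proof -
      note f = face_unit_inv[where n = 1, OF _ X[THEN conjunct1]]
      have "face 1 1 ?y = inv\<^bsub>cochain_ring A (Suc 1)\<^esub> (conv (face 0 1 x) (face 2 1 x))"
        using f(2)[of 1] X by simp
      also have "\<dots> = conv (face 0 1 ?y) (face 2 1 ?y)"
      proof (rule cochain_inv(2))
        show "conv (face 0 1 x) (face 2 1 x) \<in> tensor_power A (Suc 1)"
          using f(1)[of 0] f(1)[of 2] by (auto simp: Units_def intro: tensor_power_conv[OF A_sconv])
        have yt: "?y \<in> tensor_power A 1" using R.Units_inv_closed[of x] X by simp
        show "conv (face 0 1 ?y) (face 2 1 ?y) \<in> tensor_power A (Suc 1)"
          by (intro tensor_power_conv[OF A_sconv] face_tensor_power yt) auto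
        have "conv (conv (face 0 1 x) (face 2 1 x)) (conv (face 0 1 ?y) (face 2 1 ?y))
            = conv (conv (face 0 1 ?y) (face 0 1 x)) (conv (face 2 1 ?y) (face 2 1 x))"
          by (simp add: conv_ac)
        then show "conv (conv (face 0 1 x) (face 2 1 x)) (conv (face 0 1 ?y) (face 2 1 ?y))
            = unit_cochain (Suc 1)"
          by (simp add: face_conv[symmetric] inv face_unit conv_unit del: One_nat_def)
      qed
      finally show ?thesis .
    qed
    ultimately show "?y \<in> carrier (Z_mult A 1)"
      unfolding Z_mult_1_carrier using R.Units_inv_Units X by blast
  qed
  fix y assume y: "y \<in> carrier (Z_mult A 1)"
  note Y = y[unfolded Z_mult_1_carrier]
  show "x \<otimes>\<^bsub>Z_mult A 1\<^esub> y = y \<otimes>\<^bsub>Z_mult A 1\<^esub> x" by (simp add: conv_commute[of x])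
  have "conv x y \<in> Units (cochain_ring A 1)" using R.Units_m_closed[of x y] X Y by simp
  moreover have "conv x y [[]] = 1" using X Y by (simp add: fix_empty_def)
  moreover have "face 1 1 (conv x y) = conv (face 0 1 (conv x y)) (face 2 1 (conv x y))"
  proof -
    have "face 1 1 (conv x y) = conv (conv (face 0 1 x) (face 2 1 x)) (conv (face 0 1 y) (face 2 1 y))"
      using X Y by (simp add: face_conv)
    also have "\<dots> = conv (conv (face 0 1 x) (face 0 1 y)) (conv (face 2 1 x) (face 2 1 y))"
      by (simp add: conv_ac)
    finally show ?thesis by (simp add: face_conv)
  qed
  ultimately show "x \<otimes>\<^bsub>Z_mult A 1\<^esub> y \<in> carrier (Z_mult A 1)"
    unfolding Z_mult_1_carrier Z_mult_simps(2) by blast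
qed (simp add: conv_assoc)

lemma Hom_Gm_lpow:
  assumes "hopf_hom_Gm A h"
  shows "h (lpow m) \<in> carrier (Z_mult A 1)"
    "h (lpow (m + l)) = conv (h (lpow m)) (h (lpow l))"
    "h (Poly_Mapping.single m c) = smul c (h (lpow m))"
proof -
  have lp: "lpow (a + b) = (lpow a * lpow b :: int \<Rightarrow>\<^sub>0 'k)" for a b
    by (simp add: lpow_def mult_single)
  have add: "h (lpow (a + b)) = conv (h (lpow a)) (h (lpow b))" for a b
    using assms by (simp add: hopf_hom_Gm_def lp)
  then show "h (lpow (m + l)) = conv (h (lpow m)) (h (lpow l))" .
  have one: "h (lpow 0) = unit_cochain 1"
    using assms by (simp add: hopf_hom_Gm_def lpow_def)
  have mem: "h P \<in> tensor_power A 1" for P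
    using assms by (simp add: hopf_hom_Gm_def)
  \<comment> \<open>The image of t^(-m) serves as the inverse.\<close>
  have "h (lpow m) \<in> Units (cochain_ring A 1)"
    by (rule cochain_inv(1)[OF mem mem[of "lpow (- m)"]]) (simp add: add[symmetric] one)
  moreover have "\<forall>u v. h (lpow m) [u @ v] = h (lpow m) [u] * h (lpow m) [v]" "h (lpow m) [[]] = 1"
    using assms by (auto simp: hopf_hom_Gm_def)
  ultimately show "h (lpow m) \<in> carrier (Z_mult A 1)"
    unfolding Z_mult_1_carrier multiplicative_iff[OF mem] by blast
  have "Poly_Mapping.single m c = Poly_Mapping.single 0 c * lpow m"
    by (simp add: lpow_def mult_single)
  moreover have "h (Poly_Mapping.single 0 c * P) ws = c * h P ws" for P ws
    using assms unfolding hopf_hom_Gm_def by blast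
  ultimately show "h (Poly_Mapping.single m c) = smul c (h (lpow m))"
    by (intro ext) (simp only: smul_def)
qed

text \<open>The value at t forces the value at its inverse, hence at all powers of t, and these span
  the Laurent polynomials.\<close>

lemma Hom_Gm_eqI:
  assumes h: "hopf_hom_Gm A h" and h': "hopf_hom_Gm A h'" and eq: "h (lpow 1) = h' (lpow 1)"
  shows "h = h'"
proof
  interpret G: comm_group "Z_mult A 1" by (rule Z_mult_1_group)
  note H = Hom_Gm_lpow[OF h] and H' = Hom_Gm_lpow[OF h']
  have one: "h (lpow 0) = unit_cochain 1" "h' (lpow 0) = unit_cochain 1"
    using h h' by (simp_all add: hopf_hom_Gm_def lpow_def)
  have neg: "h (lpow (- 1)) = h' (lpow (- 1))"
  proof -
    have "inv\<^bsub>Z_mult A 1\<^esub> h (lpow 1) = h (lpow (- 1))"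
      by (rule G.comm_inv_char) (use H(1) H(2)[of 1 "- 1"] one in auto)
    moreover have "inv\<^bsub>Z_mult A 1\<^esub> h' (lpow 1) = h' (lpow (- 1))"
      by (rule G.comm_inv_char) (use H'(1) H'(2)[of 1 "- 1"] one in auto)
    ultimately show ?thesis using eq by simp
  qed
  have lp: "h (lpow m) = h' (lpow m)" for m
  proof (induction m rule: int_induct[of _ 0])
    case base
    show ?case using one by simp
  next
    case (step1 i)
    then show ?case using H(2)[of i 1] H'(2)[of i 1] eq by simp
  next
    case (step2 i)
    then show ?case using H(2)[of i "- 1"] H'(2)[of i "- 1"] neg by simp
  qed
  have add: "g (P + Q) = g P + g Q" if "hopf_hom_Gm A g" for g P Q
    using that by (intro ext) (simp add: hopf_hom_Gm_def)
  fix P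
  show "h P = h' P"
  proof (induction P rule: poly_mapping_single_induct)
    case zero
    have "h (Poly_Mapping.single 0 0) = h' (Poly_Mapping.single 0 0)" by (simp only: H(3) H'(3) lp)
    then show ?case by simp
  next
    case (add a b)
    then show ?case using \<open>\<And>g P Q. hopf_hom_Gm A g \<Longrightarrow> g (P + Q) = g P + g Q\<close> h h' by metis
  next
    case (single m c)
    show ?case by (simp only: H(3) H'(3) lp)
  qed
qed

lemma char_ext_hopf_hom:
  assumes x: "x \<in> carrier (Z_mult A 1)"
  shows "hopf_hom_Gm A (char_ext (Z_mult A 1) x)"
proof -
  interpret G: comm_group "Z_mult A 1" by (rule Z_mult_1_group)
  let ?\<theta> = "char_ext (Z_mult A 1) x"
  have pow: "x [^]\<^bsub>Z_mult A 1\<^esub> m \<in> carrier (Z_mult A 1)" for m :: int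
    using x by (rule G.int_pow_closed)
  have powt: "x [^]\<^bsub>Z_mult A 1\<^esub> m \<in> tensor_power A 1" for m :: int
    using pow[of m] unfolding Z_mult_1_carrier by (simp add: Units_def)
  have mem: "?\<theta> P \<in> tensor_power A 1" for P
  proof (induction P rule: poly_mapping_single_induct)
    case zero
    show ?case unfolding char_ext_zero by (rule tensor_power_closed)
  next
    case (add a b)
    then show ?case unfolding char_ext_add by (rule tensor_power_closed)
  next
    case (single m c)
    show ?case unfolding char_ext_single by (intro tensor_power_closed powt)
  qed
  have mult: "?\<theta> (P * Q) = conv (?\<theta> P) (?\<theta> Q)" for P Q
  proof (induction P rule: poly_mapping_single_induct)
    case zero
    show ?case by (simp only: mult_zero_left char_ext_zero conv_zero_left)
  next
    case (add a b)
    then show ?case by (simp only: distrib_right char_ext_add conv_add_left)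
  next
    case (single m c)
    show ?case
    proof (induction Q rule: poly_mapping_single_induct)
      case zero
      show ?case by (simp only: mult_zero_right char_ext_zero conv_zero_right)
    next
      case (add a b)
      then show ?case by (simp only: distrib_left char_ext_add conv_add_right)
    next
      case (single l d)
      have "conv (x [^]\<^bsub>Z_mult A 1\<^esub> m) (x [^]\<^bsub>Z_mult A 1\<^esub> l) = x [^]\<^bsub>Z_mult A 1\<^esub> (m + l)"
        using G.int_pow_mult[OF x, of m l] by simp
      then show ?case
        by (simp add: mult_single char_ext_single conv_smul_left conv_smul_right
            funsp.scale_scale)
    qed
  qed
  have one: "?\<theta> (Poly_Mapping.single 0 c) = smul c (unit_cochain 1)" for c
    by (simp add: char_ext_single)
  show ?thesis
    unfolding hopf_hom_Gm_def
  proof (intro conjI allI)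
    show "?\<theta> 1 = unit_cochain 1" using one[of 1] by simp
    show "?\<theta> (P + Q) ws = ?\<theta> P ws + ?\<theta> Q ws" for P Q ws by (simp add: char_ext_add)
    show "?\<theta> (Poly_Mapping.single 0 c * P) ws = c * ?\<theta> P ws" for c P ws
      unfolding mult one conv_smul_left conv_unit[OF supported_tensor_power[OF mem[of P]]]
      by (simp add: smul_def)
    show "?\<theta> (lpow m) [u @ v] = ?\<theta> (lpow m) [u] * ?\<theta> (lpow m) [v]" for m u v
      using pow[of m] unfolding Z_mult_1_carrier multiplicative_iff[OF powt] char_ext_lpow by blast
    show "?\<theta> (lpow m) [[]] = 1" for m
      using pow[of m] unfolding Z_mult_1_carrier char_ext_lpow by blast
  qed (use mem mult in simp_all)
qed

text \<open>The isomorphism is built from cocycles to characters, because the group laws are known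
  for cocycles and are transported to \<open>Hom_Gm\<close>. Its inverse, evaluation at t, is then
  composed with the quotient map by the trivial coboundaries.\<close>

lemma H_mult_1_iso: "group_iso (\<lambda>h. cls_mult A 1 (h (lpow 1))) (Hom_Gm A) (H_mult A 1)"
proof -
  let ?G = "Z_mult A 1"
  interpret G: comm_group ?G by (rule Z_mult_1_group)
  have lpow1: "char_ext ?G x (lpow 1) = x" if "x \<in> carrier ?G" for x
    unfolding char_ext_lpow by (rule G.int_pow_1[OF that])
  have hom: "char_ext ?G (conv x y) = char_ext ?G x \<otimes>\<^bsub>Hom_Gm A\<^esub> char_ext ?G y"
    if "x \<in> carrier ?G" "y \<in> carrier ?G" for x y
  proof -
    have "conv x y [^]\<^bsub>?G\<^esub> m = conv (x [^]\<^bsub>?G\<^esub> m) (y [^]\<^bsub>?G\<^esub> m)" for m :: int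
      using G.int_pow_distrib[OF that, of m] unfolding Z_mult_simps(2) .
    then show ?thesis
      by (intro ext) (simp add: Hom_Gm_def char_ext_lpow char_ext_def[of _ "conv x y"])
  qed
  have bij: "bij_betw (char_ext ?G) (carrier ?G) (carrier (Hom_Gm A))"
  proof (rule bij_betw_byWitness[of _ "\<lambda>h. h (lpow 1)"])
    show "\<forall>h\<in>carrier (Hom_Gm A). char_ext ?G (h (lpow 1)) = h"
    proof
      fix h assume "h \<in> carrier (Hom_Gm A)"
      then have h: "hopf_hom_Gm A h" by (simp add: Hom_Gm_def)
      from Hom_Gm_lpow(1)[OF h] have "h (lpow 1) \<in> carrier ?G" .
      then show "char_ext ?G (h (lpow 1)) = h"
        by (intro Hom_Gm_eqI char_ext_hopf_hom h lpow1)
    qed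
    show "char_ext ?G ` carrier ?G \<subseteq> carrier (Hom_Gm A)"
      using char_ext_hopf_hom by (auto simp: Hom_Gm_def simp del: Z_mult_simps)
    show "(\<lambda>h. h (lpow 1)) ` carrier (Hom_Gm A) \<subseteq> carrier ?G"
      using Hom_Gm_lpow(1) by (auto simp: Hom_Gm_def simp del: Z_mult_simps)
  qed (use lpow1 in blast)
  have "char_ext ?G \<in> hom ?G (Hom_Gm A)"
    by (rule homI) (use bij_betwE[OF bij] hom Z_mult_simps(2) in \<open>metis+\<close>)
  then have iso: "char_ext ?G \<in> iso ?G (Hom_Gm A)" using bij by (simp add: iso_def)
  have "char_ext ?G \<one>\<^bsub>?G\<^esub> = \<one>\<^bsub>Hom_Gm A\<^esub>"
  proof (intro ext)
    fix P ws
    have "\<one>\<^bsub>?G\<^esub> [^]\<^bsub>?G\<^esub> m = unit_cochain 1" for m :: int using G.int_pow_one by simp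
    then show "char_ext ?G \<one>\<^bsub>?G\<^esub> P ws = \<one>\<^bsub>Hom_Gm A\<^esub> P ws"
      unfolding char_ext_def by (simp add: Hom_Gm_def)
  qed
  then have Hom: "comm_group (Hom_Gm A)" by (rule iso_imp_comm_group[OF G.comm_group_axioms iso])
  have "(\<lambda>h. h (lpow 1)) \<in> iso (Hom_Gm A) ?G"
    by (rule iso_left_inverse[OF G.group_axioms iso]) (rule lpow1)
  moreover have "B_mult A 1 = {\<one>\<^bsub>?G\<^esub>}" by (simp only: B_mult_1 Z_mult_simps(3))
  ultimately show ?thesis
    unfolding cls_mult_def H_mult_def
    by (rule group_iso_trivial_quotient[OF comm_group.axioms(2)[OF Hom] G.group_axioms])
qed

end

theorem theorem5p4:
  fixes scale :: "'k::alg_closed_field \<Rightarrow> 'g::ab_group_add \<Rightarrow> 'g"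
    and br :: "'g \<Rightarrow> 'g \<Rightarrow> 'g"
    and pmap :: "'g \<Rightarrow> 'g"
    and A :: "('g list \<Rightarrow> 'k) set"
  assumes char_pos: "CHAR('k) > 0"
    and lie: "restricted_lie_algebra scale br pmap"
    and fin: "fin_dim scale"
    and A: "A = coord_ring scale br pmap"
  shows "group_iso (\<lambda>c. cls_mult A 0 (\<lambda>ws. c * unit_cochain 0 ws))
           mult_group_of_field (H_mult A 0)
    \<and> group_iso (\<lambda>h. cls_mult A 1 (h (lpow 1))) (Hom_Gm A) (H_mult A 1)
    \<and> (\<forall>n\<ge>2.
           group_iso (E_map A n) (Z_add A n) (Z_mult A n)
           \<and> group_iso (L_map A n) (Z_mult A n) (Z_add A n)
           \<and> (\<forall>\<phi>\<in>carrier (Z_add A n). L_map A n (E_map A n \<phi>) = \<phi>)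
           \<and> (\<forall>\<Phi>\<in>carrier (Z_mult A n). E_map A n (L_map A n \<Phi>) = \<Phi>))
    \<and> (\<forall>n\<ge>3. \<exists>EE LL.
           (\<forall>\<phi>\<in>carrier (Z_add A n). EE (cls_add A n \<phi>) = cls_mult A n (E_map A n \<phi>))
           \<and> (\<forall>\<Phi>\<in>carrier (Z_mult A n). LL (cls_mult A n \<Phi>) = cls_add A n (L_map A n \<Phi>))
           \<and> group_iso EE (H_add A n) (H_mult A n)
           \<and> group_iso LL (H_mult A n) (H_add A n)
           \<and> (\<forall>x\<in>carrier (H_add A n). LL (EE x) = x)
           \<and> (\<forall>y\<in>carrier (H_mult A n). EE (LL y) = y))"
proof -
  interpret restricted_lie_algebra scale br pmap by (rule lie)
  interpret coord_algebra A
    unfolding A by (rule coord_algebra_coord_ring[OF char_pos vector_space_axioms fin])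
  show ?thesis
    using H_mult_0_iso H_mult_1_iso E_map_cocycle_iso E_map_cohomology_iso by blast
qed

end
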